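(* Assume (A1), (A2), (A3), (A4) of the context. For any preference vector $w\in\Delta^{++}_{m-1}$, suppose $\gamma\in\left(0,\frac1{2\rho_y}\right)$, $c_t=c_0$ for all $t$ with $c_0>0$, and $\delta\in\left(0,\frac18\right)$. Then there exist a sufficiently small $\alpha_{\theta,0}>0$ and monotonically decreasing sequences $\{\overline\alpha_{x,t}\},\{\overline\alpha_{y,t}\}$ such that, when $\alpha_{\theta,t}=\alpha_{\theta,0}(1+t)^{-\left(\frac38+\delta\right)}$, $1-\beta_t=\Theta\left(\alpha_{\theta,t}^{2/3}\right)$, $\alpha_{x,t}\in(0,\overline\alpha_{x,t}]$, $\alpha_{y,t}\in(0,\overline\alpha_{y,t}]$ and $\alpha_{x,t}\le\alpha_{y,t}$, for the iterates of the MB-MOMEHA algorithm there exists for each $t$ a multiplier $p_t\ge0$ such that, with $\varepsilon'_T:=g(x_T,y_T)-\upsilon_\gamma(x_T,y_T)$, $$\mathbb{E}[\varepsilon'_T]=\mathcal{O}(1),\qquad \min_{0\le t\le T}\mathbb{E}\left[H_{p_t}(x_{t+1},y_{t+1};\varepsilon'_{t+1})\right]=\mathcal{O}\left(T^{-\left(\frac18-\delta\right)}\right),$$ i.e. $\mathcal{O}(1)$-$\mathcal{O}(T^{-(1/8-\delta)})$-Pareto stationarity in the best case, in expectation. Furthermore, if $\mathbb{E}[\mathcal{P}_{c_t}(x_t,y_t)]$ is bounded above (uniformly in $t$), $c_t=c_0(1+t)^{\frac1{16}}$ and $\alpha_{\theta,t}=\alpha_{\theta,0}(1+t)^{-\frac38}$,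 then (the other conditions being unchanged) $$\mathbb{E}[\varepsilon'_T]=\mathcal{O}\left(T^{-\frac1{16}}\right),\qquad \min_{0\le t\le T}\mathbb{E}\left[H_{p_t}(x_{t+1},y_{t+1};\varepsilon'_{t+1})\right]=\mathcal{O}\left(T^{-\frac1{16}}\sqrt{\ln T}\right),$$ i.e. $\mathcal{O}(T^{-1/16})$-$\mathcal{O}(T^{-1/16}\sqrt{\ln T})$-Pareto stationarity in the best case, in expectation.
   Context: **Problem data.** $f_i(x,y)=\mathbb{E}_{\xi\sim\mathcal{D}_i}[f_i(x,y;\xi)]$ ($i=1,\dots,m$) and $g(x,y)=\mathbb{E}_{\varrho\sim\mathcal{D}_g}[g(x,y;\varrho)]$ are real functions on $\mathbb{R}^{d_x}\times\mathbb{R}^{d_y}$. $\Delta_{m-1}=\{\lambda\in\mathbb{R}^m:\lambda_i\ge0,\sum_i\lambda_i=1\}$ and $\Delta^{++}_{m-1}$ is its subset of vectors with all entries strictly positive. For a preference $w$, a smoothing parameter $\mu>0$ and ideal values $z_i$ with $z_i<f_i$ everywhere, the smooth Tchebycheff scalarization is $$F^{(\mathrm{STCH})}_w(x,y)=\frac1\mu\log\Big(\sum_{i=1}^m\exp\big(\mu w_i(f_i(x,y)-z_i)\big)\Big).$$ For $\gamma>0$, $\upsilon_\gamma(x,y)=\min_{\theta\in\mathbb{R}^{d_y}}\{g(x,\theta)+\frac1{2\gamma}\|\theta-y\|^2\}$. The penalized objective is $\mathcal{P}_{c}(x,y)=F^{(\mathrm{STCH})}_w(x,y)-\underline F+c\,(g(x,y)-\upsilon_\gamma(x,y))$,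 with $\underline F$ from (A1). **MB-MOMEHA algorithm.** Given $x_0,y_0$, $\theta_0=y_0$, $m_{\theta,0}=0,m_{x,0}=0,m_{y,0}=0$, step sizes $\alpha_{\theta,t},\alpha_{x,t},\alpha_{y,t}$, penalty factors $c_t$ and momentum parameters $\beta_t$. At iteration $t=0,1,\dots$ draw independent mini-batches $\xi_{x,t,i},\xi_{y,t,i}$ from $\mathcal{D}_i$ and $\varrho_{\theta,t},\varrho_{x,t},\varrho_{y,t}$ from $\mathcal{D}_g$ ($\hat\nabla$ denotes mini-batch stochastic gradients) and set successively $\hat d_{\theta,t}=\hat\nabla_yg(x_t,\theta_t;\varrho_{\theta,t})+\frac1\gamma(\theta_t-y_t)$, $m_{\theta,t+1}=\beta_tm_{\theta,t}+(1-\beta_t)\hat d_{\theta,t}$, $\theta_{t+1}=\theta_t-\alpha_{\theta,t}m_{\theta,t+1}$; $$\hat d_{x,t}=\sum_{i=1}^m\frac{\exp(\mu w_i(f_i(x_t,y_t;\xi_{x,t,i})-z_i))\,w_i\hat\nabla_xf_i(x_t,y_t;\xi_{x,t,i})}{c_t\sum_{j=1}^m\exp(\mu w_j(f_j(x_t,y_t;\xi_{x,t,j})-z_j))}+\hat\nabla_xg(x_t,y_t;\varrho_{x,t})-\hat\nabla_xg(x_t,\theta_{t+1};\varrho_{x,t}),$$ $m_{x,t+1}=\beta_tm_{x,t}+(1-\beta_t)\hat d_{x,t}$, $x_{t+1}=x_t-\alpha_{x,t}m_{x,t+1}$; $$\hat d_{y,t}=\sum_{i=1}^m\frac{\exp(\mu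 w_i(f_i(x_{t+1},y_t;\xi_{y,t,i})-z_i))\,w_i\hat\nabla_yf_i(x_{t+1},y_t;\xi_{y,t,i})}{c_t\sum_{j=1}^m\exp(\mu w_j(f_j(x_{t+1},y_t;\xi_{y,t,j})-z_j))}+\hat\nabla_yg(x_{t+1},y_t;\varrho_{y,t})+\frac1\gamma(\theta_{t+1}-y_t),$$ $m_{y,t+1}=\beta_tm_{y,t}+(1-\beta_t)\hat d_{y,t}$, $y_{t+1}=y_t-\alpha_{y,t}m_{y,t+1}$. The full-gradient counterparts along these iterates are $d_{x,t}=\frac1{c_t}\nabla_xF^{(\mathrm{STCH})}_w(x_t,y_t)+\nabla_xg(x_t,y_t)-\nabla_xg(x_t,\theta_{t+1})$ and $d_{y,t}=\frac1{c_t}\nabla_yF^{(\mathrm{STCH})}_w(x_{t+1},y_t)+\nabla_yg(x_{t+1},y_t)+\frac1\gamma(\theta_{t+1}-y_t)$. **Filtration.** $\mathcal{F}_t$ is the $\sigma$-algebra of all randomness drawn before iteration $t$; $\mathcal{F}_{\theta,t}=\mathcal{F}_t$, $\mathcal{F}_{x,t}=\sigma(\mathcal{F}_t,\varrho_{\theta,t})$, $\mathcal{F}_{y,t}=\sigma(\mathcal{F}_t,\varrho_{\theta,t},\varrho_{x,t},\xi_{x,t})$. The mini-batches forming $\hat d_{x,t}$, $\hat d_{y,t}$ are independent of $\mathcal{F}_{x,t}$, $\mathcal{F}_{y,t}$, respectively. **Assumptions.** (A1) Each $f_i$ is proper and bounded below; consequently $F^{(\mathrm{STCH})}_w$ is bounded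 below by a constant $\underline F>-\infty$. (A2) Each $f_i$ and $g$ are continuously differentiable with $L_f$- and $L_g$-Lipschitz gradients on $\mathbb{R}^{d_x}\times\mathbb{R}^{d_y}$, respectively; $F^{(\mathrm{STCH})}_w$ is differentiable with $L_F$-Lipschitz gradient (the paper lists this as part of the assumption). By smoothness $g$ is $(\rho_x,\rho_y)$-weakly convex, i.e. $g(x,y)+\frac{\rho_x}{2}\|x\|^2+\frac{\rho_y}{2}\|y\|^2$ is convex, with constants $\rho_x,\rho_y>0$. (A3) Almost surely, for every $t\ge0$: if $g(x_t,y_t)-\upsilon_\gamma(x_t,y_t)>0$ then $\nabla g(x_t,y_t)-\nabla\upsilon_\gamma(x_t,y_t)\neq0$. (A4) For the mini-batches drawn at iteration $t$, $\mathbb{E}[\hat\nabla g(x_t,\theta_t;\varrho)\mid\mathcal{F}_{\theta,t}]=\nabla g(x_t,\theta_t)$ and $\mathbb{E}[\|\hat\nabla g(x_t,\theta_t;\varrho)-\nabla g(x_t,\theta_t)\|^2\mid\mathcal{F}_{\theta,t}]\le\sigma^2$. For $\cdot\in\{x,y\}$ and all $t\ge0$, $\mathbb{E}[\hat d_{\cdot,t}\mid\mathcal{F}_{\cdot,t}]=d_{\cdot,t}+b_{\cdot,t}$ and $\mathbb{E}[\|\hat d_{\cdot,t}-d_{\cdot,t}-b_{\cdot,t}\|^2\mid\mathcal{F}_{\cdot,t}]\le\sigma^2$, where the bias $b_{\cdot,t}$ is $\mathcal{F}_{\cdot,t}$-measurable with $\|b_{\cdot,t}\|=\mathcal{O}(\alpha_{\theta,t}^{2/3})$.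 **Stationarity measure.** For $(x,y)$ with $g(x,y)-\upsilon_\gamma(x,y)\le\varepsilon_c$ and $p\ge0$, $$H_p(x,y;\varepsilon_c)=\min_{\lambda\in\Delta_{m-1}}\Big\|\sum_{i=1}^m\lambda_i\nabla f_i(x,y)+p\,(\nabla g(x,y)-\nabla\upsilon_\gamma(x,y))\Big\|,$$ so $H_p(x,y;\varepsilon_c)\le\varepsilon_s$ means that some $\lambda\in\Delta_{m-1}$ makes the norm at most $\varepsilon_s$. The point $(x,y)$ is $\varepsilon_c$-$\varepsilon_s$-Pareto stationary if $g(x,y)-\upsilon_\gamma(x,y)\le\varepsilon_c$ and $H_p(x,y;\varepsilon_c)\le\varepsilon_s$ for some $p\ge0$. Here $\varepsilon'_t=g(x_t,y_t)-\upsilon_\gamma(x_t,y_t)$, and $p_t$ may be random (depend on the iterates). The $\mathcal{O}$-notation is for $T\to\infty$; $\Theta$ is for $t\to\infty$.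
   Formalization: As stated the claim fails for summable α_{x,t} (m=1, f=x²/2, g=0, x_0=1). Added: α_{x,t} is, for large t, at least a constant times min of the two upper bounds for α_{x,t} and α_{y,t}; also 0≤β_t<1 is made explicit. *)

theory Defs
  imports "HOL-Probability.Probability" "HOL-Library.Landau_Symbols"
begin

type_synonym ('dx, 'dy) pt = "(real^'dx) \<times> (real^'dy)"

definition nabla :: "('v::real_inner \<Rightarrow> real) \<Rightarrow> 'v \<Rightarrow> 'v" where
  "nabla h p = (THE D. GDERIV h p :> D)"

definition lipschitz_gradient :: "real \<Rightarrow> ('v::real_inner \<Rightarrow> real) \<Rightarrow> bool" where
  "lipschitz_gradient L h \<longleftrightarrow>
     (\<forall>p. h differentiable at p) \<and> continuous_on UNIV (nabla h) \<and> L-lipschitz_on UNIV (nabla h)"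

definition prob_simplex :: "(real^'m::finite) set" where
  "prob_simplex = {l. (\<forall>i. 0 \<le> l $ i) \<and> (\<Sum>i\<in>UNIV. l $ i) = 1}"

definition prob_simplex_pos :: "(real^'m::finite) set" where
  "prob_simplex_pos = {l\<in>prob_simplex. \<forall>i. 0 < l $ i}"

text \<open>
  The stochastic bilevel problem together with the parameters of its scalarization.
  The index type \<open>'m\<close> enumerates the upper-level objectives. The fields \<open>fsample\<close> and
  \<open>gsample\<close> are the functions of a point and one sample; the gradients with respect to the
  two blocks of variables are the two components of the gradient on the product space.
\<close>

record ('s, 'r, 'm, 'dx, 'dy) problem =
  Df :: "'m::finite \<Rightarrow> 's measure"
  Dg :: "'r measure"
  fsample :: "'m \<Rightarrow> ('dx::finite, 'dy::finite) pt \<Rightarrow> 's \<Rightarrow> real"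
  gsample :: "('dx, 'dy) pt \<Rightarrow> 'r \<Rightarrow> real"
  pref :: "real^'m"
  smoothing :: real
  ideal :: "real^'m"
  gam :: real

definition objf :: "('s,'r,'m::finite,'dx::finite,'dy::finite) problem \<Rightarrow> 'm \<Rightarrow> ('dx,'dy) pt \<Rightarrow> real" where
  "objf P i p = (\<integral>s. fsample P i p s \<partial>Df P i)"

definition objg :: "('s,'r,'m::finite,'dx::finite,'dy::finite) problem \<Rightarrow> ('dx,'dy) pt \<Rightarrow> real" where
  "objg P p = (\<integral>s. gsample P p s \<partial>Dg P)"

text \<open>
  The joint measurability of the sample gradients is automatic when the sample functions are
  differentiable in the point. Differentiability of every single sample is not required.
\<close>

definition stochastic_data :: "('s,'r,'m::finite,'dx::finite,'dy::finite) problem \<Rightarrow> bool" where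
  "stochastic_data P \<longleftrightarrow>
     (\<forall>i. prob_space (Df P i)) \<and> prob_space (Dg P) \<and>
     (\<forall>i. (\<lambda>(p, s). fsample P i p s) \<in> borel_measurable (borel \<Otimes>\<^sub>M Df P i)) \<and>
     (\<lambda>(p, s). gsample P p s) \<in> borel_measurable (borel \<Otimes>\<^sub>M Dg P) \<and>
     (\<forall>i. (\<lambda>(p, s). nabla (\<lambda>q. fsample P i q s) p) \<in> borel_measurable (borel \<Otimes>\<^sub>M Df P i)) \<and>
     (\<lambda>(p, s). nabla (\<lambda>q. gsample P q s) p) \<in> borel_measurable (borel \<Otimes>\<^sub>M Dg P) \<and>
     (\<forall>i p. integrable (Df P i) (fsample P i p)) \<and>
     (\<forall>p. integrable (Dg P) (gsample P p))"

definition stch :: "('s,'r,'m::finite,'dx::finite,'dy::finite) problem \<Rightarrow> ('dx,'dy) pt \<Rightarrow> real" where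
  "stch P p = 1 / smoothing P *
     ln (\<Sum>i\<in>UNIV. exp (smoothing P * pref P $ i * (objf P i p - ideal P $ i)))"

text \<open>
  The infima below are the minima: the simplex is compact, and for \<open>gam P < 1 / \<rho>y\<close> the
  function of \<open>\<theta>\<close> is continuous and strongly convex.
\<close>

definition moreau :: "('s,'r,'m::finite,'dx::finite,'dy::finite) problem \<Rightarrow> ('dx,'dy) pt \<Rightarrow> real" where
  "moreau P = (\<lambda>(x, y). INF \<theta>. objg P (x, \<theta>) + 1 / (2 * gam P) * (norm (\<theta> - y))\<^sup>2)"

definition gap :: "('s,'r,'m::finite,'dx::finite,'dy::finite) problem \<Rightarrow> ('dx,'dy) pt \<Rightarrow> real" where
  "gap P p = objg P p - moreau P p"

definition penalized :: "('s,'r,'m::finite,'dx::finite,'dy::finite) problem \<Rightarrow> real \<Rightarrow> real \<Rightarrow> ('dx,'dy) pt \<Rightarrow> real" where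
  "penalized P Flow c p = stch P p - Flow + c * gap P p"

text \<open>The measure is only defined on points whose lower-level gap is at most \<open>\<epsilon>c\<close>.\<close>

definition stat_measure ::
  "('s,'r,'m::finite,'dx::finite,'dy::finite) problem \<Rightarrow> real \<Rightarrow> real \<Rightarrow> ('dx,'dy) pt \<Rightarrow> real" where
  "stat_measure P pm \<epsilon>c p =
     (if gap P p \<le> \<epsilon>c
      then INF l\<in>prob_simplex. norm ((\<Sum>i\<in>UNIV. l $ i *\<^sub>R nabla (objf P i) p)
                                + pm *\<^sub>R (nabla (objg P) p - nabla (moreau P) p))
      else undefined)"

text \<open>
  Labels of the mini-batches: the iteration and, for the objectives, the index.
  A mini-batch of size \<open>n\<close> is a function on \<open>{..<n}\<close>. Batch sizes are arbitrary and may vary.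
\<close>

datatype 'm draw = GTheta nat | GX nat | FX nat 'm | GY nat | FY nat 'm

fun draw_time :: "'m draw \<Rightarrow> nat" where
  "draw_time (GTheta t) = t"
| "draw_time (GX t) = t"
| "draw_time (FX t i) = t"
| "draw_time (GY t) = t"
| "draw_time (FY t i) = t"

record ('w, 's, 'r, 'm) batches =
  bsize :: "'m draw \<Rightarrow> nat"
  rho_theta :: "nat \<Rightarrow> 'w \<Rightarrow> nat \<Rightarrow> 'r"
  rho_x :: "nat \<Rightarrow> 'w \<Rightarrow> nat \<Rightarrow> 'r"
  rho_y :: "nat \<Rightarrow> 'w \<Rightarrow> nat \<Rightarrow> 'r"
  xi_x :: "nat \<Rightarrow> 'm \<Rightarrow> 'w \<Rightarrow> nat \<Rightarrow> 's"
  xi_y :: "nat \<Rightarrow> 'm \<Rightarrow> 'w \<Rightarrow> nat \<Rightarrow> 's"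

definition minibatch :: "'w measure \<Rightarrow> 'a measure \<Rightarrow> nat \<Rightarrow> ('w \<Rightarrow> nat \<Rightarrow> 'a) \<Rightarrow> bool" where
  "minibatch M D n X \<longleftrightarrow> 0 < n \<and> X \<in> M \<rightarrow>\<^sub>M (\<Pi>\<^sub>M k\<in>{..<n}. D) \<and>
     distr M (\<Pi>\<^sub>M k\<in>{..<n}. D) X = (\<Pi>\<^sub>M k\<in>{..<n}. D)"

definition batch_algebra :: "'w measure \<Rightarrow> 'a measure \<Rightarrow> nat \<Rightarrow> ('w \<Rightarrow> nat \<Rightarrow> 'a) \<Rightarrow> 'w measure" where
  "batch_algebra M D n X = vimage_algebra (space M) X (\<Pi>\<^sub>M k\<in>{..<n}. D)"

fun draw_algebra ::
  "('s,'r,'m::finite,'dx::finite,'dy::finite) problem \<Rightarrow> 'w measure \<Rightarrow> ('w,'s,'r,'m) batches \<Rightarrow> 'm draw \<Rightarrow> 'w measure" where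
  "draw_algebra P M B (GTheta t) = batch_algebra M (Dg P) (bsize B (GTheta t)) (rho_theta B t)"
| "draw_algebra P M B (GX t) = batch_algebra M (Dg P) (bsize B (GX t)) (rho_x B t)"
| "draw_algebra P M B (FX t i) = batch_algebra M (Df P i) (bsize B (FX t i)) (xi_x B t i)"
| "draw_algebra P M B (GY t) = batch_algebra M (Dg P) (bsize B (GY t)) (rho_y B t)"
| "draw_algebra P M B (FY t i) = batch_algebra M (Df P i) (bsize B (FY t i)) (xi_y B t i)"

definition independent_minibatches ::
  "('s,'r,'m::finite,'dx::finite,'dy::finite) problem \<Rightarrow> 'w measure \<Rightarrow> ('w,'s,'r,'m) batches \<Rightarrow> bool" where
  "independent_minibatches P M B \<longleftrightarrow>
     (\<forall>t. minibatch M (Dg P) (bsize B (GTheta t)) (rho_theta B t) \<and>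
          minibatch M (Dg P) (bsize B (GX t)) (rho_x B t) \<and>
          minibatch M (Dg P) (bsize B (GY t)) (rho_y B t) \<and>
          (\<forall>i. minibatch M (Df P i) (bsize B (FX t i)) (xi_x B t i) \<and>
               minibatch M (Df P i) (bsize B (FY t i)) (xi_y B t i))) \<and>
     prob_space.indep_sets M (\<lambda>l. sets (draw_algebra P M B l)) UNIV"

definition generated ::
  "('s,'r,'m::finite,'dx::finite,'dy::finite) problem \<Rightarrow> 'w measure \<Rightarrow> ('w,'s,'r,'m) batches \<Rightarrow> 'm draw set \<Rightarrow> 'w measure" where
  "generated P M B J = sigma (space M) (\<Union>l\<in>J. sets (draw_algebra P M B l))"

definition filt_theta ::
  "('s,'r,'m::finite,'dx::finite,'dy::finite) problem \<Rightarrow> 'w measure \<Rightarrow> ('w,'s,'r,'m) batches \<Rightarrow> nat \<Rightarrow> 'w measure" where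
  "filt_theta P M B t = generated P M B {l. draw_time l < t}"

definition filt_x ::
  "('s,'r,'m::finite,'dx::finite,'dy::finite) problem \<Rightarrow> 'w measure \<Rightarrow> ('w,'s,'r,'m) batches \<Rightarrow> nat \<Rightarrow> 'w measure" where
  "filt_x P M B t = generated P M B ({l. draw_time l < t} \<union> {GTheta t})"

definition filt_y ::
  "('s,'r,'m::finite,'dx::finite,'dy::finite) problem \<Rightarrow> 'w measure \<Rightarrow> ('w,'s,'r,'m) batches \<Rightarrow> nat \<Rightarrow> 'w measure" where
  "filt_y P M B t = generated P M B ({l. draw_time l < t} \<union> {GTheta t, GX t} \<union> range (FX t))"

definition batch_avg :: "nat \<Rightarrow> ('a \<Rightarrow> 'v::real_vector) \<Rightarrow> (nat \<Rightarrow> 'a) \<Rightarrow> 'v" where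
  "batch_avg n h b = (\<Sum>k<n. h (b k)) /\<^sub>R real n"

definition fhat ::
  "('s,'r,'m::finite,'dx::finite,'dy::finite) problem \<Rightarrow> 'm \<Rightarrow> nat \<Rightarrow> ('dx,'dy) pt \<Rightarrow> (nat \<Rightarrow> 's) \<Rightarrow> real" where
  "fhat P i n p b = batch_avg n (fsample P i p) b"

definition grad_fhat ::
  "('s,'r,'m::finite,'dx::finite,'dy::finite) problem \<Rightarrow> 'm \<Rightarrow> nat \<Rightarrow> ('dx,'dy) pt \<Rightarrow> (nat \<Rightarrow> 's) \<Rightarrow> ('dx,'dy) pt" where
  "grad_fhat P i n p b = batch_avg n (\<lambda>s. nabla (\<lambda>q. fsample P i q s) p) b"

definition grad_ghat ::
  "('s,'r,'m::finite,'dx::finite,'dy::finite) problem \<Rightarrow> nat \<Rightarrow> ('dx,'dy) pt \<Rightarrow> (nat \<Rightarrow> 'r) \<Rightarrow> ('dx,'dy) pt" where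
  "grad_ghat P n p b = batch_avg n (\<lambda>s. nabla (\<lambda>q. gsample P q s) p) b"

text \<open>The scalarized part of the directions, divided by the penalty factor \<open>c\<close>; \<open>b i\<close> is the batch
  of objective \<open>i\<close>, of size \<open>n i\<close>.\<close>

definition stch_dir ::
  "('s,'r,'m::finite,'dx::finite,'dy::finite) problem \<Rightarrow> real \<Rightarrow> ('m \<Rightarrow> nat) \<Rightarrow> ('dx,'dy) pt \<Rightarrow> ('m \<Rightarrow> nat \<Rightarrow> 's) \<Rightarrow> ('dx,'dy) pt" where
  "stch_dir P c n p b =
     (let e = (\<lambda>i. exp (smoothing P * pref P $ i * (fhat P i (n i) p (b i) - ideal P $ i)))
      in \<Sum>i\<in>UNIV. (e i * pref P $ i / (c * (\<Sum>j\<in>UNIV. e j))) *\<^sub>R grad_fhat P i (n i) p (b i))"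

record schedule =
  penalty :: "nat \<Rightarrow> real"
  step_theta :: "nat \<Rightarrow> real"
  step_x :: "nat \<Rightarrow> real"
  step_y :: "nat \<Rightarrow> real"
  momentum :: "nat \<Rightarrow> real"

record ('w, 'dx, 'dy) iterates =
  it_x :: "nat \<Rightarrow> 'w \<Rightarrow> real^'dx::finite"
  it_y :: "nat \<Rightarrow> 'w \<Rightarrow> real^'dy::finite"
  it_theta :: "nat \<Rightarrow> 'w \<Rightarrow> real^'dy"
  mom_x :: "nat \<Rightarrow> 'w \<Rightarrow> real^'dx"
  mom_y :: "nat \<Rightarrow> 'w \<Rightarrow> real^'dy"
  mom_theta :: "nat \<Rightarrow> 'w \<Rightarrow> real^'dy"

definition dhat_theta ::
  "('s,'r,'m::finite,'dx::finite,'dy::finite) problem \<Rightarrow> ('w,'s,'r,'m) batches \<Rightarrow> ('w,'dx,'dy) iterates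
   \<Rightarrow> nat \<Rightarrow> 'w \<Rightarrow> real^'dy" where
  "dhat_theta P B R t \<omega> =
     snd (grad_ghat P (bsize B (GTheta t)) (it_x R t \<omega>, it_theta R t \<omega>) (rho_theta B t \<omega>))
     + (1 / gam P) *\<^sub>R (it_theta R t \<omega> - it_y R t \<omega>)"

definition dhat_x ::
  "('s,'r,'m::finite,'dx::finite,'dy::finite) problem \<Rightarrow> schedule \<Rightarrow> ('w,'s,'r,'m) batches \<Rightarrow> ('w,'dx,'dy) iterates
   \<Rightarrow> nat \<Rightarrow> 'w \<Rightarrow> real^'dx" where
  "dhat_x P S B R t \<omega> =
     fst (stch_dir P (penalty S t) (\<lambda>i. bsize B (FX t i)) (it_x R t \<omega>, it_y R t \<omega>) (\<lambda>i. xi_x B t i \<omega>))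
     + fst (grad_ghat P (bsize B (GX t)) (it_x R t \<omega>, it_y R t \<omega>) (rho_x B t \<omega>))
     - fst (grad_ghat P (bsize B (GX t)) (it_x R t \<omega>, it_theta R (t + 1) \<omega>) (rho_x B t \<omega>))"

definition dhat_y ::
  "('s,'r,'m::finite,'dx::finite,'dy::finite) problem \<Rightarrow> schedule \<Rightarrow> ('w,'s,'r,'m) batches \<Rightarrow> ('w,'dx,'dy) iterates
   \<Rightarrow> nat \<Rightarrow> 'w \<Rightarrow> real^'dy" where
  "dhat_y P S B R t \<omega> =
     snd (stch_dir P (penalty S t) (\<lambda>i. bsize B (FY t i)) (it_x R (t + 1) \<omega>, it_y R t \<omega>) (\<lambda>i. xi_y B t i \<omega>))
     + snd (grad_ghat P (bsize B (GY t)) (it_x R (t + 1) \<omega>, it_y R t \<omega>) (rho_y B t \<omega>))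
     + (1 / gam P) *\<^sub>R (it_theta R (t + 1) \<omega> - it_y R t \<omega>)"

definition momeha ::
  "('s,'r,'m::finite,'dx::finite,'dy::finite) problem \<Rightarrow> schedule \<Rightarrow> real^'dx \<Rightarrow> real^'dy \<Rightarrow> 'w measure
   \<Rightarrow> ('w,'s,'r,'m) batches \<Rightarrow> ('w,'dx,'dy) iterates \<Rightarrow> bool" where
  "momeha P S x0 y0 M B R \<longleftrightarrow>
     (\<forall>\<omega>\<in>space M.
        it_x R 0 \<omega> = x0 \<and> it_y R 0 \<omega> = y0 \<and> it_theta R 0 \<omega> = y0 \<and>
        mom_theta R 0 \<omega> = 0 \<and> mom_x R 0 \<omega> = 0 \<and> mom_y R 0 \<omega> = 0 \<and>
        (\<forall>t. mom_theta R (t + 1) \<omega> = momentum S t *\<^sub>R mom_theta R t \<omega> + (1 - momentum S t) *\<^sub>R dhat_theta P B R t \<omega> \<and>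
             it_theta R (t + 1) \<omega> = it_theta R t \<omega> - step_theta S t *\<^sub>R mom_theta R (t + 1) \<omega> \<and>
             mom_x R (t + 1) \<omega> = momentum S t *\<^sub>R mom_x R t \<omega> + (1 - momentum S t) *\<^sub>R dhat_x P S B R t \<omega> \<and>
             it_x R (t + 1) \<omega> = it_x R t \<omega> - step_x S t *\<^sub>R mom_x R (t + 1) \<omega> \<and>
             mom_y R (t + 1) \<omega> = momentum S t *\<^sub>R mom_y R t \<omega> + (1 - momentum S t) *\<^sub>R dhat_y P S B R t \<omega> \<and>
             it_y R (t + 1) \<omega> = it_y R t \<omega> - step_y S t *\<^sub>R mom_y R (t + 1) \<omega>))"

definition d_x ::
  "('s,'r,'m::finite,'dx::finite,'dy::finite) problem \<Rightarrow> schedule \<Rightarrow> ('w,'dx,'dy) iterates \<Rightarrow> nat \<Rightarrow> 'w \<Rightarrow> real^'dx" where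
  "d_x P S R t \<omega> =
     (1 / penalty S t) *\<^sub>R fst (nabla (stch P) (it_x R t \<omega>, it_y R t \<omega>))
     + fst (nabla (objg P) (it_x R t \<omega>, it_y R t \<omega>))
     - fst (nabla (objg P) (it_x R t \<omega>, it_theta R (t + 1) \<omega>))"

definition d_y ::
  "('s,'r,'m::finite,'dx::finite,'dy::finite) problem \<Rightarrow> schedule \<Rightarrow> ('w,'dx,'dy) iterates \<Rightarrow> nat \<Rightarrow> 'w \<Rightarrow> real^'dy" where
  "d_y P S R t \<omega> =
     (1 / penalty S t) *\<^sub>R snd (nabla (stch P) (it_x R (t + 1) \<omega>, it_y R t \<omega>))
     + snd (nabla (objg P) (it_x R (t + 1) \<omega>, it_y R t \<omega>))
     + (1 / gam P) *\<^sub>R (it_theta R (t + 1) \<omega> - it_y R t \<omega>)"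

text \<open>
  Besides the upper bounds, \<open>step_x\<close> must not be of smaller order than the largest value
  \<open>min (ubx t) (uby t)\<close> admitted by the other constraints on it. Without such a bound
  the step sizes may be summable, and the iterates may then converge to a point that is not
  stationary (take one objective \<open>x\<^sup>2 / 2\<close> and the lower-level function \<open>0\<close>).
\<close>

definition admissible :: "(nat \<Rightarrow> real) \<Rightarrow> (nat \<Rightarrow> real) \<Rightarrow> schedule \<Rightarrow> bool" where
  "admissible ubx uby S \<longleftrightarrow>
     (\<forall>t. 0 < step_x S t \<and> step_x S t \<le> ubx t \<and> 0 < step_y S t \<and> step_y S t \<le> uby t \<and>
          step_x S t \<le> step_y S t) \<and>
     (\<forall>t. 0 \<le> momentum S t \<and> momentum S t < 1) \<and>
     (\<lambda>t. 1 - momentum S t) \<in> \<Theta>(\<lambda>t. step_theta S t powr (2/3)) \<and>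
     step_x S \<in> \<Omega>(\<lambda>t. min (ubx t) (uby t))"

definition constraint_regular ::
  "('s,'r,'m::finite,'dx::finite,'dy::finite) problem \<Rightarrow> 'w measure \<Rightarrow> ('w,'dx,'dy) iterates \<Rightarrow> bool" where
  "constraint_regular P M R \<longleftrightarrow>
     (AE \<omega> in M. \<forall>t. let p = (it_x R t \<omega>, it_y R t \<omega>) in
        gap P p > 0 \<longrightarrow> nabla (objg P) p - nabla (moreau P) p \<noteq> 0)"

text \<open>
  The library's conditional expectation is real-valued; vectors are treated coordinatewise.
  The conditional second moment is taken in \<^typ>\<open>ennreal\<close>, so that no integrability is presupposed.
\<close>

definition vec_cond_exp :: "'w measure \<Rightarrow> 'w measure \<Rightarrow> ('w \<Rightarrow> 'v::euclidean_space) \<Rightarrow> 'w \<Rightarrow> 'v" where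
  "vec_cond_exp M G X \<omega> = (\<Sum>b\<in>Basis. real_cond_exp M G (\<lambda>\<omega>. X \<omega> \<bullet> b) \<omega> *\<^sub>R b)"

definition mean_variance ::
  "'w measure \<Rightarrow> 'w measure \<Rightarrow> real \<Rightarrow> ('w \<Rightarrow> 'v::euclidean_space) \<Rightarrow> ('w \<Rightarrow> 'v) \<Rightarrow> bool" where
  "mean_variance M G \<sigma> X c \<longleftrightarrow>
     (AE \<omega> in M. vec_cond_exp M G X \<omega> = c \<omega>) \<and>
     (AE \<omega> in M. nn_cond_exp M G (\<lambda>\<omega>. ennreal ((norm (X \<omega> - c \<omega>))\<^sup>2)) \<omega> \<le> ennreal (\<sigma>\<^sup>2))"

definition stochastic_directions ::
  "('s,'r,'m::finite,'dx::finite,'dy::finite) problem \<Rightarrow> schedule \<Rightarrow> real \<Rightarrow> 'w measure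
   \<Rightarrow> ('w,'s,'r,'m) batches \<Rightarrow> ('w,'dx,'dy) iterates \<Rightarrow> bool" where
  "stochastic_directions P S \<sigma> M B R \<longleftrightarrow>
     (\<forall>t. mean_variance M (filt_theta P M B t) \<sigma>
            (\<lambda>\<omega>. grad_ghat P (bsize B (GTheta t)) (it_x R t \<omega>, it_theta R t \<omega>) (rho_theta B t \<omega>))
            (\<lambda>\<omega>. nabla (objg P) (it_x R t \<omega>, it_theta R t \<omega>))) \<and>
     (\<exists>bx by K.
        (\<forall>t. bx t \<in> borel_measurable (filt_x P M B t) \<and> by t \<in> borel_measurable (filt_y P M B t) \<and>
             mean_variance M (filt_x P M B t) \<sigma> (dhat_x P S B R t) (\<lambda>\<omega>. d_x P S R t \<omega> + bx t \<omega>) \<and>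
             mean_variance M (filt_y P M B t) \<sigma> (dhat_y P S B R t) (\<lambda>\<omega>. d_y P S R t \<omega> + by t \<omega>) \<and>
             (AE \<omega> in M. norm (bx t \<omega>) \<le> K * step_theta S t powr (2/3)) \<and>
             (AE \<omega> in M. norm (by t \<omega>) \<le> K * step_theta S t powr (2/3))))"

definition iter_gap ::
  "('s,'r,'m::finite,'dx::finite,'dy::finite) problem \<Rightarrow> ('w,'dx,'dy) iterates \<Rightarrow> nat \<Rightarrow> 'w \<Rightarrow> real" where
  "iter_gap P R t \<omega> = gap P (it_x R t \<omega>, it_y R t \<omega>)"

definition iter_stat ::
  "('s,'r,'m::finite,'dx::finite,'dy::finite) problem \<Rightarrow> ('w,'dx,'dy) iterates \<Rightarrow> (nat \<Rightarrow> 'w \<Rightarrow> real)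
   \<Rightarrow> nat \<Rightarrow> 'w \<Rightarrow> real" where
  "iter_stat P R pm t \<omega> =
     stat_measure P (pm t \<omega>) (iter_gap P R (t + 1) \<omega>) (it_x R (t + 1) \<omega>, it_y R (t + 1) \<omega>)"

text \<open>
  Integrability is stated explicitly because the Bochner integral of a non-integrable function
  is \<open>0\<close>.
\<close>

definition stationary_in_expectation ::
  "('s,'r,'m::finite,'dx::finite,'dy::finite) problem \<Rightarrow> 'w measure \<Rightarrow> ('w,'dx,'dy) iterates
   \<Rightarrow> (nat \<Rightarrow> real) \<Rightarrow> (nat \<Rightarrow> real) \<Rightarrow> bool" where
  "stationary_in_expectation P M R rc rs \<longleftrightarrow>
     (\<exists>pm. (\<forall>t. pm t \<in> borel_measurable M \<and> (\<forall>\<omega>\<in>space M. 0 \<le> pm t \<omega>) \<and>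
                integrable M (iter_stat P R pm t)) \<and>
           (\<forall>t. integrable M (iter_gap P R t)) \<and>
           (\<lambda>T. \<integral>\<omega>. iter_gap P R T \<omega> \<partial>M) \<in> O(rc) \<and>
           (\<lambda>T. MIN t\<in>{0..T}. \<integral>\<omega>. iter_stat P R pm t \<omega> \<partial>M) \<in> O(rs))"

end

theory Submission
  imports Defs "HOL-Real_Asymp.Real_Asymp"
begin

text \<open>
  Take \<open>r t = (1 + t) powr (-3/4)\<close> as the bound on both upper step sizes, let \<open>a\<close> be the lower step
  size, and put \<open>s = a powr (2/3)\<close>. Since \<open>r/a\<close>, \<open>r/s\<close> and \<open>a/s\<close> all tend to zero, no smallness of
  the constants is needed: the tracking error \<open>h\<close> of the proximal point and the momentum errors \<open>U\<close>, \<open>V\<close>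
  contract eventually, and a weighted sum of the expected penalized objective (divided by the
  penalty factor) with \<open>(r/a) h\<close>, \<open>(r/s) U\<close> and \<open>(r/s) V\<close> decreases by a multiple of \<open>r\<close> times the expected squared
  gradient, up to an error of order \<open>r s\<close>. The upper-level momentum is compared with the
  exact gradient of the penalized objective, so that the tracking error enters as a bias. The sum of
  \<open>r s\<close> is bounded for the first schedule and logarithmic for the second.
\<close>

section \<open>Gradients of smooth functions\<close>

text \<open>The errors spoil one another in a loop: descent is spoiled by \<open>v\<close>,
  \<open>v\<close> by the tracking error \<open>H\<close>, \<open>H\<close> by \<open>u\<close>, and
  \<open>U\<close> again by \<open>h\<close>. The weights are chosen along this chain, each so large
  that the contraction of its error absorbs what the previous link leaves over. The loop closes only
  through a term with the factor \<open>(a / s)^2\<close>, so no circular condition on the constants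
  arises. Every displacement of the upper iterates is charged to the expected squared momentum
  \<open>N\<close>, which the descent step produces with a negative sign. Dividing the objective by
  the penalty factor keeps the Lipschitz constant of its gradient uniform in \<open>t\<close>. It
  also makes a growing penalty harmless for the value, because \<open>stch P\<close> stays above
  \<open>Flow\<close>. The gradient, however, does change with the penalty; this drift is where a
  bound on the expected penalized objective enters. The step sizes sum to order
  \<open>T powr (1/4)\<close>, so the best expected squared gradient decays with exponent
  \<open>-1/4\<close>, up to the sum of \<open>r * s\<close>. Multiplying by the penalty to return
  to the Pareto combination costs another \<open>1/16\<close> when the penalty grows.\<close>

lemma GDERIV_unique: "GDERIV h p :> D \<Longrightarrow> GDERIV h p :> E \<Longrightarrow> D = E"
proof -
  assume "GDERIV h p :> D" "GDERIV h p :> E"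
  then have "(\<lambda>v. inner v D) = (\<lambda>v. inner v E)"
    unfolding gderiv_def by (rule has_derivative_unique)
  then have "inner (D - E) D = inner (D - E) E" by meson
  then have "inner (D - E) (D - E) = 0" by (simp add: inner_diff_right)
  then show "D = E" by simp
qed

lemma nabla_eq: "GDERIV h p :> D \<Longrightarrow> nabla h p = D"
  unfolding nabla_def by (rule the_equality) (auto intro: GDERIV_unique)

text \<open>\<open>nabla\<close> is a definite description and means something only once a gradient
  exists; Riesz representation supplies one, with the values of the derivative on the basis as
  coordinates.\<close>

lemma GDERIV_nabla:
  fixes h :: "'v::euclidean_space \<Rightarrow> real"
  assumes "h differentiable at p"
  shows "GDERIV h p :> nabla h p"
proof -
  obtain f' where f': "(h has_derivative f') (at p)"
    using assms by (auto simp: differentiable_def)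
  then interpret bounded_linear f' by (rule has_derivative_bounded_linear)
  define D where "D = (\<Sum>b\<in>Basis. f' b *\<^sub>R b)"
  have "f' v = inner v D" for v
  proof -
    have "f' v = f' (\<Sum>b\<in>Basis. inner v b *\<^sub>R b)" by (simp add: euclidean_representation)
    also have "\<dots> = (\<Sum>b\<in>Basis. inner v b * f' b)" by (simp add: sum scaleR)
    also have "\<dots> = inner v D" by (simp add: D_def inner_sum_right mult.commute)
    finally show ?thesis .
  qed
  then have "GDERIV h p :> D" using f' unfolding gderiv_def by presburger
  then show ?thesis using nabla_eq by metis
qed

lemma lipschitz_gradientD:
  fixes h :: "'v::euclidean_space \<Rightarrow> real"
  assumes "lipschitz_gradient L h"
  shows "GDERIV h p :> nabla h p" and "L-lipschitz_on UNIV (nabla h)"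
  using assms by (auto simp: lipschitz_gradient_def intro: GDERIV_nabla)

text \<open>The mean value theorem along the segment reduces the increment to the gradient at one
  intermediate point. Integration would give \<open>L / 2\<close>; the constant \<open>L\<close> is
  good enough and needs no integral. Two-sidedness serves the envelope and the integrability of
  smooth functions.\<close>

lemma gradient_quadratic_bound:
  fixes h :: "'v::real_inner \<Rightarrow> real"
  assumes G: "\<And>p. GDERIV h p :> G p" and lip: "L-lipschitz_on UNIV G"
  shows "\<bar>h q - h p - inner (q - p) (G p)\<bar> \<le> L * (norm (q - p))\<^sup>2"
proof -
  let ?k = "\<lambda>t. h (p + t *\<^sub>R (q - p))"
  have der: "(?k has_derivative (\<lambda>s. inner (s *\<^sub>R (q - p)) (G (p + t *\<^sub>R (q - p))))) (at t)" for t
  proof -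
    have 1: "((\<lambda>t. p + t *\<^sub>R (q - p)) has_derivative (\<lambda>s. s *\<^sub>R (q - p))) (at t)"
      by (auto intro!: derivative_eq_intros)
    show ?thesis
      using has_derivative_compose[OF 1 G[unfolded gderiv_def]] by simp
  qed
  obtain x where x: "0 < x" "x < 1"
      and "?k 1 - ?k 0 = inner ((1 - 0) *\<^sub>R (q - p)) (G (p + x *\<^sub>R (q - p)))"
  proof (rule mvt[of 0 1 ?k "\<lambda>t s. inner (s *\<^sub>R (q - p)) (G (p + t *\<^sub>R (q - p)))"])
    show "continuous_on {0..1} ?k"
      by (intro continuous_at_imp_continuous_on ballI has_derivative_continuous[OF der])
  qed (use der in auto)
  then have "h q - h p - inner (q - p) (G p) = inner (q - p) (G (p + x *\<^sub>R (q - p)) - G p)"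
    by (simp add: inner_diff_right)
  then have "\<bar>h q - h p - inner (q - p) (G p)\<bar> \<le> norm (q - p) * norm (G (p + x *\<^sub>R (q - p)) - G p)"
    by (metis Cauchy_Schwarz_ineq2)
  also have "norm (G (p + x *\<^sub>R (q - p)) - G p) \<le> L * norm (x *\<^sub>R (q - p))"
    using lipschitz_onD[OF lip, of "p + x *\<^sub>R (q - p)" p] by (simp add: dist_norm)
  also have "\<dots> \<le> L * norm (q - p)"
    using x lipschitz_on_nonneg[OF lip] by (intro mult_left_mono) (auto simp: mult_left_le_one_le)
  finally show ?thesis
    by (simp add: power2_eq_square mult.left_commute mult_left_mono)
qed

text \<open>A quadratic error bound at a single point already identifies the gradient there. It
  makes the Moreau envelope differentiable without differentiating the proximal map.\<close>

lemma GDERIV_of_quadratic_bound: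
  fixes h :: "'v::real_inner \<Rightarrow> real"
  assumes bound: "\<And>q. \<bar>h q - h p - inner (q - p) D\<bar> \<le> C * (norm (q - p))\<^sup>2"
  shows "GDERIV h p :> D"
  unfolding gderiv_def has_derivative_at'
proof (intro conjI allI impI)
  show "bounded_linear (\<lambda>v. inner v D)" by (rule bounded_linear_inner_left)
  fix e :: real assume "0 < e"
  \<comment> \<open>The \<open>+ 1\<close> avoids division by zero and makes the final estimate
    strict.\<close>
  define d where "d = e / (\<bar>C\<bar> + 1)"
  have "d > 0" using \<open>0 < e\<close> by (simp add: d_def)
  moreover have "norm (h q - h p - inner (q - p) D) / norm (q - p) < e"
    if q: "0 < norm (q - p)" "norm (q - p) < d" for q
  proof -
    have "norm (h q - h p - inner (q - p) D) \<le> \<bar>C\<bar> * (norm (q - p))\<^sup>2"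
      by (rule order_trans[OF _ order_trans[OF bound]]) (auto intro: mult_right_mono)
    then have "norm (h q - h p - inner (q - p) D) / norm (q - p) \<le> \<bar>C\<bar> * norm (q - p)"
      using q by (simp add: field_simps power2_eq_square)
    also have "\<dots> < e"
      using q(2) \<open>0 < e\<close> unfolding d_def
      by (smt (verit) mult_strict_right_mono mult_right_mono norm_ge_zero pos_less_divide_eq q(1) mult.commute)
    finally show ?thesis .
  qed
  ultimately show "\<exists>d>0. \<forall>q. 0 < norm (q - p) \<and> norm (q - p) < d \<longrightarrow>
      norm (h q - h p - inner (q - p) D) / norm (q - p) < e" by blast
qed

text \<open>A gradient step of length \<open>1 / (2 * L)\<close> decreases \<open>h\<close> by at
  least \<open>(norm (G p))^2 / (4 * L)\<close> and cannot pass below \<open>l\<close>.\<close>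

lemma gradient_le_value_gap:
  fixes h :: "'v::real_inner \<Rightarrow> real"
  assumes G: "\<And>p. GDERIV h p :> G p" and lip: "L-lipschitz_on UNIV G" and "0 < L"
    and low: "\<And>p. l \<le> h p"
  shows "(norm (G p))\<^sup>2 \<le> 4 * L * (h p - l)"
proof -
  define q where "q = p - (1 / (2 * L)) *\<^sub>R G p"
  have "h q - h p - inner (q - p) (G p) \<le> L * (norm (q - p))\<^sup>2"
    using gradient_quadratic_bound[OF G lip, of q p] by linarith
  moreover have "inner (q - p) (G p) = - (norm (G p))\<^sup>2 / (2 * L)"
    by (simp add: q_def power2_norm_eq_inner)
  moreover have "L * (norm (q - p))\<^sup>2 = (norm (G p))\<^sup>2 / (4 * L)"
    using \<open>0 < L\<close> by (simp add: q_def power_divide power_mult_distrib field_simps power2_eq_square)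
  ultimately have "l \<le> h p - (norm (G p))\<^sup>2 / (2 * L) + (norm (G p))\<^sup>2 / (4 * L)"
    using low[of q] by simp
  then show ?thesis using \<open>0 < L\<close> by (simp add: field_simps)
qed

lemma lipschitz_on_diff_gradient:
  fixes f g :: "'a::metric_space \<Rightarrow> 'b::real_normed_vector"
  assumes "C-lipschitz_on U f" "D-lipschitz_on U g"
  shows "(C + D)-lipschitz_on U (\<lambda>x. f x - g x)"
  using lipschitz_on_add[OF assms(1) lipschitz_on_minus[OF assms(2)]] by simp

text \<open>The free weight \<open>e\<close> is later a fraction of a contraction rate, so that
  passing from one error to the next costs only part of the contraction.\<close>

lemma norm_add_sq_young:
  fixes a b :: "'a::real_inner"
  assumes "0 < e"
  shows "(norm (a + b))\<^sup>2 \<le> (1 + e) * (norm a)\<^sup>2 + (1 + 1 / e) * (norm b)\<^sup>2"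
proof -
  have "0 \<le> (norm (e *\<^sub>R a - b))\<^sup>2 / e" using assms by simp
  also have "\<dots> = (e\<^sup>2 * (norm a)\<^sup>2 - 2 * e * inner a b + (norm b)\<^sup>2) / e"
    unfolding power2_norm_eq_inner
    by (simp add: inner_diff_left inner_diff_right inner_commute power2_eq_square algebra_simps)
  also have "\<dots> = e * (norm a)\<^sup>2 - 2 * inner a b + (norm b)\<^sup>2 / e"
    using assms by (simp add: diff_divide_distrib add_divide_distrib power2_eq_square)
  finally show ?thesis
    by (simp add: power2_norm_eq_inner inner_add_left inner_add_right inner_commute algebra_simps)
qed

lemma norm_add_sq_le:
  fixes a b :: "'a::real_inner"
  shows "(norm (a + b))\<^sup>2 \<le> 2 * (norm a)\<^sup>2 + 2 * (norm b)\<^sup>2"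
  using norm_add_sq_young[of 1 a b] by simp

text \<open>The convexity defect is \<open>(1 - e) * e * (norm (a - b))^2\<close>. Unlike Young's
  inequality this leaves the factor \<open>1 - e\<close> intact and lets an averaged bias enter with
  the factor \<open>e\<close> only.\<close>

lemma norm_convex_sq:
  fixes a b :: "'a::real_inner"
  assumes "0 \<le> e" "e \<le> 1"
  shows "(norm ((1 - e) *\<^sub>R a + e *\<^sub>R b))\<^sup>2 \<le> (1 - e) * (norm a)\<^sup>2 + e * (norm b)\<^sup>2"
proof -
  have "0 \<le> (1 - e) * e * (norm (a - b))\<^sup>2" using assms by simp
  also have "\<dots> = (1 - e) * (norm a)\<^sup>2 + e * (norm b)\<^sup>2 - (norm ((1 - e) *\<^sub>R a + e *\<^sub>R b))\<^sup>2"
    unfolding power2_norm_eq_inner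
    by (simp add: inner_diff_left inner_diff_right inner_add_left inner_add_right inner_commute
         algebra_simps)
  finally show ?thesis by simp
qed

section \<open>The Moreau envelope of a weakly convex lower level\<close>

lemma fst_lipschitz: "norm (fst (z :: 'a::real_normed_vector \<times> 'b::real_normed_vector)) \<le> norm z"
  by (metis norm_fst_le prod.collapse)

lemma snd_lipschitz: "norm (snd (z :: 'a::real_normed_vector \<times> 'b::real_normed_vector)) \<le> norm z"
  by (metis norm_snd_le prod.collapse)

lemma norm_diff_scaleR_sq:
  fixes d s :: "'a::real_inner"
  shows "(norm (d - a *\<^sub>R s))\<^sup>2 = (norm d)\<^sup>2 - 2 * (a * inner d s) + a\<^sup>2 * (norm s)\<^sup>2"
  unfolding power2_norm_eq_inner
  by (simp add: inner_diff_left inner_diff_right inner_commute power2_eq_square)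

lemma norm_sq_prod:
  fixes z :: "'a::real_inner \<times> 'b::real_inner"
  shows "(norm z)\<^sup>2 = (norm (fst z))\<^sup>2 + (norm (snd z))\<^sup>2"
  by (cases z) (simp add: norm_Pair)

text \<open>The condition \<open>\<gamma> * \<rho> < 1\<close> lets the proximal term outweigh the
  missing convexity in the second block.\<close>

locale weakly_convex_lower =
  fixes g :: "'a::euclidean_space \<times> 'b::euclidean_space \<Rightarrow> real"
    and G :: "'a \<times> 'b \<Rightarrow> 'a \<times> 'b" and L \<rho> \<gamma> :: real
  assumes grad: "GDERIV g p :> G p" and lip: "L-lipschitz_on UNIV G"
    and weakly_convex: "convex_on UNIV (\<lambda>\<theta>. g (x, \<theta>) + \<rho> / 2 * (norm \<theta>)\<^sup>2)"
    and \<gamma>: "0 < \<gamma>" "\<gamma> * \<rho> < 1"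
begin

definition obj :: "'a \<times> 'b \<Rightarrow> 'b \<Rightarrow> real" where
  "obj z \<theta> = g (fst z, \<theta>) + 1 / (2 * \<gamma>) * (norm (\<theta> - snd z))\<^sup>2"

text \<open>The gradient of \<open>obj z\<close> at \<open>\<theta>\<close>: its zero is the
  proximal point, and it is the conditional mean of the stochastic lower-level direction.\<close>

definition S :: "'a \<times> 'b \<Rightarrow> 'b \<Rightarrow> 'b" where
  "S z \<theta> = snd (G (fst z, \<theta>)) + (1 / \<gamma>) *\<^sub>R (\<theta> - snd z)"

text \<open>The strong convexity modulus of \<open>obj z\<close>; \<open>K\<close> below is a
  Lipschitz constant of \<open>S\<close> in both arguments.\<close>

definition \<mu> :: real where "\<mu> = 1 / \<gamma> - \<rho>"
definition K :: real where "K = L + 1 / \<gamma>"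

lemma \<mu>_pos: "0 < \<mu>"
  using \<gamma> by (simp add: \<mu>_def field_simps)

lemma L_nonneg: "0 \<le> L"
  using lip lipschitz_on_nonneg by blast

lemma K_pos: "0 < K"
  using \<gamma> L_nonneg by (simp add: K_def add_nonneg_pos)

lemma G_lip: "norm (G p - G q) \<le> L * norm (p - q)"
  using lipschitz_onD[OF lip, of p q] by (simp add: dist_norm)

lemma S_lip: "norm (S z \<theta> - S z' \<theta>') \<le> K * (norm (z - z') + norm (\<theta> - \<theta>'))"
proof -
  have "S z \<theta> - S z' \<theta>' = snd (G (fst z, \<theta>) - G (fst z', \<theta>'))
      + (1 / \<gamma>) *\<^sub>R ((\<theta> - \<theta>') - snd (z - z'))"
    by (simp add: S_def algebra_simps)
  also have "norm \<dots> \<le> norm (snd (G (fst z, \<theta>) - G (fst z', \<theta>')))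
      + norm ((1 / \<gamma>) *\<^sub>R ((\<theta> - \<theta>') - snd (z - z')))"
    by (rule norm_triangle_ineq)
  also have "norm (snd (G (fst z, \<theta>) - G (fst z', \<theta>'))) \<le> L * (norm (z - z') + norm (\<theta> - \<theta>'))"
  proof -
    have "norm (snd (G (fst z, \<theta>) - G (fst z', \<theta>'))) \<le> L * norm ((fst z, \<theta>) - (fst z', \<theta>'))"
      using snd_lipschitz G_lip order_trans by blast
    also have "norm ((fst z, \<theta>) - (fst z', \<theta>')) \<le> norm (fst (z - z')) + norm (\<theta> - \<theta>')"
      using norm_Pair_le[of "fst z - fst z'" "\<theta> - \<theta>'"] by simp
    also have "norm (fst (z - z')) \<le> norm (z - z')" by (rule fst_lipschitz)
    finally show ?thesis using L_nonneg by (simp add: mult_left_mono)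
  qed
  also have "norm ((1 / \<gamma>) *\<^sub>R ((\<theta> - \<theta>') - snd (z - z'))) \<le> 1 / \<gamma> * (norm (z - z') + norm (\<theta> - \<theta>'))"
  proof -
    have "norm ((\<theta> - \<theta>') - snd (z - z')) \<le> norm (z - z') + norm (\<theta> - \<theta>')"
      using norm_triangle_ineq4[of "\<theta> - \<theta>'" "snd (z - z')"] snd_lipschitz[of "z - z'"] by linarith
    then show ?thesis using \<gamma> by (simp add: divide_right_mono)
  qed
  finally show ?thesis by (simp add: K_def algebra_simps)
qed

text \<open>On the segment, \<open>g\<close> plus its quadratic correction is a convex function of
  one variable and lies above its tangent at \<open>0\<close>. The correction is then traded for the
  proximal term, whose expansion is exact; the two curvatures differ by
  \<open>\<mu>\<close>.\<close>

lemma obj_strongly_convex: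
  "obj z \<theta>' \<ge> obj z \<theta> + inner (\<theta>' - \<theta>) (S z \<theta>) + \<mu> / 2 * (norm (\<theta>' - \<theta>))\<^sup>2"
proof -
  obtain x y where z: "z = (x, y)" by (cases z)
  let ?d = "\<theta>' - \<theta>"
  define k where "k t = g (x, \<theta> + t *\<^sub>R ?d) + \<rho> / 2 * (norm (\<theta> + t *\<^sub>R ?d))\<^sup>2" for t :: real
  have "convex_on UNIV k"
  proof (rule convex_onI)
    fix t u v :: real assume t: "0 < t" "t < 1"
    have "\<theta> + ((1 - t) *\<^sub>R u + t *\<^sub>R v) *\<^sub>R ?d
        = (1 - t) *\<^sub>R (\<theta> + u *\<^sub>R ?d) + t *\<^sub>R (\<theta> + v *\<^sub>R ?d)"
      by (simp add: algebra_simps)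
    then show "k ((1 - t) *\<^sub>R u + t *\<^sub>R v) \<le> (1 - t) * k u + t * k v"
      unfolding k_def using convex_onD[OF weakly_convex[of x], of t "\<theta> + u *\<^sub>R ?d" "\<theta> + v *\<^sub>R ?d"] t
      by simp
  qed simp
  moreover have "(k has_field_derivative (inner ?d (snd (G (x, \<theta>))) + \<rho> * inner \<theta> ?d)) (at 0)"
  proof -
    have 1: "((\<lambda>t. (x, \<theta> + t *\<^sub>R ?d)) has_derivative (\<lambda>s. (0, s *\<^sub>R ?d))) (at (0::real))"
      by (auto intro!: derivative_eq_intros)
    have "((\<lambda>t. g (x, \<theta> + t *\<^sub>R ?d)) has_derivative (\<lambda>s. inner (0, s *\<^sub>R ?d) (G (x, \<theta>)))) (at (0::real))"
      using has_derivative_compose[OF 1 grad[unfolded gderiv_def]] by simp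
    then have 2: "((\<lambda>t. g (x, \<theta> + t *\<^sub>R ?d)) has_real_derivative inner ?d (snd (G (x, \<theta>)))) (at (0::real))"
      unfolding has_field_derivative_def
      by (rule has_derivative_eq_rhs) (simp add: inner_prod_def fun_eq_iff)
    have 3: "((\<lambda>t. (norm (\<theta> + t *\<^sub>R ?d))\<^sup>2) has_real_derivative 2 * inner \<theta> ?d) (at (0::real))"
      unfolding power2_norm_eq_inner
      by (auto intro!: derivative_eq_intros simp: has_field_derivative_def inner_commute)
    show ?thesis unfolding k_def
      using DERIV_add[OF 2 DERIV_cmult[OF 3, of "\<rho> / 2"]] by simp
  qed
  ultimately have "k 1 - k 0 \<ge> (inner ?d (snd (G (x, \<theta>))) + \<rho> * inner \<theta> ?d) * (1 - 0)"
    by (intro convex_on_imp_above_tangent[of UNIV]) (auto simp: )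
  then have *: "g (x, \<theta>') + \<rho> / 2 * (norm \<theta>')\<^sup>2 - g (x, \<theta>) - \<rho> / 2 * (norm \<theta>)\<^sup>2
      \<ge> inner ?d (snd (G (x, \<theta>))) + \<rho> * inner \<theta> ?d"
    by (simp add: k_def)
  have 1: "(norm \<theta>')\<^sup>2 = (norm \<theta>)\<^sup>2 + 2 * inner \<theta> ?d + (norm ?d)\<^sup>2"
    and 2: "(norm (\<theta>' - y))\<^sup>2 = (norm (\<theta> - y))\<^sup>2 + 2 * inner ?d (\<theta> - y) + (norm ?d)\<^sup>2"
    unfolding power2_norm_eq_inner by (simp_all add: inner_diff_left inner_diff_right inner_commute)
  have "obj z \<theta>' - obj z \<theta> = g (x, \<theta>') - g (x, \<theta>) + 1 / (2 * \<gamma>) * (2 * inner ?d (\<theta> - y) + (norm ?d)\<^sup>2)"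
    unfolding obj_def z fst_conv snd_conv 2 by (simp add: algebra_simps)
  moreover have "inner ?d (S z \<theta>) = inner ?d (snd (G (x, \<theta>))) + 1 / \<gamma> * inner ?d (\<theta> - y)"
    by (simp add: S_def z inner_add_right)
  moreover have "\<mu> / 2 * (norm ?d)\<^sup>2 = 1 / (2 * \<gamma>) * (norm ?d)\<^sup>2 - \<rho> / 2 * (norm ?d)\<^sup>2"
    by (simp add: \<mu>_def left_diff_distrib diff_divide_distrib)
  moreover have "1 / (2 * \<gamma>) * (2 * inner ?d (\<theta> - y) + (norm ?d)\<^sup>2)
      = 1 / \<gamma> * inner ?d (\<theta> - y) + 1 / (2 * \<gamma>) * (norm ?d)\<^sup>2"
    by (simp add: distrib_left)
  moreover have "\<rho> / 2 * (norm \<theta>')\<^sup>2 = \<rho> / 2 * (norm \<theta>)\<^sup>2 + \<rho> * inner \<theta> ?d + \<rho> / 2 * (norm ?d)\<^sup>2"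
    unfolding 1 by (simp add: distrib_left)
  ultimately show ?thesis using * by linarith
qed

text \<open>The strong convexity inequality is added to itself with \<open>\<theta>\<close> and
  \<open>\<theta>'\<close> exchanged.\<close>

lemma S_strongly_monotone: "\<mu> * (norm (\<theta> - \<theta>'))\<^sup>2 \<le> inner (\<theta> - \<theta>') (S z \<theta> - S z \<theta>')"
  using obj_strongly_convex[of z \<theta> \<theta>'] obj_strongly_convex[of z \<theta>' \<theta>]
  by (simp add: inner_diff_left inner_diff_right norm_minus_commute algebra_simps)

text \<open>Expanding the square gives the factor \<open>1 - 2 * a * \<mu> + a^2 * K^2\<close>; the
  step restriction spends half of the linear gain on the quadratic term.\<close>

lemma gradient_step_contraction:
  assumes "0 \<le> a" "a * K\<^sup>2 \<le> \<mu>"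
  shows "(norm ((\<theta> - a *\<^sub>R S z \<theta>) - (\<theta>' - a *\<^sub>R S z \<theta>')))\<^sup>2 \<le> (1 - a * \<mu>) * (norm (\<theta> - \<theta>'))\<^sup>2"
proof -
  let ?d = "\<theta> - \<theta>'" and ?s = "S z \<theta> - S z \<theta>'"
  have "(norm ?s)\<^sup>2 \<le> (K * norm ?d)\<^sup>2"
    using S_lip[of z \<theta> z \<theta>'] by (intro power_mono) auto
  then have "a * (a * (norm ?s)\<^sup>2) \<le> a * (a * (K\<^sup>2 * (norm ?d)\<^sup>2))"
    using assms(1) by (intro mult_left_mono) (auto simp: power_mult_distrib)
  also have "\<dots> = a * ((a * K\<^sup>2) * (norm ?d)\<^sup>2)" by simp
  also have "\<dots> \<le> a * (\<mu> * (norm ?d)\<^sup>2)"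
    using assms by (intro mult_left_mono mult_right_mono) auto
  finally have 1: "a\<^sup>2 * (norm ?s)\<^sup>2 \<le> a * \<mu> * (norm ?d)\<^sup>2"
    by (simp add: power2_eq_square mult.assoc)
  have "a * (\<mu> * (norm ?d)\<^sup>2) \<le> a * inner ?d ?s"
    using S_strongly_monotone assms(1) by (intro mult_left_mono) auto
  moreover have "(\<theta> - a *\<^sub>R S z \<theta>) - (\<theta>' - a *\<^sub>R S z \<theta>') = ?d - a *\<^sub>R ?s"
    by (simp add: algebra_simps)
  moreover have "(norm (?d - a *\<^sub>R ?s))\<^sup>2 = (norm ?d)\<^sup>2 - 2 * (a * inner ?d ?s) + a\<^sup>2 * (norm ?s)\<^sup>2"
    by (rule norm_diff_scaleR_sq)
  ultimately show ?thesis using 1 by (simp add: algebra_simps)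
qed

text \<open>Strong monotonicity turns a short gradient step into a contraction, so the minimizer
  comes from Banach's fixed point theorem, without compactness.\<close>

lemma ex_stationary: "\<exists>\<theta>. S z \<theta> = 0"
proof -
  \<comment> \<open>The first bound makes the step contract, the second keeps the argument of the
    square root nonnegative.\<close>
  define a where "a = min (\<mu> / K\<^sup>2) (1 / \<mu>)"
  have a: "0 < a" "a * K\<^sup>2 \<le> \<mu>" "a * \<mu> \<le> 1"
    using \<mu>_pos K_pos by (auto simp: a_def min_def field_simps)
  have "\<exists>!\<theta>. \<theta> - a *\<^sub>R S z \<theta> = \<theta>"
  proof (rule banach_fix_type)
    show "0 \<le> sqrt (1 - a * \<mu>)" "sqrt (1 - a * \<mu>) < 1"
      using a \<mu>_pos by auto
    show "\<forall>\<theta> \<theta>'. dist (\<theta> - a *\<^sub>R S z \<theta>) (\<theta>' - a *\<^sub>R S z \<theta>') \<le> sqrt (1 - a * \<mu>) * dist \<theta> \<theta>'"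
    proof (intro allI)
      fix \<theta> \<theta>'
      have "norm ((\<theta> - a *\<^sub>R S z \<theta>) - (\<theta>' - a *\<^sub>R S z \<theta>')) \<le> sqrt ((1 - a * \<mu>) * (norm (\<theta> - \<theta>'))\<^sup>2)"
        using gradient_step_contraction a by (intro real_le_rsqrt) auto
      then show "dist (\<theta> - a *\<^sub>R S z \<theta>) (\<theta>' - a *\<^sub>R S z \<theta>') \<le> sqrt (1 - a * \<mu>) * dist \<theta> \<theta>'"
        by (simp add: real_sqrt_mult dist_norm)
    qed
  qed
  then show ?thesis using a(1) by auto
qed

definition prox :: "'a \<times> 'b \<Rightarrow> 'b" where "prox z = (SOME \<theta>. S z \<theta> = 0)"

lemma S_prox [simp]: "S z (prox z) = 0"
  unfolding prox_def by (rule someI_ex[OF ex_stationary])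

lemma prox_lip: "norm (prox z - prox z') \<le> K / \<mu> * norm (z - z')"
proof (cases "prox z = prox z'")
  case True
  then show ?thesis using K_pos \<mu>_pos by simp
next
  case False
  let ?d = "prox z - prox z'"
  have "\<mu> * (norm ?d)\<^sup>2 \<le> inner ?d (S z (prox z) - S z (prox z'))"
    by (rule S_strongly_monotone)
  \<comment> \<open>\<open>S z (prox z)\<close> and \<open>S z' (prox z')\<close> both vanish, so
    one may stand for the other; what remains has a common second argument and is Lipschitz in
    \<open>z\<close>.\<close>
  also have "\<dots> = inner ?d (S z' (prox z') - S z (prox z'))" by simp
  also have "\<dots> \<le> norm ?d * norm (S z' (prox z') - S z (prox z'))"
    by (rule norm_cauchy_schwarz)
  also have "\<dots> \<le> norm ?d * (K * norm (z - z'))"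
    using S_lip[of z' "prox z'" z "prox z'"] by (intro mult_left_mono) (auto simp: norm_minus_commute)
  finally have "norm ?d * (\<mu> * norm ?d) \<le> norm ?d * (K * norm (z - z'))"
    by (simp add: power2_eq_square algebra_simps)
  then have "\<mu> * norm ?d \<le> K * norm (z - z')"
    using False by simp
  then show ?thesis using \<mu>_pos by (simp add: field_simps)
qed

section \<open>The envelope and its gradient\<close>

definition env :: "'a \<times> 'b \<Rightarrow> real" where "env z = (INF \<theta>. obj z \<theta>)"

lemma obj_ge_prox: "obj z (prox z) \<le> obj z \<theta>"
  using obj_strongly_convex[of z "prox z" \<theta>] \<mu>_pos
  by (smt (verit) S_prox inner_zero_right mult_nonneg_nonneg zero_le_power2 divide_nonneg_pos)

lemma env_eq: "env z = obj z (prox z)"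
  unfolding env_def
proof (rule antisym)
  have "bdd_below (range (obj z))" using obj_ge_prox by (meson bdd_belowI2)
  then show "(INF \<theta>. obj z \<theta>) \<le> obj z (prox z)" by (rule cINF_lower) simp
  show "obj z (prox z) \<le> (INF \<theta>. obj z \<theta>)" by (rule cINF_greatest) (simp_all only: UNIV_not_empty not_False_eq_True obj_ge_prox)
qed

lemma env_le: "env z \<le> g z"
  using obj_ge_prox[of z "snd z"] by (simp add: env_eq obj_def)

definition Genv :: "'a \<times> 'b \<Rightarrow> 'a \<times> 'b" where
  "Genv z = (fst (G (fst z, prox z)), (1 / \<gamma>) *\<^sub>R (snd z - prox z))"

text \<open>The gradient of \<open>obj z \<theta>\<close> in \<open>z\<close> with
  \<open>\<theta>\<close> frozen; \<open>Genv\<close> is its value at the proximal point, as in the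
  envelope theorem.\<close>

definition D :: "'a \<times> 'b \<Rightarrow> 'b \<Rightarrow> 'a \<times> 'b" where
  "D z \<theta> = (fst (G (fst z, \<theta>)), (1 / \<gamma>) *\<^sub>R (snd z - \<theta>))"

lemma D_lip: "norm (D z \<theta> - D z' \<theta>') \<le> 2 * K * (norm (z - z') + norm (\<theta> - \<theta>'))"
proof -
  let ?n = "norm (z - z') + norm (\<theta> - \<theta>')"
  have "norm (D z \<theta> - D z' \<theta>') \<le> norm (fst (D z \<theta> - D z' \<theta>')) + norm (snd (D z \<theta> - D z' \<theta>'))"
    by (metis norm_Pair_le prod.collapse)
  also have "norm (fst (D z \<theta> - D z' \<theta>')) \<le> L * ?n"
  proof -
    have "norm (fst (D z \<theta> - D z' \<theta>')) \<le> norm (G (fst z, \<theta>) - G (fst z', \<theta>'))"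
      using fst_lipschitz[of "G (fst z, \<theta>) - G (fst z', \<theta>')"] by (simp add: D_def)
    also have "\<dots> \<le> L * norm ((fst z, \<theta>) - (fst z', \<theta>'))" by (rule G_lip)
    also have "\<dots> \<le> L * (norm (fst (z - z')) + norm (\<theta> - \<theta>'))"
      using norm_Pair_le[of "fst z - fst z'" "\<theta> - \<theta>'"] L_nonneg by (simp add: mult_left_mono)
    also have "\<dots> \<le> L * ?n" using fst_lipschitz[of "z - z'"] L_nonneg by (simp add: mult_left_mono)
    finally show ?thesis .
  qed
  also have "norm (snd (D z \<theta> - D z' \<theta>')) \<le> 1 / \<gamma> * ?n"
  proof -
    have "snd (D z \<theta> - D z' \<theta>') = (1 / \<gamma>) *\<^sub>R (snd (z - z') - (\<theta> - \<theta>'))"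
      by (simp add: D_def algebra_simps)
    moreover have "norm (snd (z - z') - (\<theta> - \<theta>')) \<le> ?n"
      using norm_triangle_ineq4[of "snd (z - z')" "\<theta> - \<theta>'"] snd_lipschitz[of "z - z'"] by linarith
    ultimately show ?thesis using \<gamma> by (simp add: divide_right_mono)
  qed
  finally have "norm (D z \<theta> - D z' \<theta>') \<le> K * ?n" by (simp add: K_def algebra_simps)
  also have "\<dots> \<le> 2 * K * ?n" using K_pos by (simp add: algebra_simps)
  finally show ?thesis .
qed

text \<open>Smoothness of \<open>g\<close> handles the first block; in the second block
  \<open>obj\<close> is quadratic and its expansion is exact.\<close>

lemma obj_smooth: "\<bar>obj z' \<theta> - obj z \<theta> - inner (z' - z) (D z \<theta>)\<bar> \<le> K * (norm (z' - z))\<^sup>2"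
proof -
  let ?d = "z' - z"
  have "\<bar>g (fst z', \<theta>) - g (fst z, \<theta>) - inner (fst ?d, 0) (G (fst z, \<theta>))\<bar> \<le> L * (norm (fst ?d))\<^sup>2"
    using gradient_quadratic_bound[OF grad lip, of "(fst z', \<theta>)" "(fst z, \<theta>)"] by simp
  moreover have "1 / (2 * \<gamma>) * (norm (\<theta> - snd z'))\<^sup>2 = 1 / (2 * \<gamma>) * (norm (\<theta> - snd z))\<^sup>2
      + inner (snd ?d) ((1 / \<gamma>) *\<^sub>R (snd z - \<theta>)) + 1 / (2 * \<gamma>) * (norm (snd ?d))\<^sup>2"
  proof -
    have "(norm (\<theta> - snd z'))\<^sup>2 = (norm (\<theta> - snd z))\<^sup>2 + 2 * inner (snd ?d) (snd z - \<theta>) + (norm (snd ?d))\<^sup>2"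
      unfolding power2_norm_eq_inner
      by (simp add: inner_diff_left inner_diff_right inner_commute)
    then show ?thesis by (simp only: distrib_left inner_scaleR_right)
  qed
  moreover from this have "obj z' \<theta> - obj z \<theta> - inner ?d (D z \<theta>)
      = (g (fst z', \<theta>) - g (fst z, \<theta>) - inner (fst ?d, 0) (G (fst z, \<theta>)))
        + 1 / (2 * \<gamma>) * (norm (snd ?d))\<^sup>2"
    unfolding obj_def D_def inner_prod_def by simp
  ultimately have "\<bar>obj z' \<theta> - obj z \<theta> - inner ?d (D z \<theta>)\<bar>
      \<le> L * (norm (fst ?d))\<^sup>2 + \<bar>1 / (2 * \<gamma>) * (norm (snd ?d))\<^sup>2\<bar>"
    by linarith
  also have "\<dots> \<le> L * (norm ?d)\<^sup>2 + 1 / \<gamma> * (norm ?d)\<^sup>2"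
  proof (intro add_mono)
    show "L * (norm (fst ?d))\<^sup>2 \<le> L * (norm ?d)\<^sup>2"
      using L_nonneg fst_lipschitz[of ?d] by (intro mult_left_mono power_mono) auto
    have "1 / (2 * \<gamma>) * (norm (snd ?d))\<^sup>2 \<le> 1 / \<gamma> * (norm ?d)\<^sup>2"
      using \<gamma> snd_lipschitz[of ?d] by (intro mult_mono power_mono) (auto simp: field_simps)
    then show "\<bar>1 / (2 * \<gamma>) * (norm (snd ?d))\<^sup>2\<bar> \<le> 1 / \<gamma> * (norm ?d)\<^sup>2"
      using \<gamma> by simp
  qed
  finally show ?thesis by (simp add: K_def algebra_simps)
qed

lemma Genv_D: "Genv z = D z (prox z)"
  by (simp add: Genv_def D_def)

lemma Genv_lip: "(2 * K * (1 + K / \<mu>))-lipschitz_on UNIV Genv"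
proof (rule lipschitz_onI)
  fix z z'
  have "norm (Genv z - Genv z') \<le> 2 * K * (norm (z - z') + norm (prox z - prox z'))"
    unfolding Genv_D by (rule D_lip)
  also have "\<dots> \<le> 2 * K * (norm (z - z') + K / \<mu> * norm (z - z'))"
    using prox_lip K_pos by (intro mult_left_mono add_mono) auto
  finally show "dist (Genv z) (Genv z') \<le> 2 * K * (1 + K / \<mu>) * dist z z'"
    by (simp add: dist_norm algebra_simps)
qed (use K_pos \<mu>_pos in auto)

text \<open>Danskin: \<^term>\<open>env\<close> is squeezed between the values of \<^term>\<open>obj\<close> at the two proximal points.\<close>

lemma GDERIV_env: "GDERIV env z :> Genv z"
proof (rule GDERIV_of_quadratic_bound)
  fix z'
  let ?d = "z' - z" and ?C = "K + 2 * K * (K / \<mu>)"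
  have nn: "0 \<le> 2 * K * (K / \<mu>) * (norm ?d)\<^sup>2" using K_pos \<mu>_pos by auto
  have "env z' \<le> obj z' (prox z)" using obj_ge_prox env_eq by metis
  then have up: "env z' - env z - inner ?d (Genv z) \<le> ?C * (norm ?d)\<^sup>2"
    using obj_smooth[of z' "prox z" z] nn unfolding env_eq[of z] Genv_D
    by (simp add: algebra_simps)
  have "env z \<le> obj z (prox z')" using obj_ge_prox env_eq by metis
  then have "env z' - env z \<ge> inner ?d (D z (prox z')) - K * (norm ?d)\<^sup>2"
    using obj_smooth[of z' "prox z'" z] unfolding env_eq[of z'] by simp
  \<comment> \<open>The lower estimate carries the gradient at the wrong proximal point
    \<open>prox z'\<close>. Since \<open>prox\<close> is Lipschitz, correcting it costs another
    quadratic term.\<close>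
  moreover have "inner ?d (Genv z - D z (prox z')) \<le> 2 * K * (K / \<mu>) * (norm ?d)\<^sup>2"
  proof -
    have "inner ?d (Genv z - D z (prox z')) \<le> norm ?d * norm (Genv z - D z (prox z'))"
      by (rule norm_cauchy_schwarz)
    also have "\<dots> \<le> norm ?d * (2 * K * (K / \<mu> * norm ?d))"
    proof (rule mult_left_mono)
      have "norm (Genv z - D z (prox z')) \<le> 2 * K * norm (prox z - prox z')"
        using D_lip[of z "prox z" z "prox z'"] by (simp add: Genv_D)
      also have "\<dots> \<le> 2 * K * (K / \<mu> * norm ?d)"
        using prox_lip[of z z'] K_pos by (intro mult_left_mono) (auto simp: norm_minus_commute)
      finally show "norm (Genv z - D z (prox z')) \<le> 2 * K * (K / \<mu> * norm ?d)" .
    qed simp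
    finally show ?thesis by (simp add: power2_eq_square algebra_simps)
  qed
  ultimately have "env z' - env z - inner ?d (Genv z) \<ge> - (?C * (norm ?d)\<^sup>2)"
    by (simp add: inner_diff_right algebra_simps)
  with up show "\<bar>env z' - env z - inner ?d (Genv z)\<bar> \<le> ?C * (norm ?d)\<^sup>2" by linarith
qed

end

section \<open>A Lyapunov function for the error recursions\<close>

text \<open>In the proof \<open>A\<close>, \<open>B\<close>, \<open>D\<close> are the weights of the
  tracking error, the lower and the upper momentum error. \<open>kD\<close> comes first, so that a
  quarter of the contraction of \<open>V\<close> pays for \<open>C * r * v\<close>; the bias in
  \<open>v\<close> leaves \<open>C1 * r * H\<close>, which fixes \<open>kA\<close>; the tracking
  step then leaves \<open>2 * kA * C * r * u\<close>, which fixes \<open>kB\<close>. The hypotheses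
  \<open>small1\<close> to \<open>small3\<close> dispose of the feedback terms.\<close>

lemma lyapunov_step:
  fixes r a s \<eta> c l L \<mu> C \<phi> \<phi>' q N v V V' u U U' h h' H :: real
  assumes pos: "0 < r" "0 < a" "0 < s" "0 < \<eta>" "0 < c" "0 < l" "0 < L" "0 < \<mu>" "0 < C"
    and nonneg: "0 \<le> N" "0 \<le> v" "0 \<le> V" "0 \<le> u" "0 \<le> U" "0 \<le> h" "0 \<le> H"
    and \<eta>: "l * s \<le> \<eta>" "\<eta> \<le> L * s" "\<eta> \<le> 1" and a\<mu>: "a * \<mu> \<le> 1"
    and \<phi>': "\<phi>' \<le> \<phi> - c * r * q - c * r * N + C * r * v"
    and v: "v \<le> (1 - \<eta>) * V + C * \<eta> * (H + s + r\<^sup>2 * N)"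
    and V': "V' \<le> (1 + \<eta> / 2) * v + C / \<eta> * (r\<^sup>2 * N + s ^ 3)"
    and u: "u \<le> (1 - \<eta>) * U + C * \<eta> * s"
    and U': "U' \<le> (1 + \<eta> / 2) * u + C / \<eta> * (a\<^sup>2 * (u + h) + r\<^sup>2 * N)"
    and H: "H \<le> (1 - a * \<mu>) * h + C * a * u"
    and h': "h' \<le> (1 + a * \<mu> / 2) * H + C / a * r\<^sup>2 * N"
    and kD: "kD = 4 * C / l" and C1: "C1 = 2 * kD * L * C" and kA: "kA = 4 * C1 / \<mu>"
    and kB: "kB = 16 * kA * C / l"
    and small1: "C * (a / s)\<^sup>2 / l\<^sup>2 \<le> 1 / 8"
    and small2: "kB * C / l * (a / s)\<^sup>2 \<le> kA * \<mu> / 4"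
    and small3: "C1 * r\<^sup>2 + kD * C / l * (r / s)\<^sup>2 + kA * C * (r / a)\<^sup>2 + kB * C / l * (r / s)\<^sup>2 \<le> c"
  shows "\<phi>' + kA * (r / a) * h' + kB * (r / s) * U' + kD * (r / s) * V'
     \<le> \<phi> + kA * (r / a) * h + kB * (r / s) * U + kD * (r / s) * V - c * r * q
       + (C1 + kD * C / l + 2 * kB * L * C) * (r * s)"
proof -
  define A B D where "A = kA * (r / a)" and "B = kB * (r / s)" and "D = kD * (r / s)"
  have kpos: "0 < kD" "0 < C1" "0 < kA" "0 < kB" using pos by (simp_all add: kD C1 kA kB)
  have ABD: "0 < A" "0 < B" "0 < D" using kpos pos by (simp_all add: A_def B_def D_def)
  \<comment> \<open>By the two-sided bound on \<open>\<eta>\<close>, a weight of order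
    \<open>r / s\<close> becomes of order \<open>r\<close> when multiplied by \<open>\<eta>\<close>,
    and of order \<open>r / s^2\<close> when divided by it.\<close>
  have lower: "k * l * r \<le> k * (r / s) * \<eta>" and upper: "k * (r / s) * \<eta> \<le> k * L * r"
    and inv: "k * (r / s) / \<eta> \<le> k / l * (r / s\<^sup>2)" if "0 < k" for k
  proof -
    have "k * (r / s) * (l * s) \<le> k * (r / s) * \<eta>"
      using \<eta> pos that by (intro mult_left_mono) auto
    moreover have "k * (r / s) * \<eta> \<le> k * (r / s) * (L * s)"
      using \<eta> pos that by (intro mult_left_mono) auto
    moreover have "k * (r / s) * (l * s) = k * l * r" "k * (r / s) * (L * s) = k * L * r"
      using pos by simp_all
    ultimately show "k * l * r \<le> k * (r / s) * \<eta>" "k * (r / s) * \<eta> \<le> k * L * r"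
      by simp_all
    have "k * (r / s) / \<eta> \<le> k * (r / s) / (l * s)"
      using \<eta> pos that by (intro divide_left_mono) auto
    then show "k * (r / s) / \<eta> \<le> k / l * (r / s\<^sup>2)"
      using pos by (simp add: field_simps power2_eq_square)
  qed
  \<comment> \<open>Each momentum error is charged a factor \<open>1 + 3 * \<eta> / 4\<close> in
    total: \<open>\<eta> / 2\<close> from the drift, the rest from the terms it absorbs. The
    contraction \<open>1 - \<eta>\<close> still cancels this.\<close>
  have contr: "(1 + 3 * \<eta> / 4) * (1 - \<eta>) \<le> 1" "1 + 3 * \<eta> / 4 \<le> 2"
    using pos \<eta> by (auto simp: algebra_simps intro: order_trans[of _ 0])
  have D: "C * r \<le> D * \<eta> / 4" "D * \<eta> \<le> kD * L * r" "D / \<eta> \<le> kD / l * (r / s\<^sup>2)"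
  proof -
    have "kD * l = 4 * C" using pos by (simp add: kD)
    with lower[OF kpos(1), folded D_def] show "C * r \<le> D * \<eta> / 4" by simp
  qed (use upper[OF kpos(1)] inv[OF kpos(1)] in \<open>simp_all add: D_def\<close>)
  have B: "2 * kA * C * r \<le> B * \<eta> / 8" "B * \<eta> \<le> kB * L * r" "B / \<eta> \<le> kB / l * (r / s\<^sup>2)"
  proof -
    have "kB * l = 16 * kA * C" using pos by (simp add: kB)
    with lower[OF kpos(4), folded B_def] show "2 * kA * C * r \<le> B * \<eta> / 8" by simp
  qed (use upper[OF kpos(4)] inv[OF kpos(4)] in \<open>simp_all add: B_def\<close>)
  have expand: "D * x * (y * V + C * e * Z) = D * V * (x * y) + x * ((D * e) * (C * Z))"
    for D x y V e Z :: real by (simp add: algebra_simps)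
  have collapse: "X * x + y * (e * Z) \<le> X * 1 + 2 * (f * Z)"
    if "0 \<le> X" "x \<le> 1" "0 \<le> y" "y \<le> 2" "0 \<le> e" "e \<le> f" "0 \<le> Z" for X x y e f Z :: real
    using that by (intro add_mono[OF mult_left_mono mult_mono[OF _ mult_right_mono]]) auto
  have Aa: "A * a = kA * r" using pos by (simp add: A_def)

  \<comment> \<open>The drift \<open>s ^ 3\<close> meets the factor \<open>r / s^2\<close> and so
    ends up in the order \<open>r * s\<close> of the noise.\<close>
  have V1: "D * V' + C * r * v \<le> D * V + C1 * r * (H + s + r\<^sup>2 * N) + kD * C / l * (r / s)\<^sup>2 * (r * N)
      + kD * C / l * (r * s)"
  proof -
    have "D * V' \<le> D * ((1 + \<eta> / 2) * v + C / \<eta> * (r\<^sup>2 * N + s ^ 3))"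
      using V' ABD by (intro mult_left_mono) auto
    moreover have "C * r * v \<le> D * \<eta> / 4 * v" using D(1) nonneg by (intro mult_right_mono)
    ultimately have "D * V' + C * r * v \<le> D * (1 + 3 * \<eta> / 4) * v + (D / \<eta>) * (C * (r\<^sup>2 * N + s ^ 3))"
      by (simp add: algebra_simps)
    moreover have "(D / \<eta>) * (C * (r\<^sup>2 * N + s ^ 3)) \<le> kD / l * (r / s\<^sup>2) * (C * (r\<^sup>2 * N + s ^ 3))"
      using D(3) pos nonneg by (intro mult_right_mono) auto
    moreover have "kD / l * (r / s\<^sup>2) * (C * (r\<^sup>2 * N + s ^ 3))
        = kD * C / l * (r / s)\<^sup>2 * (r * N) + kD * C / l * (r * s)"
      using pos by (simp add: field_simps power2_eq_square power3_eq_cube)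
    moreover have "D * (1 + 3 * \<eta> / 4) * v \<le> D * V + C1 * r * (H + s + r\<^sup>2 * N)"
    proof -
      have "D * (1 + 3 * \<eta> / 4) * v \<le> D * (1 + 3 * \<eta> / 4) * ((1 - \<eta>) * V + C * \<eta> * (H + s + r\<^sup>2 * N))"
        using v ABD pos by (intro mult_left_mono) auto
      also have "\<dots> = D * V * ((1 + 3 * \<eta> / 4) * (1 - \<eta>))
          + (1 + 3 * \<eta> / 4) * ((D * \<eta>) * (C * (H + s + r\<^sup>2 * N)))"
        by (rule expand)
      also have "\<dots> \<le> D * V * 1 + 2 * ((kD * L * r) * (C * (H + s + r\<^sup>2 * N)))"
        using contr D(2) ABD nonneg pos by (intro collapse) auto
      also have "\<dots> = D * V + C1 * r * (H + s + r\<^sup>2 * N)" by (simp add: C1)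
      finally show ?thesis .
    qed
    ultimately show ?thesis by linarith
  qed
  \<comment> \<open>As \<open>kA * \<mu> / 4 = C1\<close>, a quarter of the contraction absorbs the
    term in \<open>H\<close>. Another quarter is kept back: it survives as
    \<open>- kA * \<mu> / 4 * (r * h)\<close> and pays for the feedback of \<open>h\<close> into
    \<open>U'\<close>.\<close>
  have H1: "A * h' + C1 * r * H \<le> A * h - kA * \<mu> / 4 * (r * h) + 2 * kA * C * r * u
      + kA * C * (r / a)\<^sup>2 * (r * N)"
  proof -
    have "A * h' \<le> A * ((1 + a * \<mu> / 2) * H + C / a * r\<^sup>2 * N)"
      using h' ABD by (intro mult_left_mono) auto
    moreover have "C1 * r * H = (A * a) * \<mu> / 4 * H" unfolding Aa using pos by (simp add: kA)
    moreover have "A * (C / a * r\<^sup>2 * N) = kA * C * (r / a)\<^sup>2 * (r * N)"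
      using pos by (simp add: A_def field_simps power2_eq_square)
    moreover have "A * ((1 + a * \<mu> / 2) * H + C / a * r\<^sup>2 * N)
        = A * (1 + 3 * (a * \<mu>) / 4) * H - (A * a) * \<mu> / 4 * H + A * (C / a * r\<^sup>2 * N)"
      by (simp add: algebra_simps)
    ultimately have "A * h' + C1 * r * H \<le> A * (1 + 3 * (a * \<mu>) / 4) * H + kA * C * (r / a)\<^sup>2 * (r * N)"
      by linarith
    moreover have "A * (1 + 3 * (a * \<mu>) / 4) * H \<le> A * h - kA * \<mu> / 4 * (r * h) + 2 * kA * C * r * u"
    proof -
      let ?x = "a * \<mu>"
      have x: "0 < ?x" using pos by simp
      have "A * (1 + 3 * ?x / 4) * H \<le> A * (1 + 3 * ?x / 4) * ((1 - ?x) * h + C * a * u)"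
        using H ABD x by (intro mult_left_mono) auto
      also have "\<dots> = A * h * ((1 + 3 * ?x / 4) * (1 - ?x)) + (1 + 3 * ?x / 4) * ((A * a) * (C * u))"
        by (rule expand)
      also have "\<dots> \<le> A * h * (1 - ?x / 4) + 2 * ((A * a) * (C * u))"
        using x a\<mu> ABD nonneg pos by (intro add_mono mult_left_mono mult_right_mono) (auto simp: algebra_simps)
      also have "\<dots> = A * h - (A * a) * \<mu> / 4 * h + 2 * ((A * a) * (C * u))"
        by (simp add: algebra_simps)
      finally show ?thesis unfolding Aa by (simp add: algebra_simps)
    qed
    ultimately show ?thesis by linarith
  qed
  have U1: "B * U' + 2 * kA * C * r * u \<le> B * U + 2 * kB * L * C * (r * s) + kA * \<mu> / 4 * (r * h)
      + kB * C / l * (r / s)\<^sup>2 * (r * N)"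
  proof -
    have "B * U' \<le> B * ((1 + \<eta> / 2) * u + C / \<eta> * (a\<^sup>2 * (u + h) + r\<^sup>2 * N))"
      using U' ABD by (intro mult_left_mono) auto
    moreover have "2 * kA * C * r * u \<le> B * \<eta> / 8 * u" using B(1) nonneg by (intro mult_right_mono)
    \<comment> \<open>The lower momentum error feeds on itself through the movement of
      \<open>\<theta>\<close>; by \<open>small1\<close> this costs only an eighth of
      \<open>\<eta>\<close>.\<close>
    moreover have "B * (C / \<eta> * a\<^sup>2) * u \<le> B * \<eta> / 8 * u"
    proof -
      have "C * a\<^sup>2 \<le> (l * s)\<^sup>2 / 8" using small1 pos by (simp add: field_simps power2_eq_square)
      also have "\<dots> \<le> \<eta>\<^sup>2 / 8" using \<eta> pos by (intro divide_right_mono power_mono) auto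
      finally have "C / \<eta> * a\<^sup>2 \<le> \<eta> / 8" using pos by (simp add: field_simps power2_eq_square)
      then have "B * (C / \<eta> * a\<^sup>2) \<le> B * (\<eta> / 8)" using ABD by (intro mult_left_mono) auto
      then have "B * (C / \<eta> * a\<^sup>2) * u \<le> B * (\<eta> / 8) * u" using nonneg by (intro mult_right_mono)
      then show ?thesis by simp
    qed
    moreover have "B * ((1 + \<eta> / 2) * u + C / \<eta> * (a\<^sup>2 * (u + h) + r\<^sup>2 * N))
        = B * (1 + 3 * \<eta> / 4) * u - 2 * (B * \<eta> / 8 * u) + B * (C / \<eta> * a\<^sup>2) * u
          + (B / \<eta>) * (C * (a\<^sup>2 * h + r\<^sup>2 * N))"
      by (simp add: algebra_simps)
    ultimately have "B * U' + 2 * kA * C * r * u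
        \<le> B * (1 + 3 * \<eta> / 4) * u + (B / \<eta>) * (C * (a\<^sup>2 * h + r\<^sup>2 * N))"
      by linarith
    moreover have "(B / \<eta>) * (C * (a\<^sup>2 * h + r\<^sup>2 * N)) \<le> kB / l * (r / s\<^sup>2) * (C * (a\<^sup>2 * h + r\<^sup>2 * N))"
      using B(3) pos nonneg by (intro mult_right_mono) auto
    moreover have "kB / l * (r / s\<^sup>2) * (C * (a\<^sup>2 * h + r\<^sup>2 * N))
        = (kB * C / l * (a / s)\<^sup>2) * (r * h) + kB * C / l * (r / s)\<^sup>2 * (r * N)"
      using pos by (simp add: field_simps power2_eq_square)
    moreover have "(kB * C / l * (a / s)\<^sup>2) * (r * h) \<le> kA * \<mu> / 4 * (r * h)"
      using small2 pos nonneg by (intro mult_right_mono) auto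
    moreover have "B * (1 + 3 * \<eta> / 4) * u \<le> B * U + 2 * kB * L * C * (r * s)"
    proof -
      have "B * (1 + 3 * \<eta> / 4) * u \<le> B * (1 + 3 * \<eta> / 4) * ((1 - \<eta>) * U + C * \<eta> * s)"
        using u ABD pos by (intro mult_left_mono) auto
      also have "\<dots> = B * U * ((1 + 3 * \<eta> / 4) * (1 - \<eta>)) + (1 + 3 * \<eta> / 4) * ((B * \<eta>) * (C * s))"
        by (rule expand)
      also have "\<dots> \<le> B * U * 1 + 2 * ((kB * L * r) * (C * s))"
        using contr B(2) ABD nonneg pos by (intro collapse) auto
      finally show ?thesis by (simp add: algebra_simps)
    qed
    ultimately show ?thesis by linarith
  qed
  \<comment> \<open>All squared displacements together are paid for by the term
    \<open>- c * r * N\<close> of the descent inequality.\<close>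
  have "(C1 * r\<^sup>2 + kD * C / l * (r / s)\<^sup>2 + kA * C * (r / a)\<^sup>2 + kB * C / l * (r / s)\<^sup>2) * (r * N) \<le> c * (r * N)"
    using small3 pos nonneg by (intro mult_right_mono) auto
  then have "C1 * r\<^sup>2 * (r * N) + kD * C / l * (r / s)\<^sup>2 * (r * N) + kA * C * (r / a)\<^sup>2 * (r * N)
      + kB * C / l * (r / s)\<^sup>2 * (r * N) \<le> c * (r * N)"
    by (simp add: distrib_right)
  moreover have "C1 * r * (H + s + r\<^sup>2 * N) = C1 * r * H + C1 * (r * s) + C1 * r\<^sup>2 * (r * N)"
    by (simp add: algebra_simps)
  moreover have "(C1 + kD * C / l + 2 * kB * L * C) * (r * s)
      = C1 * (r * s) + kD * C / l * (r * s) + 2 * kB * L * C * (r * s)"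
    by (simp add: distrib_right)
  moreover have "c * r * N = c * (r * N)" by simp
  ultimately have "D * V' + A * h' + B * U' + C * r * v \<le> D * V + A * h + B * U
      + (C1 + kD * C / l + 2 * kB * L * C) * (r * s) + c * r * N"
    using V1 H1 U1 by (smt (verit))
  then have "\<phi>' + A * h' + B * U' + D * V' \<le> \<phi> + A * h + B * U + D * V - c * r * q
      + (C1 + kD * C / l + 2 * kB * L * C) * (r * s)"
    using \<phi>' by (smt (verit))
  then show ?thesis unfolding A_def B_def D_def .
qed

text \<open>The recursions and the smallness conditions hold only eventually, so the descent starts
  at some \<open>t0\<close>; the bound \<open>\<phi> t \<le> W t\<close> holds everywhere because
  the added terms are nonnegative.\<close>

lemma lyapunov_descent:
  fixes r a s \<eta> \<phi> q N v V u U h H :: "nat \<Rightarrow> real" and c l L \<mu> C :: real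
  assumes pos: "\<And>t. 0 < r t" "\<And>t. 0 < a t" "\<And>t. 0 < s t" "\<And>t. 0 < \<eta> t"
      "0 < c" "0 < l" "0 < L" "0 < \<mu>" "0 < C"
    and nonneg: "\<And>t. 0 \<le> N t" "\<And>t. 0 \<le> v t" "\<And>t. 0 \<le> V t" "\<And>t. 0 \<le> u t" "\<And>t. 0 \<le> U t"
      "\<And>t. 0 \<le> h t" "\<And>t. 0 \<le> H t"
    and \<eta>1: "\<And>t. \<eta> t \<le> 1"
    and dec: "decseq (\<lambda>t. r t / a t)" "decseq (\<lambda>t. r t / s t)"
    and lim: "r \<longlonglongrightarrow> 0" "a \<longlonglongrightarrow> 0" "(\<lambda>t. r t / a t) \<longlonglongrightarrow> 0" "(\<lambda>t. r t / s t) \<longlonglongrightarrow> 0" "(\<lambda>t. a t / s t) \<longlonglongrightarrow> 0"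
    and \<eta>: "\<forall>\<^sub>F t in sequentially. l * s t \<le> \<eta> t \<and> \<eta> t \<le> L * s t"
    and \<phi>': "\<forall>\<^sub>F t in sequentially. \<phi> (Suc t) \<le> \<phi> t - c * r t * q t - c * r t * N t + C * r t * v t"
    and v: "\<forall>\<^sub>F t in sequentially. v t \<le> (1 - \<eta> t) * V t + C * \<eta> t * (H t + s t + (r t)\<^sup>2 * N t)"
    and V': "\<forall>\<^sub>F t in sequentially. V (Suc t) \<le> (1 + \<eta> t / 2) * v t + C / \<eta> t * ((r t)\<^sup>2 * N t + (s t) ^ 3)"
    and u: "\<forall>\<^sub>F t in sequentially. u t \<le> (1 - \<eta> t) * U t + C * \<eta> t * s t"
    and U': "\<forall>\<^sub>F t in sequentially. U (Suc t) \<le> (1 + \<eta> t / 2) * u t + C / \<eta> t * ((a t)\<^sup>2 * (u t + h t) + (r t)\<^sup>2 * N t)"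
    and H: "\<forall>\<^sub>F t in sequentially. H t \<le> (1 - a t * \<mu>) * h t + C * a t * u t"
    and h': "\<forall>\<^sub>F t in sequentially. h (Suc t) \<le> (1 + a t * \<mu> / 2) * H t + C / a t * (r t)\<^sup>2 * N t"
  obtains W C' t0 where "0 < C'" "\<And>t. \<phi> t \<le> W t"
    "\<And>t. t \<ge> t0 \<Longrightarrow> W (Suc t) \<le> W t - c * r t * q t + C' * (r t * s t)"
proof -
  define kD C1 kA kB where "kD = 4 * C / l" and "C1 = 2 * kD * L * C" and "kA = 4 * C1 / \<mu>"
    and "kB = 16 * kA * C / l"
  have kpos: "0 < kD" "0 < C1" "0 < kA" "0 < kB"
    using pos by (simp_all add: kD_def C1_def kA_def kB_def)
  define W where "W t = \<phi> t + kA * (r t / a t) * h t + kB * (r t / s t) * U t + kD * (r t / s t) * V t" for t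
  have "\<forall>\<^sub>F t in sequentially. C * (a t / s t)\<^sup>2 / l\<^sup>2 < 1 / 8"
    by (rule order_tendstoD(2)[of _ "C * 0\<^sup>2 / l\<^sup>2"]) (use pos in \<open>auto intro!: tendsto_intros lim\<close>)
  moreover have "\<forall>\<^sub>F t in sequentially. kB * C / l * (a t / s t)\<^sup>2 < kA * \<mu> / 4"
    by (rule order_tendstoD(2)[of _ "kB * C / l * 0\<^sup>2"]) (use pos kpos in \<open>auto intro!: tendsto_intros lim\<close>)
  moreover have "\<forall>\<^sub>F t in sequentially. C1 * (r t)\<^sup>2 + kD * C / l * (r t / s t)\<^sup>2
      + kA * C * (r t / a t)\<^sup>2 + kB * C / l * (r t / s t)\<^sup>2 < c"
  proof (rule order_tendstoD(2))
    show "(\<lambda>t. C1 * (r t)\<^sup>2 + kD * C / l * (r t / s t)\<^sup>2 + kA * C * (r t / a t)\<^sup>2 + kB * C / l * (r t / s t)\<^sup>2)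
        \<longlonglongrightarrow> C1 * 0\<^sup>2 + kD * C / l * 0\<^sup>2 + kA * C * 0\<^sup>2 + kB * C / l * 0\<^sup>2"
      by (intro tendsto_intros lim)
  qed (use pos in simp)
  moreover have "\<forall>\<^sub>F t in sequentially. a t * \<mu> < 1"
    by (rule order_tendstoD(2)[of _ "0 * \<mu>"]) (use pos in \<open>auto intro!: tendsto_intros lim\<close>)
  ultimately have "\<forall>\<^sub>F t in sequentially. W (Suc t) \<le> W t - c * r t * q t
      + (C1 + kD * C / l + 2 * kB * L * C) * (r t * s t)"
    using \<eta> \<phi>' v V' u U' H h'
  proof eventually_elim
    case (elim t)
    \<comment> \<open>The weights at \<open>Suc t\<close> are replaced by those at \<open>t\<close>;
      this is where the monotonicity of \<open>r / a\<close> and \<open>r / s\<close>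
      enters.\<close>
    have "W (Suc t) \<le> \<phi> (Suc t) + kA * (r t / a t) * h (Suc t) + kB * (r t / s t) * U (Suc t)
        + kD * (r t / s t) * V (Suc t)"
      unfolding W_def using kpos nonneg decseqD[OF dec(1), of t "Suc t"] decseqD[OF dec(2), of t "Suc t"]
      by (intro add_mono mult_right_mono mult_left_mono) auto
    also have "\<dots> \<le> W t - c * r t * q t + (C1 + kD * C / l + 2 * kB * L * C) * (r t * s t)"
      unfolding W_def
    proof (rule lyapunov_step[OF pos(1-4) pos(5-9) nonneg _ _ \<eta>1])
    qed (use elim in \<open>auto simp: kD_def C1_def kA_def kB_def less_imp_le\<close>)
    finally show ?case .
  qed
  then obtain t0 where "\<And>t. t \<ge> t0 \<Longrightarrow> W (Suc t) \<le> W t - c * r t * q t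
      + (C1 + kD * C / l + 2 * kB * L * C) * (r t * s t)"
    unfolding eventually_sequentially by blast
  moreover have "\<phi> t \<le> W t" for t
    using kpos nonneg[of t] pos(1-4)[of t] by (simp add: W_def add_nonneg_nonneg less_imp_le)
  moreover have "0 < C1 + kD * C / l + 2 * kB * L * C"
    using pos kpos by (simp add: add_pos_pos)
  ultimately show ?thesis using that by blast
qed

section \<open>Square-integrable vectors and momentum averaging\<close>

text \<open>Measurability and integrability travel with every second moment, since
  \<open>msq\<close> of a vector without a finite one would be \<open>0\<close> and bounds on it
  void.\<close>

definition sqint :: "'w measure \<Rightarrow> ('w \<Rightarrow> 'v::euclidean_space) \<Rightarrow> bool" where
  "sqint M X \<longleftrightarrow> X \<in> borel_measurable M \<and> integrable M (\<lambda>\<omega>. (norm (X \<omega>))\<^sup>2)"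

abbreviation msq :: "'w measure \<Rightarrow> ('w \<Rightarrow> 'v::euclidean_space) \<Rightarrow> real" where
  "msq M X \<equiv> \<integral>\<omega>. (norm (X \<omega>))\<^sup>2 \<partial>M"

lemma sqint_measurable: "sqint M X \<Longrightarrow> X \<in> borel_measurable M"
  and sqint_integrable: "sqint M X \<Longrightarrow> integrable M (\<lambda>\<omega>. (norm (X \<omega>))\<^sup>2)"
  by (auto simp: sqint_def)

lemma sqint_add:
  assumes "sqint M X" "sqint M Y"
  shows "sqint M (\<lambda>\<omega>. X \<omega> + Y \<omega>)"
  unfolding sqint_def
proof
  have [measurable]: "X \<in> borel_measurable M" "Y \<in> borel_measurable M"
    using assms sqint_measurable by blast+
  show "(\<lambda>\<omega>. X \<omega> + Y \<omega>) \<in> borel_measurable M" by measurable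
  show "integrable M (\<lambda>\<omega>. (norm (X \<omega> + Y \<omega>))\<^sup>2)"
  proof (rule Bochner_Integration.integrable_bound)
    show "integrable M (\<lambda>\<omega>. 2 * (norm (X \<omega>))\<^sup>2 + 2 * (norm (Y \<omega>))\<^sup>2)"
      using assms by (simp add: sqint_integrable)
  qed (auto simp: norm_add_sq_le)
qed

lemma sqint_scaleR:
  assumes "sqint M X"
  shows "sqint M (\<lambda>\<omega>. k *\<^sub>R X \<omega>)"
  using assms by (auto simp: sqint_def power_mult_distrib)

lemma sqint_diff:
  assumes "sqint M X" "sqint M Y"
  shows "sqint M (\<lambda>\<omega>. X \<omega> - Y \<omega>)"
  using sqint_add[OF assms(1) sqint_scaleR[OF assms(2), of "-1"]] by simp

lemma (in prob_space) sqint_const: "sqint M (\<lambda>_. k)"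
  by (simp add: sqint_def)

text \<open>The additive constant is integrable because the measure is finite. Lipschitz images,
  projections and bounded biases are all instances.\<close>

lemma (in prob_space) sqint_bound:
  fixes X :: "'a \<Rightarrow> 'v::euclidean_space" and Y :: "'a \<Rightarrow> 'u::euclidean_space"
  assumes "sqint M X" "Y \<in> borel_measurable M" "AE \<omega> in M. norm (Y \<omega>) \<le> k * norm (X \<omega>) + l"
  shows "sqint M Y"
  unfolding sqint_def
proof
  show "integrable M (\<lambda>\<omega>. (norm (Y \<omega>))\<^sup>2)"
  proof (rule Bochner_Integration.integrable_bound)
    show "integrable M (\<lambda>\<omega>. 2 * (k\<^sup>2 * (norm (X \<omega>))\<^sup>2) + 2 * l\<^sup>2)"
      using assms(1) by (simp add: sqint_integrable)
    show "AE \<omega> in M. norm ((norm (Y \<omega>))\<^sup>2) \<le> norm (2 * (k\<^sup>2 * (norm (X \<omega>))\<^sup>2) + 2 * l\<^sup>2)"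
      using assms(3)
    proof eventually_elim
      case (elim \<omega>)
      have "(norm (Y \<omega>))\<^sup>2 \<le> (k * norm (X \<omega>) + l)\<^sup>2" using elim by (intro power_mono) auto
      also have "\<dots> \<le> 2 * (k * norm (X \<omega>))\<^sup>2 + 2 * l\<^sup>2"
        using norm_add_sq_le[of "k * norm (X \<omega>)" l] by simp
      finally show ?case by (simp add: power_mult_distrib)
    qed
  qed (use assms(2) in measurable)
qed (use assms in simp)

lemma (in prob_space) sqint_lipschitz:
  fixes X :: "'a \<Rightarrow> 'v::euclidean_space" and f :: "'v \<Rightarrow> 'u::euclidean_space"
  assumes "sqint M X" "k-lipschitz_on UNIV f"
  shows "sqint M (\<lambda>\<omega>. f (X \<omega>))"
proof (rule sqint_bound[OF assms(1)])
  have [measurable]: "f \<in> borel_measurable borel"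
    using assms(2) by (intro borel_measurable_continuous_onI lipschitz_on_continuous_on)
  have [measurable]: "X \<in> borel_measurable M" using assms(1) by (rule sqint_measurable)
  show "(\<lambda>\<omega>. f (X \<omega>)) \<in> borel_measurable M" by measurable
  show "AE \<omega> in M. norm (f (X \<omega>)) \<le> k * norm (X \<omega>) + norm (f 0)"
  proof (rule AE_I2)
    fix \<omega>
    have "norm (f (X \<omega>) - f 0) \<le> k * norm (X \<omega>)"
      using lipschitz_onD[OF assms(2), of "X \<omega>" 0] by (simp add: dist_norm)
    then show "norm (f (X \<omega>)) \<le> k * norm (X \<omega>) + norm (f 0)"
      using norm_triangle_ineq2[of "f (X \<omega>)" "f 0"] by linarith
  qed
qed

lemma (in prob_space) sqint_fst: "sqint M X \<Longrightarrow> sqint M (\<lambda>\<omega>. fst (X \<omega>))"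
  by (rule sqint_bound[of X _ 1 0]) (auto simp: fst_lipschitz intro: sqint_measurable measurable_compose[OF _ borel_measurable_continuous_onI[OF continuous_on_fst[OF continuous_on_id]]])

lemma (in prob_space) sqint_snd: "sqint M X \<Longrightarrow> sqint M (\<lambda>\<omega>. snd (X \<omega>))"
  by (rule sqint_bound[of X _ 1 0]) (auto simp: snd_lipschitz intro: sqint_measurable measurable_compose[OF _ borel_measurable_continuous_onI[OF continuous_on_snd[OF continuous_on_id]]])

lemma sqint_Pair: "sqint M X \<Longrightarrow> sqint M Y \<Longrightarrow> sqint M (\<lambda>\<omega>. (X \<omega>, Y \<omega>))"
  by (auto simp: sqint_def norm_Pair)

lemma sqint_cong: "(\<And>\<omega>. \<omega> \<in> space M \<Longrightarrow> X \<omega> = Y \<omega>) \<Longrightarrow> sqint M X \<longleftrightarrow> sqint M Y"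
  unfolding sqint_def by (intro conj_cong measurable_cong Bochner_Integration.integrable_cong) auto

text \<open>Polarization expresses the inner product by three integrable squared norms.\<close>

lemma sqint_inner:
  assumes "sqint M X" "sqint M Y"
  shows "integrable M (\<lambda>\<omega>. inner (X \<omega>) (Y \<omega>))"
proof -
  have "inner (X \<omega>) (Y \<omega>) = ((norm (X \<omega> + Y \<omega>))\<^sup>2 - (norm (X \<omega>))\<^sup>2 - (norm (Y \<omega>))\<^sup>2) / 2" for \<omega>
    unfolding power2_norm_eq_inner by (simp add: inner_add_left inner_add_right inner_commute)
  then show ?thesis
    using sqint_integrable[OF sqint_add[OF assms]] assms[THEN sqint_integrable]
    by (simp only: integrable_divide_zero Bochner_Integration.integrable_diff)
qed

lemma (in prob_space) sqint_norm_integrable: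
  assumes "sqint M X" shows "integrable M (\<lambda>\<omega>. norm (X \<omega>))"
proof -
  have "sqint M (\<lambda>\<omega>. norm (X \<omega>))" using assms by (auto simp: sqint_def)
  from sqint_inner[OF this sqint_const[of "1::real"]] show ?thesis by simp
qed

text \<open>Jensen's inequality, read off from the nonnegativity of the variance.\<close>

lemma (in prob_space) expectation_norm_le:
  assumes "sqint M X" shows "expectation (\<lambda>\<omega>. norm (X \<omega>)) \<le> sqrt (msq M X)"
proof (rule real_le_rsqrt)
  have "0 \<le> variance (\<lambda>\<omega>. norm (X \<omega>))" by simp
  also have "\<dots> = msq M X - (expectation (\<lambda>\<omega>. norm (X \<omega>)))\<^sup>2"
    using assms by (intro variance_eq sqint_norm_integrable sqint_integrable)
  finally show "(expectation (\<lambda>\<omega>. norm (X \<omega>)))\<^sup>2 \<le> msq M X" by simp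
qed

text \<open>Orthogonality to the square-integrable \<open>G\<close>-measurable vectors is the only
  trace of conditional expectation that the later estimates see.\<close>

definition noise :: "'w measure \<Rightarrow> 'w measure \<Rightarrow> real \<Rightarrow> ('w \<Rightarrow> 'v::euclidean_space) \<Rightarrow> bool" where
  "noise M G \<sigma> e \<longleftrightarrow> sqint M e \<and> msq M e \<le> \<sigma>\<^sup>2 \<and>
     (\<forall>Y. Y \<in> borel_measurable G \<longrightarrow> sqint M Y \<longrightarrow> (\<integral>\<omega>. inner (Y \<omega>) (e \<omega>) \<partial>M) = 0)"

text \<open>The variance bound for the lower level concerns the full gradient, while the iteration
  uses only its second block; test vectors are padded with zero.\<close>

lemma (in prob_space) noise_snd:
  fixes e :: "'a \<Rightarrow> 'v::euclidean_space \<times> 'u::euclidean_space"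
  assumes "noise M G \<sigma> e" shows "noise M G \<sigma> (\<lambda>\<omega>. snd (e \<omega>))"
  unfolding noise_def
proof (intro conjI allI impI)
  have e: "sqint M e" using assms by (simp add: noise_def)
  then show s: "sqint M (\<lambda>\<omega>. snd (e \<omega>))" by (rule sqint_snd)
  have "msq M (\<lambda>\<omega>. snd (e \<omega>)) \<le> msq M e"
    using sqint_integrable[OF s] sqint_integrable[OF e]
    by (rule integral_mono) (auto simp: snd_lipschitz intro: power_mono)
  then show "msq M (\<lambda>\<omega>. snd (e \<omega>)) \<le> \<sigma>\<^sup>2" using assms by (simp add: noise_def)
  fix Y :: "'a \<Rightarrow> 'u" assume Y: "Y \<in> borel_measurable G" "sqint M Y"
  have "(\<lambda>\<omega>. (0::'v, Y \<omega>)) \<in> borel_measurable G" using Y(1) by (intro borel_measurable_Pair) auto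
  moreover have "sqint M (\<lambda>\<omega>. (0::'v, Y \<omega>))" using Y(2) sqint_const by (rule sqint_Pair[rotated])
  ultimately have "(\<integral>\<omega>. inner (0, Y \<omega>) (e \<omega>) \<partial>M) = 0" using assms unfolding noise_def by blast
  then show "(\<integral>\<omega>. inner (Y \<omega>) (snd (e \<omega>)) \<partial>M) = 0" by (simp add: inner_prod_def)
qed

text \<open>The conditional second moment is bounded in \<open>ennreal\<close>, so integrating it
  makes the error square integrable before anything is known about \<open>X\<close>; then
  \<open>X\<close> is a sum of two square-integrable vectors. Orthogonality is checked per
  coordinate, because \<open>vec_cond_exp\<close> is defined that way.\<close>

lemma (in prob_space) mean_variance_noise:
  fixes X c :: "'a \<Rightarrow> 'v::euclidean_space"
  assumes sub: "subalgebra M G" and mv: "mean_variance M G \<sigma> X c"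
    and X[measurable]: "X \<in> borel_measurable M" and c: "sqint M c"
  shows "sqint M X" "noise M G \<sigma> (\<lambda>\<omega>. X \<omega> - c \<omega>)"
proof -
  let ?e = "\<lambda>\<omega>. X \<omega> - c \<omega>"
  interpret G: finite_measure_subalgebra M G
    by unfold_locales (rule sub)
  have [measurable]: "c \<in> borel_measurable M" using c by (rule sqint_measurable)
  have "(\<integral>\<^sup>+\<omega>. ennreal ((norm (?e \<omega>))\<^sup>2) \<partial>M) = (\<integral>\<^sup>+\<omega>. 1 * nn_cond_exp M G (\<lambda>\<omega>. ennreal ((norm (?e \<omega>))\<^sup>2)) \<omega> \<partial>M)"
    by (subst G.nn_cond_exp_intg) auto
  also have "\<dots> \<le> (\<integral>\<^sup>+\<omega>. ennreal (\<sigma>\<^sup>2) \<partial>M)"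
    using mv unfolding mean_variance_def by (intro nn_integral_mono_AE) auto
  finally have bound: "(\<integral>\<^sup>+\<omega>. ennreal ((norm (?e \<omega>))\<^sup>2) \<partial>M) \<le> ennreal (\<sigma>\<^sup>2)"
    by (simp add: emeasure_space_1)
  then have int: "integrable M (\<lambda>\<omega>. (norm (?e \<omega>))\<^sup>2)"
    by (intro integrableI_bounded) (auto intro: le_less_trans)
  then have e: "sqint M ?e" by (simp add: sqint_def)
  have "ennreal (msq M ?e) \<le> ennreal (\<sigma>\<^sup>2)"
    using bound nn_integral_eq_integral[OF int] by simp
  then have msq: "msq M ?e \<le> \<sigma>\<^sup>2" by simp
  show X2: "sqint M X" using sqint_add[OF e c] by simp
  have "(\<integral>\<omega>. inner (Y \<omega>) (?e \<omega>) \<partial>M) = 0" if Y: "Y \<in> borel_measurable G" "sqint M Y" for Y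
  proof -
    have comp: "sqint M (\<lambda>\<omega>. Z \<omega> \<bullet> b)" if "sqint M Z" "b \<in> Basis" for Z :: "'a \<Rightarrow> 'v" and b
      by (rule sqint_bound[OF that(1), of _ 1 0])
         (use that sqint_measurable[OF that(1)] in \<open>auto simp: Basis_le_norm\<close>)
    have coord: "integrable M (\<lambda>\<omega>. (Y \<omega> \<bullet> b) * (?e \<omega> \<bullet> b)) \<and> (\<integral>\<omega>. (Y \<omega> \<bullet> b) * (?e \<omega> \<bullet> b) \<partial>M) = 0"
      if b: "b \<in> Basis" for b
    proof -
      have Yb: "(\<lambda>\<omega>. Y \<omega> \<bullet> b) \<in> borel_measurable G" using Y(1) by measurable
      have Xi: "integrable M (\<lambda>\<omega>. (Y \<omega> \<bullet> b) * (X \<omega> \<bullet> b))"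
        and ci: "integrable M (\<lambda>\<omega>. (Y \<omega> \<bullet> b) * (c \<omega> \<bullet> b))"
        using sqint_inner[OF comp[OF Y(2) b] comp[OF X2 b]] sqint_inner[OF comp[OF Y(2) b] comp[OF c b]]
        by simp_all
      have "(\<integral>\<omega>. (Y \<omega> \<bullet> b) * (X \<omega> \<bullet> b) \<partial>M) = (\<integral>\<omega>. (Y \<omega> \<bullet> b) * real_cond_exp M G (\<lambda>\<omega>. X \<omega> \<bullet> b) \<omega> \<partial>M)"
        using Xi Yb by (intro G.real_cond_exp_intg(2)[symmetric]) auto
      also have "\<dots> = (\<integral>\<omega>. (Y \<omega> \<bullet> b) * (c \<omega> \<bullet> b) \<partial>M)"
      proof (rule integral_cong_AE)
        have [measurable]: "(\<lambda>\<omega>. Y \<omega> \<bullet> b) \<in> borel_measurable M"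
          using comp[OF Y(2) b] by (rule sqint_measurable)
        show "(\<lambda>\<omega>. (Y \<omega> \<bullet> b) * real_cond_exp M G (\<lambda>\<omega>. X \<omega> \<bullet> b) \<omega>) \<in> borel_measurable M"
          "(\<lambda>\<omega>. (Y \<omega> \<bullet> b) * (c \<omega> \<bullet> b)) \<in> borel_measurable M" by measurable
        have "AE \<omega> in M. vec_cond_exp M G X \<omega> = c \<omega>" using mv by (simp add: mean_variance_def)
        then show "AE \<omega> in M. (Y \<omega> \<bullet> b) * real_cond_exp M G (\<lambda>\<omega>. X \<omega> \<bullet> b) \<omega> = (Y \<omega> \<bullet> b) * (c \<omega> \<bullet> b)"
        proof eventually_elim
          case (elim \<omega>)
          have "c \<omega> \<bullet> b = real_cond_exp M G (\<lambda>\<omega>. X \<omega> \<bullet> b) \<omega>"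
            using b unfolding elim[symmetric] vec_cond_exp_def by (simp add: inner_sum_left_Basis)
          then show ?case by simp
        qed
      qed
      finally show ?thesis using Xi ci by (simp add: inner_diff_left right_diff_distrib)
    qed
    have "(\<integral>\<omega>. inner (Y \<omega>) (?e \<omega>) \<partial>M) = (\<integral>\<omega>. (\<Sum>b\<in>Basis. (Y \<omega> \<bullet> b) * (?e \<omega> \<bullet> b)) \<partial>M)"
      by (subst euclidean_inner) simp
    also have "\<dots> = (\<Sum>b\<in>Basis. \<integral>\<omega>. (Y \<omega> \<bullet> b) * (?e \<omega> \<bullet> b) \<partial>M)"
      using coord by (intro Bochner_Integration.integral_sum) auto
    also have "\<dots> = 0" using coord by simp
    finally show ?thesis .
  qed
  then show "noise M G \<sigma> ?e" using e msq by (simp add: noise_def)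
qed

text \<open>\<open>m\<close> plays the momentum minus its target and \<open>b\<close> the
  conditional bias of the direction. The noise is orthogonal to the \<open>G\<close>-measurable rest
  and enters only with the factor \<open>\<eta>^2\<close>; the bias is averaged by
  convexity.\<close>

lemma (in prob_space) momentum_step:
  fixes m b e :: "'a \<Rightarrow> 'v::euclidean_space"
  assumes e: "noise M G \<sigma> e" and \<eta>: "0 \<le> \<eta>" "\<eta> \<le> 1"
    and m: "sqint M m" "m \<in> borel_measurable G" and b: "sqint M b" "b \<in> borel_measurable G"
  shows "msq M (\<lambda>\<omega>. (1 - \<eta>) *\<^sub>R m \<omega> + \<eta> *\<^sub>R (b \<omega> + e \<omega>))
      \<le> (1 - \<eta>) * msq M m + \<eta> * msq M b + \<eta>\<^sup>2 * \<sigma>\<^sup>2"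
proof -
  let ?Y = "\<lambda>\<omega>. (1 - \<eta>) *\<^sub>R m \<omega> + \<eta> *\<^sub>R b \<omega>"
  have Y: "sqint M ?Y" by (intro sqint_add sqint_scaleR m b)
  have Ym: "?Y \<in> borel_measurable G" using m(2) b(2) by measurable
  have se: "sqint M e" using e by (simp add: noise_def)
  note int = sqint_integrable[OF Y] sqint_integrable[OF se] sqint_inner[OF Y se]
    sqint_integrable[OF m(1)] sqint_integrable[OF b(1)]
  have "(norm ((1 - \<eta>) *\<^sub>R m \<omega> + \<eta> *\<^sub>R (b \<omega> + e \<omega>)))\<^sup>2
      = (norm (?Y \<omega>))\<^sup>2 + 2 * \<eta> * inner (?Y \<omega>) (e \<omega>) + \<eta>\<^sup>2 * (norm (e \<omega>))\<^sup>2" for \<omega>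
  proof -
    have "(1 - \<eta>) *\<^sub>R m \<omega> + \<eta> *\<^sub>R (b \<omega> + e \<omega>) = ?Y \<omega> - (- \<eta>) *\<^sub>R e \<omega>" by (simp add: algebra_simps)
    then show ?thesis by (simp only: norm_diff_scaleR_sq) simp
  qed
  then have "msq M (\<lambda>\<omega>. (1 - \<eta>) *\<^sub>R m \<omega> + \<eta> *\<^sub>R (b \<omega> + e \<omega>))
      = msq M ?Y + 2 * \<eta> * (\<integral>\<omega>. inner (?Y \<omega>) (e \<omega>) \<partial>M) + \<eta>\<^sup>2 * msq M e"
    using int by simp
  also have "(\<integral>\<omega>. inner (?Y \<omega>) (e \<omega>) \<partial>M) = 0" using e Y Ym unfolding noise_def by blast
  also have "msq M ?Y \<le> (\<integral>\<omega>. (1 - \<eta>) * (norm (m \<omega>))\<^sup>2 + \<eta> * (norm (b \<omega>))\<^sup>2 \<partial>M)"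
    using int \<eta> by (intro integral_mono norm_convex_sq) auto
  also have "\<dots> = (1 - \<eta>) * msq M m + \<eta> * msq M b" using int by simp
  also have "\<eta>\<^sup>2 * msq M e \<le> \<eta>\<^sup>2 * \<sigma>\<^sup>2" using e by (intro mult_left_mono) (auto simp: noise_def)
  finally show ?thesis by simp
qed

lemma msq_add_young:
  fixes X Y :: "'w \<Rightarrow> 'v::euclidean_space"
  assumes "sqint M X" "sqint M Y" "0 < e"
  shows "msq M (\<lambda>\<omega>. X \<omega> + Y \<omega>) \<le> (1 + e) * msq M X + (1 + 1 / e) * msq M Y"
proof -
  note int = sqint_integrable[OF sqint_add[OF assms(1,2)]] assms(1,2)[THEN sqint_integrable]
  have "msq M (\<lambda>\<omega>. X \<omega> + Y \<omega>) \<le> (\<integral>\<omega>. (1 + e) * (norm (X \<omega>))\<^sup>2 + (1 + 1 / e) * (norm (Y \<omega>))\<^sup>2 \<partial>M)"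
    using int by (intro integral_mono norm_add_sq_young assms) auto
  then show ?thesis using int by simp
qed

section \<open>The penalized objective and the stationarity measure\<close>

lemma GDERIV_sum:
  assumes "\<And>i. i \<in> I \<Longrightarrow> GDERIV (f i) x :> D i"
  shows "GDERIV (\<lambda>x. \<Sum>i\<in>I. f i x) x :> (\<Sum>i\<in>I. D i)"
  using assms unfolding gderiv_def inner_sum_right by (rule has_derivative_sum)

lemma GDERIV_cmult:
  fixes f :: "'a::real_inner \<Rightarrow> real"
  assumes "GDERIV f x :> D" shows "GDERIV (\<lambda>x. k * f x) x :> k *\<^sub>R D"
  using GDERIV_mult[OF GDERIV_const assms, of k] by simp

text \<open>The index set may be uncountable, but a strict sublevel set of the infimum is a union of
  open sets. Nonnegativity keeps the infimum a genuine one.\<close>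

lemma borel_measurable_INF_continuous:
  fixes f :: "'i \<Rightarrow> 'a::topological_space \<Rightarrow> real"
  assumes cont: "\<And>i. i \<in> I \<Longrightarrow> continuous_on UNIV (f i)" and "I \<noteq> {}"
    and low: "\<And>i x. i \<in> I \<Longrightarrow> 0 \<le> f i x"
  shows "(\<lambda>x. INF i\<in>I. f i x) \<in> borel_measurable borel"
  unfolding borel_measurable_iff_less
proof
  fix k
  have "{x \<in> space borel. (INF i\<in>I. f i x) < k} = (\<Union>i\<in>I. {x. f i x < k})"
    using cINF_less_iff[OF \<open>I \<noteq> {}\<close> bdd_belowI2[OF low]] by auto
  also have "open \<dots>"
    using cont by (intro open_UN ballI open_Collect_less) (auto intro: continuous_intros)
  finally show "{x \<in> space borel. (INF i\<in>I. f i x) < k} \<in> sets borel" by simp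
qed

locale bilevel =
  fixes P :: "('s, 'r, 'm::finite, 'dx::finite, 'dy::finite) problem"
    and Flow Lf Lg LF \<rho>x \<rho>y :: real
  assumes data: "stochastic_data P"
    and smoothing: "0 < smoothing P"
    and pref: "pref P \<in> prob_simplex_pos"
    and Flow: "\<And>p. Flow \<le> stch P p"
    and smooth_f: "\<And>i. lipschitz_gradient Lf (objf P i)"
    and smooth_g: "lipschitz_gradient Lg (objg P)"
    and smooth_F: "lipschitz_gradient LF (stch P)"
    and weakly_convex: "0 < \<rho>x" "0 < \<rho>y"
      "convex_on UNIV (\<lambda>(x, y). objg P (x, y) + \<rho>x / 2 * (norm x)\<^sup>2 + \<rho>y / 2 * (norm y)\<^sup>2)"
    and gam: "0 < gam P" "gam P < 1 / (2 * \<rho>y)"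
begin

text \<open>On a slice with fixed \<open>x\<close> the joint weak convexity loses its
  \<open>x\<close>-quadratic, which is constant along convex combinations there.\<close>

sublocale lower: weakly_convex_lower "objg P" "nabla (objg P)" Lg \<rho>y "gam P"
proof
  show "convex_on UNIV (\<lambda>\<theta>. objg P (x, \<theta>) + \<rho>y / 2 * (norm \<theta>)\<^sup>2)" for x
  proof (rule convex_onI)
    fix t :: real and u v :: "real^'dy" assume t: "0 < t" "t < 1"
    have "(1 - t) *\<^sub>R x + t *\<^sub>R x = x" by (simp add: algebra_simps)
    moreover have "(1 - t) * k + t * k = k" for k
      by (simp add: algebra_simps)
    from this[of "\<rho>x / 2 * (norm x)\<^sup>2"]
    have "(1 - t) * (\<rho>x / 2 * (norm x)\<^sup>2) + t * (\<rho>x / 2 * (norm x)\<^sup>2) = \<rho>x / 2 * (norm x)\<^sup>2" .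
    ultimately show "objg P (x, (1 - t) *\<^sub>R u + t *\<^sub>R v) + \<rho>y / 2 * (norm ((1 - t) *\<^sub>R u + t *\<^sub>R v))\<^sup>2
        \<le> (1 - t) * (objg P (x, u) + \<rho>y / 2 * (norm u)\<^sup>2) + t * (objg P (x, v) + \<rho>y / 2 * (norm v)\<^sup>2)"
      using convex_onD[OF weakly_convex(3), of t "(x, u)" "(x, v)"] t
      by (simp add: distrib_left)
  qed simp
  show "gam P * \<rho>y < 1"
    using gam weakly_convex(2) by (simp add: field_simps)
qed (use lipschitz_gradientD[OF smooth_g] gam in auto)

lemma moreau_eq: "moreau P = lower.env"
  by (auto simp: moreau_def lower.env_def lower.obj_def fun_eq_iff)

lemma gap_nonneg: "0 \<le> gap P z"
  using lower.env_le by (simp add: gap_def moreau_eq)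

definition Dgap :: "('dx, 'dy) pt \<Rightarrow> ('dx, 'dy) pt" where
  "Dgap z = nabla (objg P) z - lower.Genv z"

definition Lgap :: real where
  "Lgap = Lg + 2 * lower.K * (1 + lower.K / lower.\<mu>)"

lemma nabla_moreau: "nabla (moreau P) z = lower.Genv z"
  unfolding moreau_eq by (rule nabla_eq[OF lower.GDERIV_env])

lemma GDERIV_gap: "GDERIV (gap P) z :> Dgap z"
  using GDERIV_diff[OF lower.grad lower.GDERIV_env]
  by (simp add: Dgap_def gap_def[abs_def] moreau_eq)

lemma Dgap_lip: "Lgap-lipschitz_on UNIV Dgap"
  using lipschitz_on_diff_gradient[OF lower.lip lower.Genv_lip] by (simp add: Dgap_def[abs_def] Lgap_def)

section \<open>The scalarized objective and the scaled penalized objective\<close>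

abbreviation "DF \<equiv> nabla (stch P)"

lemma GDERIV_F: "GDERIV (stch P) z :> DF z" and DF_lip: "LF-lipschitz_on UNIV DF"
  using lipschitz_gradientD[OF smooth_F] by auto

text \<open>The penalized objective divided by \<open>c\<close>. Its gradient is what the upper
  directions estimate, up to the current \<open>\<theta>\<close> in place of the proximal point and
  the updated \<open>x\<close> in the \<open>y\<close>-direction.\<close>

definition \<Phi> :: "real \<Rightarrow> ('dx, 'dy) pt \<Rightarrow> real" where
  "\<Phi> c z = (1 / c) * (stch P z - Flow) + gap P z"

definition D\<Phi> :: "real \<Rightarrow> ('dx, 'dy) pt \<Rightarrow> ('dx, 'dy) pt" where
  "D\<Phi> c z = (1 / c) *\<^sub>R DF z + Dgap z"

lemma GDERIV_\<Phi>: "GDERIV (\<Phi> c) z :> D\<Phi> c z"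
  unfolding \<Phi>_def[abs_def] D\<Phi>_def
  by (rule GDERIV_add[OF GDERIV_cmult GDERIV_gap])
     (use GDERIV_diff[OF GDERIV_F GDERIV_const] in simp)

lemma LF_nonneg: "0 \<le> LF"
  using lipschitz_on_nonneg DF_lip by blast

lemma D\<Phi>_lip:
  assumes "0 < c0" "c0 \<le> c"
  shows "(LF / c0 + Lgap)-lipschitz_on UNIV (D\<Phi> c)"
proof -
  have "(1 / c * LF)-lipschitz_on UNIV (\<lambda>z. (1 / c) *\<^sub>R DF z)"
    using lipschitz_on_cmult[OF DF_lip, of "1 / c"] assms by simp
  then have "(1 / c * LF + Lgap)-lipschitz_on UNIV (D\<Phi> c)"
    unfolding D\<Phi>_def[abs_def] by (rule lipschitz_on_add[OF _ Dgap_lip])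
  then show ?thesis
    by (rule lipschitz_on_le) (use assms LF_nonneg in \<open>simp add: frac_le\<close>)
qed

lemma \<Phi>_nonneg: "0 < c \<Longrightarrow> 0 \<le> \<Phi> c z"
  using Flow[of z] gap_nonneg by (simp add: \<Phi>_def)

lemma \<Phi>_antimono: "0 < c \<Longrightarrow> c \<le> c' \<Longrightarrow> \<Phi> c' z \<le> \<Phi> c z"
  using Flow[of z] by (simp add: \<Phi>_def frac_le)

text \<open>\<open>LF + 1\<close> replaces \<open>LF\<close> because
  \<open>gradient_le_value_gap\<close> asks for a positive constant.\<close>

lemma DF_le_value: "(norm (DF z))\<^sup>2 \<le> 4 * (LF + 1) * (stch P z - Flow)"
  by (rule gradient_le_value_gap[OF GDERIV_F lipschitz_on_le[OF DF_lip]]) (use LF_nonneg Flow in auto)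

section \<open>Softmax weights and the Pareto multiplier\<close>

definition sw :: "'m \<Rightarrow> ('dx, 'dy) pt \<Rightarrow> real" where
  "sw i z = exp (smoothing P * pref P $ i * (objf P i z - ideal P $ i))
     / (\<Sum>j\<in>UNIV. exp (smoothing P * pref P $ j * (objf P j z - ideal P $ j)))"

definition weight :: "('dx, 'dy) pt \<Rightarrow> real" where
  "weight z = (\<Sum>i\<in>UNIV. sw i z * pref P $ i)"

text \<open>Positive because the preference is strictly positive; it bounds \<open>weight\<close>
  from below and thereby the multiplier \<open>c / weight z\<close> from above, uniformly in the
  point.\<close>

definition wmin :: real where "wmin = Min (range (\<lambda>i. pref P $ i))"

lemma wmin_pos: "0 < wmin" and wmin_le: "wmin \<le> pref P $ i"
  using pref by (auto simp: wmin_def prob_simplex_pos_def)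

lemma exp_sum_pos: "0 < (\<Sum>j\<in>UNIV. exp (smoothing P * pref P $ j * (objf P j z - ideal P $ j)))"
  by (intro sum_pos) auto

lemma sw_pos: "0 < sw i z" and sw_sum: "(\<Sum>i\<in>UNIV. sw i z) = 1"
  using exp_sum_pos[of z] by (simp_all add: sw_def sum_divide_distrib[symmetric])

lemma wmin_le_weight: "wmin \<le> weight z"
proof -
  have "wmin = (\<Sum>i\<in>UNIV. sw i z * wmin)" by (simp add: sum_distrib_right[symmetric] sw_sum)
  also have "\<dots> \<le> weight z"
    unfolding weight_def using sw_pos wmin_le by (intro sum_mono mult_left_mono) (auto simp: less_imp_le)
  finally show ?thesis .
qed

text \<open>The chain rule for log-sum-exp; the smoothing parameter cancels between the outer factor
  and the exponents.\<close>

lemma DF_eq: "DF z = (\<Sum>i\<in>UNIV. (sw i z * pref P $ i) *\<^sub>R nabla (objf P i) z)"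
proof (rule nabla_eq)
  let ?\<mu> = "smoothing P" and ?w = "\<lambda>i. pref P $ i"
  let ?e = "\<lambda>i z. exp (?\<mu> * ?w i * (objf P i z - ideal P $ i))"
  have "GDERIV (?e i) z :> (?e i z * (?\<mu> * ?w i)) *\<^sub>R nabla (objf P i) z" for i
  proof -
    have "GDERIV (\<lambda>z. objf P i z - ideal P $ i) z :> nabla (objf P i) z"
      using GDERIV_diff[OF lipschitz_gradientD(1)[OF smooth_f] GDERIV_const] by simp
    from GDERIV_DERIV_compose[OF GDERIV_cmult[OF this] DERIV_exp] show ?thesis by simp
  qed
  then have "GDERIV (\<lambda>z. \<Sum>i\<in>UNIV. ?e i z) z :> (\<Sum>i\<in>UNIV. (?e i z * (?\<mu> * ?w i)) *\<^sub>R nabla (objf P i) z)"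
    by (rule GDERIV_sum)
  from GDERIV_cmult[OF GDERIV_DERIV_compose[OF this DERIV_ln[OF exp_sum_pos]], of "1 / ?\<mu>"]
  have "GDERIV (stch P) z :> (1 / ?\<mu>) *\<^sub>R inverse (\<Sum>i\<in>UNIV. ?e i z) *\<^sub>R
      (\<Sum>i\<in>UNIV. (?e i z * (?\<mu> * ?w i)) *\<^sub>R nabla (objf P i) z)"
    by (simp add: stch_def[abs_def])
  also have "(1 / ?\<mu>) *\<^sub>R inverse (\<Sum>i\<in>UNIV. ?e i z) *\<^sub>R
      (\<Sum>i\<in>UNIV. (?e i z * (?\<mu> * ?w i)) *\<^sub>R nabla (objf P i) z)
      = (\<Sum>i\<in>UNIV. (sw i z * ?w i) *\<^sub>R nabla (objf P i) z)"
    unfolding scaleR_right.sum scaleR_scaleR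
    using smoothing by (intro sum.cong refl arg_cong2[where f = scaleR]) (simp_all add: sw_def field_simps)
  finally show "GDERIV (stch P) z :> (\<Sum>i\<in>UNIV. (sw i z * ?w i) *\<^sub>R nabla (objf P i) z)" .
qed

lemma stat_measure_eq:
  "stat_measure P pm (gap P z) z =
     (INF l\<in>prob_simplex. norm ((\<Sum>i\<in>UNIV. l $ i *\<^sub>R nabla (objf P i) z) + pm *\<^sub>R Dgap z))"
  by (simp add: stat_measure_def nabla_moreau Dgap_def)

lemma prob_simplex_nonempty: "(prob_simplex :: (real^'m) set) \<noteq> {}"
  using pref by (auto simp: prob_simplex_pos_def)

lemma stat_measure_nonneg: "0 \<le> stat_measure P pm (gap P z) z"
  unfolding stat_measure_eq by (rule cINF_greatest[OF prob_simplex_nonempty]) simp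

text \<open>Normalizing the softmax weights of \<^term>\<open>DF\<close> yields a point of the simplex, and the
  multiplier \<^term>\<open>c / weight z\<close> turns the combination into a multiple of \<^term>\<open>D\<Phi> c z\<close>.\<close>

lemma stat_measure_le:
  assumes "0 < c"
  shows "stat_measure P (c / weight z) (gap P z) z \<le> c / wmin * norm (D\<Phi> c z)"
proof -
  have W: "0 < weight z" using wmin_pos wmin_le_weight[of z] by linarith
  define l :: "real^'m" where "l = (\<chi> i. sw i z * pref P $ i / weight z)"
  have "l \<in> prob_simplex"
    using W sw_pos[of _ z] wmin_pos wmin_le
    by (auto simp: l_def prob_simplex_def sum_divide_distrib[symmetric] weight_def[symmetric]
        intro!: divide_nonneg_pos mult_nonneg_nonneg less_imp_le[OF sw_pos]
          order_trans[OF less_imp_le[OF wmin_pos] wmin_le])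
  then have "stat_measure P (c / weight z) (gap P z) z
      \<le> norm ((\<Sum>i\<in>UNIV. l $ i *\<^sub>R nabla (objf P i) z) + (c / weight z) *\<^sub>R Dgap z)"
    unfolding stat_measure_eq by (intro cINF_lower) (auto intro!: bdd_belowI2[of _ 0])
  also have "(\<Sum>i\<in>UNIV. l $ i *\<^sub>R nabla (objf P i) z) = (1 / weight z) *\<^sub>R DF z"
    unfolding DF_eq scaleR_right.sum by (simp add: l_def)
  also have "(1 / weight z) *\<^sub>R DF z + (c / weight z) *\<^sub>R Dgap z = (c / weight z) *\<^sub>R D\<Phi> c z"
    using assms by (simp add: D\<Phi>_def scaleR_add_right)
  also have "norm \<dots> = c / weight z * norm (D\<Phi> c z)" using W assms by simp
  also have "\<dots> \<le> c / wmin * norm (D\<Phi> c z)"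
    using W assms wmin_pos wmin_le_weight by (intro mult_right_mono divide_left_mono) auto
  finally show ?thesis .
qed

lemma continuous_f: "continuous_on UNIV (objf P i)"
proof -
  have "\<forall>p. objf P i differentiable at p" using smooth_f unfolding lipschitz_gradient_def by blast
  then show ?thesis
    by (intro continuous_at_imp_continuous_on ballI differentiable_imp_continuous_within) auto
qed

lemma weight_measurable [measurable]: "weight \<in> borel_measurable borel"
proof (rule borel_measurable_continuous_onI)
  have "(\<Sum>j\<in>UNIV. exp (smoothing P * pref P $ j * (objf P j z - ideal P $ j))) \<noteq> 0" for z
    using exp_sum_pos[of z] by linarith
  then show "continuous_on UNIV weight"
    unfolding weight_def[abs_def] sw_def by (intro continuous_intros continuous_f) auto
qed

text \<open>As a function of the pair of point and multiplier the measure is an infimum of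
  continuous functions; it is then composed with the random pair.\<close>

lemma stat_measure_measurable:
  assumes [measurable]: "Z \<in> M \<rightarrow>\<^sub>M borel" "pm \<in> M \<rightarrow>\<^sub>M borel"
  shows "(\<lambda>\<omega>. stat_measure P (pm \<omega>) (gap P (Z \<omega>)) (Z \<omega>)) \<in> borel_measurable M"
proof -
  have "(\<lambda>x. INF l\<in>prob_simplex. norm ((\<Sum>i\<in>UNIV. l $ i *\<^sub>R nabla (objf P i) (fst x)) + snd x *\<^sub>R Dgap (fst x)))
      \<in> borel_measurable borel"
  proof (rule borel_measurable_INF_continuous)
    have "continuous_on UNIV (\<lambda>x::('dx, 'dy) pt \<times> real. nabla (objf P i) (fst x))" for i
      using continuous_on_compose2[OF lipschitz_on_continuous_on[OF lipschitz_gradientD(2)[OF smooth_f]]]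
      by (auto intro!: continuous_on_fst continuous_on_id)
    moreover have "continuous_on UNIV (\<lambda>x::('dx, 'dy) pt \<times> real. Dgap (fst x))"
      using continuous_on_compose2[OF lipschitz_on_continuous_on[OF Dgap_lip]]
      by (auto intro!: continuous_on_fst continuous_on_id)
    ultimately show "continuous_on UNIV (\<lambda>x::('dx, 'dy) pt \<times> real.
        norm ((\<Sum>i\<in>UNIV. l $ i *\<^sub>R nabla (objf P i) (fst x)) + snd x *\<^sub>R Dgap (fst x)))" for l
      by (intro continuous_intros) auto
  qed (auto simp: prob_simplex_nonempty)
  moreover have "(\<lambda>\<omega>. (Z \<omega>, pm \<omega>)) \<in> borel_measurable M"
    by (intro borel_measurable_Pair assms)
  ultimately have "(\<lambda>\<omega>. INF l\<in>prob_simplex. norm ((\<Sum>i\<in>UNIV. l $ i *\<^sub>R nabla (objf P i) (fst (Z \<omega>, pm \<omega>)))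
      + snd (Z \<omega>, pm \<omega>) *\<^sub>R Dgap (fst (Z \<omega>, pm \<omega>)))) \<in> borel_measurable M"
    by (rule measurable_compose_rev)
  then show ?thesis unfolding stat_measure_eq by simp
qed

end

section \<open>The stochastic iteration\<close>

lemma batch_avg_measurable:
  fixes h :: "'p \<Rightarrow> 's \<Rightarrow> 'v::euclidean_space"
  assumes h: "(\<lambda>(p, s). h p s) \<in> borel_measurable (N \<Otimes>\<^sub>M D)" and p: "p \<in> G \<rightarrow>\<^sub>M N"
    and b: "b \<in> G \<rightarrow>\<^sub>M (\<Pi>\<^sub>M k\<in>{..<n}. D)"
  shows "(\<lambda>\<omega>. batch_avg n (h (p \<omega>)) (b \<omega>)) \<in> borel_measurable G"
proof -
  have "(\<lambda>\<omega>. h (p \<omega>) (b \<omega> k)) \<in> borel_measurable G" if "k < n" for k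
  proof -
    have "(\<lambda>\<omega>. b \<omega> k) \<in> G \<rightarrow>\<^sub>M D"
      using measurable_compose[OF b measurable_component_singleton[of k]] that by simp
    from measurable_compose[OF measurable_Pair[OF p this] h] show ?thesis by simp
  qed
  then show ?thesis unfolding batch_avg_def
    by (intro borel_measurable_scaleR borel_measurable_const borel_measurable_sum) auto
qed

text \<open>One locale serves both schedules: of the penalty only a positive lower bound and
  monotonicity are kept, and \<open>r\<close> bounds both upper step sizes.\<close>

locale momeha_run = bilevel P Flow Lf Lg LF \<rho>x \<rho>y + prob_space M
  for P :: "('s, 'r, 'm::finite, 'dx::finite, 'dy::finite) problem"
    and Flow Lf Lg LF \<rho>x \<rho>y and M :: "'w measure" +
  fixes S :: schedule and x0 :: "real^'dx" and y0 :: "real^'dy"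
    and B :: "('w, 's, 'r, 'm) batches" and R :: "('w, 'dx, 'dy) iterates"
    and \<sigma> c0 Kb :: real and bx :: "nat \<Rightarrow> 'w \<Rightarrow> real^'dx" and by' :: "nat \<Rightarrow> 'w \<Rightarrow> real^'dy"
    and r :: "nat \<Rightarrow> real"
  assumes batches: "independent_minibatches P M B"
    and run: "momeha P S x0 y0 M B R"
    and mv_theta: "\<And>t. mean_variance M (filt_theta P M B t) \<sigma>
            (\<lambda>\<omega>. grad_ghat P (bsize B (GTheta t)) (it_x R t \<omega>, it_theta R t \<omega>) (rho_theta B t \<omega>))
            (\<lambda>\<omega>. nabla (objg P) (it_x R t \<omega>, it_theta R t \<omega>))"
    and bias_measurable: "\<And>t. bx t \<in> borel_measurable (filt_x P M B t)"
      "\<And>t. by' t \<in> borel_measurable (filt_y P M B t)"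
    and mv_x: "\<And>t. mean_variance M (filt_x P M B t) \<sigma> (dhat_x P S B R t) (\<lambda>\<omega>. d_x P S R t \<omega> + bx t \<omega>)"
    and mv_y: "\<And>t. mean_variance M (filt_y P M B t) \<sigma> (dhat_y P S B R t) (\<lambda>\<omega>. d_y P S R t \<omega> + by' t \<omega>)"
    and bias: "\<And>t. AE \<omega> in M. norm (bx t \<omega>) \<le> Kb * step_theta S t powr (2/3)"
      "\<And>t. AE \<omega> in M. norm (by' t \<omega>) \<le> Kb * step_theta S t powr (2/3)"
    and momentum: "\<And>t. 0 \<le> momentum S t" "\<And>t. momentum S t < 1"
    and steps: "\<And>t. 0 < step_theta S t" "\<And>t. 0 < step_x S t" "\<And>t. 0 < step_y S t"
      "\<And>t. step_x S t \<le> r t" "\<And>t. step_y S t \<le> r t"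
    and penalty: "0 < c0" "\<And>t. c0 \<le> penalty S t" "incseq (penalty S)"
begin

abbreviation "xx \<equiv> it_x R"
abbreviation "yy \<equiv> it_y R"
abbreviation "th \<equiv> it_theta R"
abbreviation "mx \<equiv> mom_x R"
abbreviation "my \<equiv> mom_y R"
abbreviation "mt \<equiv> mom_theta R"

definition z :: "nat \<Rightarrow> 'w \<Rightarrow> ('dx, 'dy) pt" where "z t \<omega> = (xx t \<omega>, yy t \<omega>)"
definition \<eta> :: "nat \<Rightarrow> real" where "\<eta> t = 1 - momentum S t"

lemma \<eta>: "0 < \<eta> t" "\<eta> t \<le> 1"
  using momentum[of t] by (auto simp: \<eta>_def)

lemma start:
  assumes "\<omega> \<in> space M"
  shows "xx 0 \<omega> = x0" "yy 0 \<omega> = y0" "th 0 \<omega> = y0" "mt 0 \<omega> = 0" "mx 0 \<omega> = 0" "my 0 \<omega> = 0"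
  using run assms by (auto simp: momeha_def)

lemma iteration:
  assumes "\<omega> \<in> space M"
  shows "mt (Suc t) \<omega> = (1 - \<eta> t) *\<^sub>R mt t \<omega> + \<eta> t *\<^sub>R dhat_theta P B R t \<omega>"
    "th (Suc t) \<omega> = th t \<omega> - step_theta S t *\<^sub>R mt (Suc t) \<omega>"
    "mx (Suc t) \<omega> = (1 - \<eta> t) *\<^sub>R mx t \<omega> + \<eta> t *\<^sub>R dhat_x P S B R t \<omega>"
    "xx (Suc t) \<omega> = xx t \<omega> - step_x S t *\<^sub>R mx (Suc t) \<omega>"
    "my (Suc t) \<omega> = (1 - \<eta> t) *\<^sub>R my t \<omega> + \<eta> t *\<^sub>R dhat_y P S B R t \<omega>"
    "yy (Suc t) \<omega> = yy t \<omega> - step_y S t *\<^sub>R my (Suc t) \<omega>"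
  using run assms unfolding momeha_def \<eta>_def Suc_eq_plus1 by auto

section \<open>Sigma-algebras generated by the mini-batches\<close>

lemma batch_measurable:
  "rho_theta B t \<in> M \<rightarrow>\<^sub>M (\<Pi>\<^sub>M k\<in>{..<bsize B (GTheta t)}. Dg P)"
  "rho_x B t \<in> M \<rightarrow>\<^sub>M (\<Pi>\<^sub>M k\<in>{..<bsize B (GX t)}. Dg P)"
  "rho_y B t \<in> M \<rightarrow>\<^sub>M (\<Pi>\<^sub>M k\<in>{..<bsize B (GY t)}. Dg P)"
  "xi_x B t i \<in> M \<rightarrow>\<^sub>M (\<Pi>\<^sub>M k\<in>{..<bsize B (FX t i)}. Df P i)"
  "xi_y B t i \<in> M \<rightarrow>\<^sub>M (\<Pi>\<^sub>M k\<in>{..<bsize B (FY t i)}. Df P i)"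
  using batches by (auto simp: independent_minibatches_def minibatch_def)

lemma batch_algebra_subalgebra:
  assumes "X \<in> M \<rightarrow>\<^sub>M (\<Pi>\<^sub>M k\<in>{..<n}. D)"
  shows "subalgebra M (batch_algebra M D n X)"
  unfolding subalgebra_def batch_algebra_def
proof
  have X: "X \<in> space M \<rightarrow> space (\<Pi>\<^sub>M k\<in>{..<n}. D)" using assms by (auto dest: measurable_space)
  show "sets (vimage_algebra (space M) X (\<Pi>\<^sub>M k\<in>{..<n}. D)) \<subseteq> sets M"
    using assms by (auto simp: sets_vimage_algebra2[OF X] intro: measurable_sets)
qed simp

lemma draw_algebra_subalgebra: "subalgebra M (draw_algebra P M B l)"
  by (cases l) (auto intro: batch_algebra_subalgebra batch_measurable)

lemma draw_sets_Pow: "(\<Union>l\<in>J. sets (draw_algebra P M B l)) \<subseteq> Pow (space M)"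
  using draw_algebra_subalgebra sets.sets_into_space[of _ M] by (fastforce simp: subalgebra_def)

lemma sets_generated: "sets (generated P M B J) = sigma_sets (space M) (\<Union>l\<in>J. sets (draw_algebra P M B l))"
  and space_generated [simp]: "space (generated P M B J) = space M"
  unfolding generated_def using draw_sets_Pow by (simp_all add: sets_measure_of space_measure_of)

lemma generated_subalgebra: "subalgebra M (generated P M B J)"
  using draw_algebra_subalgebra
  by (auto simp: subalgebra_def sets_generated intro!: sets.sigma_sets_subset)

lemma generated_mono: "J \<subseteq> J' \<Longrightarrow> subalgebra (generated P M B J') (generated P M B J)"
  by (auto simp: subalgebra_def sets_generated intro!: sigma_sets_mono')

lemma batch_generated:
  assumes X: "X \<in> M \<rightarrow>\<^sub>M (\<Pi>\<^sub>M k\<in>{..<n}. D)" and "l \<in> J" "draw_algebra P M B l = batch_algebra M D n X"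
  shows "X \<in> generated P M B J \<rightarrow>\<^sub>M (\<Pi>\<^sub>M k\<in>{..<n}. D)"
proof (rule measurable_from_subalg)
  show "subalgebra (generated P M B J) (batch_algebra M D n X)"
    unfolding subalgebra_def
  proof
    show "sets (batch_algebra M D n X) \<subseteq> sets (generated P M B J)"
      using assms(2,3) unfolding sets_generated by (auto intro!: sigma_sets.Basic)
  qed (simp add: batch_algebra_def)
  show "X \<in> batch_algebra M D n X \<rightarrow>\<^sub>M (\<Pi>\<^sub>M k\<in>{..<n}. D)"
    unfolding batch_algebra_def using X by (intro measurable_vimage_algebra1) (auto dest: measurable_space)
qed

text \<open>The labels of the draws known at the three stages of iteration \<open>t\<close>. With
  label sets, inclusions of sigma-algebras reduce to inclusions of sets.\<close>

definition Jt :: "nat \<Rightarrow> 'm draw set" where "Jt t = {l. draw_time l < t}"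
definition Jx :: "nat \<Rightarrow> 'm draw set" where "Jx t = Jt t \<union> {GTheta t}"
definition Jy :: "nat \<Rightarrow> 'm draw set" where "Jy t = Jt t \<union> {GTheta t, GX t} \<union> range (FX t)"

lemma J_mono: "Jt t \<subseteq> Jx t" "Jx t \<subseteq> Jy t" "Jt t \<subseteq> Jy t" "Jt t \<subseteq> Jt (Suc t)" "Jx t \<subseteq> Jt (Suc t)" "Jy t \<subseteq> Jt (Suc t)"
  by (auto simp: Jt_def Jx_def Jy_def)

lemma J_mem: "GTheta t \<in> Jx t" "GX t \<in> Jy t" "FX t i \<in> Jy t" "GY t \<in> Jt (Suc t)" "FY t i \<in> Jt (Suc t)"
  by (auto simp: Jt_def Jx_def Jy_def)

abbreviation "adapted J X \<equiv> X \<in> borel_measurable (generated P M B J)"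

lemma adapted_mono: "adapted J X \<Longrightarrow> J \<subseteq> J' \<Longrightarrow> adapted J' X"
  using measurable_from_subalg generated_mono by blast

lemma adapted_M: "adapted J X \<Longrightarrow> X \<in> borel_measurable M"
  using measurable_from_subalg generated_subalgebra by blast

lemma adapted_cong: "(\<And>\<omega>. \<omega> \<in> space M \<Longrightarrow> X \<omega> = Y \<omega>) \<Longrightarrow> adapted J X \<longleftrightarrow> adapted J Y"
  by (rule measurable_cong) simp

text \<open>The recursions hold only on \<open>space M\<close>, so the iterates cannot be rewritten
  as functions; measurability is transferred by congruence instead.\<close>

lemma iteration_adapted:
  "adapted J (mt (Suc t)) \<longleftrightarrow> adapted J (\<lambda>\<omega>. (1 - \<eta> t) *\<^sub>R mt t \<omega> + \<eta> t *\<^sub>R dhat_theta P B R t \<omega>)"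
  "adapted J (th (Suc t)) \<longleftrightarrow> adapted J (\<lambda>\<omega>. th t \<omega> - step_theta S t *\<^sub>R mt (Suc t) \<omega>)"
  "adapted J (mx (Suc t)) \<longleftrightarrow> adapted J (\<lambda>\<omega>. (1 - \<eta> t) *\<^sub>R mx t \<omega> + \<eta> t *\<^sub>R dhat_x P S B R t \<omega>)"
  "adapted J (xx (Suc t)) \<longleftrightarrow> adapted J (\<lambda>\<omega>. xx t \<omega> - step_x S t *\<^sub>R mx (Suc t) \<omega>)"
  "adapted J (my (Suc t)) \<longleftrightarrow> adapted J (\<lambda>\<omega>. (1 - \<eta> t) *\<^sub>R my t \<omega> + \<eta> t *\<^sub>R dhat_y P S B R t \<omega>)"
  "adapted J (yy (Suc t)) \<longleftrightarrow> adapted J (\<lambda>\<omega>. yy t \<omega> - step_y S t *\<^sub>R my (Suc t) \<omega>)"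
  by (rule adapted_cong, simp only: iteration)+

lemma grad_ghat_adapted:
  assumes p: "adapted J p" and b: "b \<in> generated P M B J \<rightarrow>\<^sub>M (\<Pi>\<^sub>M k\<in>{..<n}. Dg P)"
  shows "adapted J (\<lambda>\<omega>. grad_ghat P n (p \<omega>) (b \<omega>))"
  unfolding grad_ghat_def
  using data by (intro batch_avg_measurable[OF _ p b]) (simp add: stochastic_data_def)

lemma stch_dir_adapted:
  assumes p: "adapted J p" and b: "\<And>i. b i \<in> generated P M B J \<rightarrow>\<^sub>M (\<Pi>\<^sub>M k\<in>{..<n i}. Df P i)"
  shows "adapted J (\<lambda>\<omega>. stch_dir P c n (p \<omega>) (\<lambda>i. b i \<omega>))"
proof -
  have "adapted J (\<lambda>\<omega>. fhat P i (n i) (p \<omega>) (b i \<omega>))" for i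
    unfolding fhat_def
    using data by (intro batch_avg_measurable[OF _ p b]) (simp add: stochastic_data_def)
  moreover have "adapted J (\<lambda>\<omega>. grad_fhat P i (n i) (p \<omega>) (b i \<omega>))" for i
    unfolding grad_fhat_def
    using data by (intro batch_avg_measurable[OF _ p b]) (simp add: stochastic_data_def)
  ultimately show ?thesis
    unfolding stch_dir_def Let_def
    by (intro borel_measurable_sum borel_measurable_scaleR borel_measurable_divide borel_measurable_times
        borel_measurable_exp[THEN measurable_compose[rotated]] borel_measurable_diff borel_measurable_const) auto
qed

lemma fst_adapted: "adapted J p \<Longrightarrow> adapted J (\<lambda>\<omega>. fst (p \<omega> :: 'u::euclidean_space \<times> 'v::euclidean_space))"
  by (rule measurable_compose[OF _ borel_measurable_continuous_onI]) (auto intro: continuous_on_fst continuous_on_id)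

lemma snd_adapted: "adapted J p \<Longrightarrow> adapted J (\<lambda>\<omega>. snd (p \<omega> :: 'u::euclidean_space \<times> 'v::euclidean_space))"
  by (rule measurable_compose[OF _ borel_measurable_continuous_onI]) (auto intro: continuous_on_snd continuous_on_id)

lemma lipschitz_adapted:
  fixes f :: "'u::euclidean_space \<Rightarrow> 'v::euclidean_space"
  shows "k-lipschitz_on UNIV f \<Longrightarrow> adapted J p \<Longrightarrow> adapted J (\<lambda>\<omega>. f (p \<omega>))"
  by (rule measurable_compose[OF _ borel_measurable_continuous_onI[OF lipschitz_on_continuous_on]])

lemmas adapted_intros = borel_measurable_add borel_measurable_diff borel_measurable_scaleR
  borel_measurable_const borel_measurable_Pair fst_adapted snd_adapted
  lipschitz_adapted[OF lower.lip] lipschitz_adapted[OF DF_lip]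

section \<open>Adaptedness of the iterates\<close>

definition state_adapted :: "nat \<Rightarrow> bool" where
  "state_adapted t \<longleftrightarrow> adapted (Jt t) (xx t) \<and> adapted (Jt t) (yy t) \<and> adapted (Jt t) (th t) \<and>
     adapted (Jt t) (mx t) \<and> adapted (Jt t) (my t) \<and> adapted (Jt t) (mt t)"

text \<open>The order of the updates matters: \<open>th (Suc t)\<close> is known before the upper
  draws and \<open>xx (Suc t)\<close> before those for \<open>y\<close>, so \<open>d_x\<close> and
  \<open>d_y\<close> are measurable at their own stages.\<close>

lemma theta_adapted:
  assumes "state_adapted t"
  shows "adapted (Jx t) (\<lambda>\<omega>. grad_ghat P (bsize B (GTheta t)) (xx t \<omega>, th t \<omega>) (rho_theta B t \<omega>))"
    "adapted (Jx t) (mt (Suc t))" "adapted (Jx t) (th (Suc t))"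
proof -
  have [intro]: "adapted (Jx t) (xx t)" "adapted (Jx t) (yy t)" "adapted (Jx t) (th t)" "adapted (Jx t) (mt t)"
    using assms adapted_mono[OF _ J_mono(1)] by (auto simp: state_adapted_def)
  show g: "adapted (Jx t) (\<lambda>\<omega>. grad_ghat P (bsize B (GTheta t)) (xx t \<omega>, th t \<omega>) (rho_theta B t \<omega>))"
    by (intro grad_ghat_adapted batch_generated[OF batch_measurable(1) J_mem(1)] adapted_intros) auto
  have "adapted (Jx t) (dhat_theta P B R t)"
    unfolding dhat_theta_def[abs_def] by (intro adapted_intros g) auto
  then show m: "adapted (Jx t) (mt (Suc t))"
    unfolding iteration_adapted(1) by (intro adapted_intros) auto
  show "adapted (Jx t) (th (Suc t))"
    unfolding iteration_adapted(2) by (intro adapted_intros m) auto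
qed

lemma x_adapted:
  assumes "state_adapted t"
  shows "adapted (Jy t) (dhat_x P S B R t)" "adapted (Jy t) (mx (Suc t))" "adapted (Jy t) (xx (Suc t))"
proof -
  have [intro]: "adapted (Jy t) (xx t)" "adapted (Jy t) (yy t)" "adapted (Jy t) (mx t)"
    using assms adapted_mono[OF _ J_mono(3)] by (auto simp: state_adapted_def)
  have [intro]: "adapted (Jy t) (th (Suc t))"
    using theta_adapted(3)[OF assms] adapted_mono[OF _ J_mono(2)] by blast
  show d: "adapted (Jy t) (dhat_x P S B R t)"
    unfolding dhat_x_def[abs_def] Suc_eq_plus1[symmetric]
    by (intro adapted_intros stch_dir_adapted grad_ghat_adapted
        batch_generated[OF batch_measurable(2) J_mem(2)] batch_generated[OF batch_measurable(4) J_mem(3)]) auto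
  then show m: "adapted (Jy t) (mx (Suc t))"
    unfolding iteration_adapted(3) by (intro adapted_intros) auto
  show "adapted (Jy t) (xx (Suc t))"
    unfolding iteration_adapted(4) by (intro adapted_intros m) auto
qed

lemma y_adapted:
  assumes "state_adapted t"
  shows "adapted (Jt (Suc t)) (dhat_y P S B R t)" "adapted (Jt (Suc t)) (my (Suc t))"
    "adapted (Jt (Suc t)) (yy (Suc t))"
proof -
  have [intro]: "adapted (Jt (Suc t)) (yy t)" "adapted (Jt (Suc t)) (my t)"
    using assms adapted_mono[OF _ J_mono(4)] by (auto simp: state_adapted_def)
  have [intro]: "adapted (Jt (Suc t)) (th (Suc t))"
    using theta_adapted(3)[OF assms] adapted_mono[OF _ J_mono(5)] by blast
  have [intro]: "adapted (Jt (Suc t)) (xx (Suc t))"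
    using x_adapted(3)[OF assms] adapted_mono[OF _ J_mono(6)] by blast
  show d: "adapted (Jt (Suc t)) (dhat_y P S B R t)"
    unfolding dhat_y_def[abs_def] Suc_eq_plus1[symmetric]
    by (intro adapted_intros stch_dir_adapted grad_ghat_adapted
        batch_generated[OF batch_measurable(3) J_mem(4)] batch_generated[OF batch_measurable(5) J_mem(5)]) auto
  then show m: "adapted (Jt (Suc t)) (my (Suc t))"
    unfolding iteration_adapted(5) by (intro adapted_intros) auto
  show "adapted (Jt (Suc t)) (yy (Suc t))"
    unfolding iteration_adapted(6) by (intro adapted_intros m) auto
qed

lemma state_adapted: "state_adapted t"
proof (induction t)
  case 0
  show ?case unfolding state_adapted_def
    by (simp add: adapted_cong[OF start(1)] adapted_cong[OF start(2)] adapted_cong[OF start(3)]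
        adapted_cong[OF start(4)] adapted_cong[OF start(5)] adapted_cong[OF start(6)])
next
  case (Suc t)
  show ?case unfolding state_adapted_def
    using theta_adapted(2,3)[OF Suc] x_adapted(2,3)[OF Suc] y_adapted(2,3)[OF Suc] J_mono(5,6)[of t]
    by (blast intro: adapted_mono)
qed

lemma adapted_t:
  "adapted (Jt t) (xx t)" "adapted (Jt t) (yy t)" "adapted (Jt t) (th t)"
  "adapted (Jt t) (mx t)" "adapted (Jt t) (my t)" "adapted (Jt t) (mt t)" "adapted (Jt t) (z t)"
  using state_adapted[of t] by (auto simp: state_adapted_def z_def[abs_def] intro: borel_measurable_Pair)

lemma d_adapted: "adapted (Jx t) (d_x P S R t)" "adapted (Jy t) (d_y P S R t)"
proof -
  have "adapted (Jx t) (xx t)" "adapted (Jx t) (yy t)" "adapted (Jx t) (th (Suc t))"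
    using adapted_t[of t] J_mono(1)[of t] theta_adapted(3)[OF state_adapted, of t] by (blast intro: adapted_mono)+
  then show "adapted (Jx t) (d_x P S R t)"
    unfolding d_x_def[abs_def] Suc_eq_plus1[symmetric] by (intro adapted_intros)
  have "adapted (Jy t) (xx (Suc t))" "adapted (Jy t) (yy t)" "adapted (Jy t) (th (Suc t))"
    using adapted_t[of t] J_mono(2,3)[of t] theta_adapted(3)[OF state_adapted, of t] x_adapted(3)[OF state_adapted, of t]
    by (blast intro: adapted_mono)+
  then show "adapted (Jy t) (d_y P S R t)"
    unfolding d_y_def[abs_def] Suc_eq_plus1[symmetric] by (intro adapted_intros)
qed

section \<open>Square integrability of the iterates\<close>

lemma iteration_sqint:
  "sqint M (mt (Suc t)) \<longleftrightarrow> sqint M (\<lambda>\<omega>. (1 - \<eta> t) *\<^sub>R mt t \<omega> + \<eta> t *\<^sub>R dhat_theta P B R t \<omega>)"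
  "sqint M (th (Suc t)) \<longleftrightarrow> sqint M (\<lambda>\<omega>. th t \<omega> - step_theta S t *\<^sub>R mt (Suc t) \<omega>)"
  "sqint M (mx (Suc t)) \<longleftrightarrow> sqint M (\<lambda>\<omega>. (1 - \<eta> t) *\<^sub>R mx t \<omega> + \<eta> t *\<^sub>R dhat_x P S B R t \<omega>)"
  "sqint M (xx (Suc t)) \<longleftrightarrow> sqint M (\<lambda>\<omega>. xx t \<omega> - step_x S t *\<^sub>R mx (Suc t) \<omega>)"
  "sqint M (my (Suc t)) \<longleftrightarrow> sqint M (\<lambda>\<omega>. (1 - \<eta> t) *\<^sub>R my t \<omega> + \<eta> t *\<^sub>R dhat_y P S B R t \<omega>)"
  "sqint M (yy (Suc t)) \<longleftrightarrow> sqint M (\<lambda>\<omega>. yy t \<omega> - step_y S t *\<^sub>R my (Suc t) \<omega>)"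
  by (rule sqint_cong, simp only: iteration)+

definition state_sqint :: "nat \<Rightarrow> bool" where
  "state_sqint t \<longleftrightarrow> sqint M (xx t) \<and> sqint M (yy t) \<and> sqint M (th t) \<and>
     sqint M (mx t) \<and> sqint M (my t) \<and> sqint M (mt t)"

lemmas sqint_intros = sqint_add sqint_diff sqint_scaleR sqint_Pair sqint_fst sqint_snd sqint_const
  sqint_lipschitz[OF _ lower.lip] sqint_lipschitz[OF _ DF_lip]

lemma filt_eq: "filt_theta P M B t = generated P M B (Jt t)" "filt_x P M B t = generated P M B (Jx t)"
  "filt_y P M B t = generated P M B (Jy t)"
  by (simp_all add: filt_theta_def filt_x_def filt_y_def Jt_def Jx_def Jy_def)

definition e_theta :: "nat \<Rightarrow> 'w \<Rightarrow> real^'dy" where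
  "e_theta t \<omega> = dhat_theta P B R t \<omega> - lower.S (z t \<omega>) (th t \<omega>)"

text \<open>Noise and square integrability share one induction: the noise property needs a
  square-integrable conditional mean, which the current state provides, and in turn makes the next
  state square integrable.\<close>

lemma theta_sqint:
  assumes "state_sqint t"
  shows "noise M (generated P M B (Jt t)) \<sigma> (e_theta t)" "sqint M (mt (Suc t))" "sqint M (th (Suc t))"
proof -
  have [intro]: "sqint M (xx t)" "sqint M (yy t)" "sqint M (th t)" "sqint M (mt t)"
    using assms by (auto simp: state_sqint_def)
  let ?g = "\<lambda>\<omega>. grad_ghat P (bsize B (GTheta t)) (xx t \<omega>, th t \<omega>) (rho_theta B t \<omega>)"
  have c: "sqint M (\<lambda>\<omega>. nabla (objg P) (xx t \<omega>, th t \<omega>))" by (intro sqint_intros) auto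
  note mv = mean_variance_noise[OF generated_subalgebra mv_theta[unfolded filt_eq]
      adapted_M[OF theta_adapted(1)[OF state_adapted]] c]
  have "e_theta t = (\<lambda>\<omega>. snd (?g \<omega> - nabla (objg P) (xx t \<omega>, th t \<omega>)))"
    by (simp add: fun_eq_iff e_theta_def dhat_theta_def lower.S_def z_def)
  then show "noise M (generated P M B (Jt t)) \<sigma> (e_theta t)" using noise_snd[OF mv(2)] by simp
  have "sqint M (dhat_theta P B R t)"
    unfolding dhat_theta_def[abs_def] by (intro sqint_intros mv(1)) auto
  then show m: "sqint M (mt (Suc t))" unfolding iteration_sqint(1) by (intro sqint_intros) auto
  show "sqint M (th (Suc t))" unfolding iteration_sqint(2) by (intro sqint_intros m) auto
qed

lemma bias_sqint: "sqint M (bx t)" "sqint M (by' t)"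
  using bias[of t] bias_measurable[of t, unfolded filt_eq, THEN adapted_M]
  by (auto intro!: sqint_bound[OF sqint_const[of "0::real"], of _ 0])

lemma x_sqint:
  assumes "state_sqint t"
  shows "sqint M (d_x P S R t)" "noise M (generated P M B (Jx t)) \<sigma> (\<lambda>\<omega>. dhat_x P S B R t \<omega> - (d_x P S R t \<omega> + bx t \<omega>))"
    "sqint M (mx (Suc t))" "sqint M (xx (Suc t))"
proof -
  have [intro]: "sqint M (xx t)" "sqint M (yy t)" "sqint M (mx t)" "sqint M (th (Suc t))"
    using assms theta_sqint(3)[OF assms] by (auto simp: state_sqint_def)
  show d: "sqint M (d_x P S R t)"
    unfolding d_x_def[abs_def] Suc_eq_plus1[symmetric] by (intro sqint_intros) auto
  note mv = mean_variance_noise[OF generated_subalgebra mv_x[unfolded filt_eq]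
      adapted_M[OF x_adapted(1)[OF state_adapted]] sqint_add[OF d bias_sqint(1)]]
  show "noise M (generated P M B (Jx t)) \<sigma> (\<lambda>\<omega>. dhat_x P S B R t \<omega> - (d_x P S R t \<omega> + bx t \<omega>))"
    by (rule mv(2))
  show m: "sqint M (mx (Suc t))" unfolding iteration_sqint(3) by (intro sqint_intros mv(1)) auto
  show "sqint M (xx (Suc t))" unfolding iteration_sqint(4) by (intro sqint_intros m) auto
qed

lemma y_sqint:
  assumes "state_sqint t"
  shows "sqint M (d_y P S R t)" "noise M (generated P M B (Jy t)) \<sigma> (\<lambda>\<omega>. dhat_y P S B R t \<omega> - (d_y P S R t \<omega> + by' t \<omega>))"
    "sqint M (my (Suc t))" "sqint M (yy (Suc t))"
proof -
  have [intro]: "sqint M (yy t)" "sqint M (my t)" "sqint M (th (Suc t))" "sqint M (xx (Suc t))"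
    using assms theta_sqint(3)[OF assms] x_sqint(4)[OF assms] by (auto simp: state_sqint_def)
  show d: "sqint M (d_y P S R t)"
    unfolding d_y_def[abs_def] Suc_eq_plus1[symmetric] by (intro sqint_intros) auto
  note mv = mean_variance_noise[OF generated_subalgebra mv_y[unfolded filt_eq]
      adapted_M[OF y_adapted(1)[OF state_adapted]] sqint_add[OF d bias_sqint(2)]]
  show "noise M (generated P M B (Jy t)) \<sigma> (\<lambda>\<omega>. dhat_y P S B R t \<omega> - (d_y P S R t \<omega> + by' t \<omega>))"
    by (rule mv(2))
  show m: "sqint M (my (Suc t))" unfolding iteration_sqint(5) by (intro sqint_intros mv(1)) auto
  show "sqint M (yy (Suc t))" unfolding iteration_sqint(6) by (intro sqint_intros m) auto
qed

lemma state_sqint: "state_sqint t"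
proof (induction t)
  case 0
  show ?case unfolding state_sqint_def
    by (simp add: sqint_cong[OF start(1)] sqint_cong[OF start(2)] sqint_cong[OF start(3)]
        sqint_cong[OF start(4)] sqint_cong[OF start(5)] sqint_cong[OF start(6)] sqint_const)
next
  case (Suc t)
  show ?case unfolding state_sqint_def
    using theta_sqint(2,3)[OF Suc] x_sqint(3,4)[OF Suc] y_sqint(3,4)[OF Suc] by blast
qed

lemma sqint_t:
  "sqint M (xx t)" "sqint M (yy t)" "sqint M (th t)" "sqint M (mx t)" "sqint M (my t)" "sqint M (mt t)"
  "sqint M (z t)" "sqint M (d_x P S R t)" "sqint M (d_y P S R t)"
  using state_sqint[of t] x_sqint(1)[OF state_sqint] y_sqint(1)[OF state_sqint]
  by (auto simp: state_sqint_def z_def[abs_def] intro: sqint_Pair)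

end

section \<open>Error recursions\<close>

text \<open>A Lipschitz gradient means at most quadratic growth, so finite second moments
  suffice.\<close>

lemma (in prob_space) integrable_smooth:
  fixes f :: "'v::euclidean_space \<Rightarrow> real"
  assumes G: "\<And>p. GDERIV f p :> G p" and lip: "L-lipschitz_on UNIV G" and X: "sqint M X"
  shows "integrable M (\<lambda>\<omega>. f (X \<omega>))"
proof (rule Bochner_Integration.integrable_bound)
  show "integrable M (\<lambda>\<omega>. \<bar>f 0\<bar> + \<bar>inner (X \<omega>) (G 0)\<bar> + L * (norm (X \<omega>))\<^sup>2)"
    using sqint_integrable[OF X] sqint_inner[OF X sqint_const] by simp
  have "continuous_on UNIV f"
    using G by (intro continuous_at_imp_continuous_on ballI has_derivative_continuous) (auto simp: gderiv_def)
  then show "(\<lambda>\<omega>. f (X \<omega>)) \<in> borel_measurable M"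
    by (rule measurable_compose[OF sqint_measurable[OF X] borel_measurable_continuous_onI])
  have "\<bar>f p\<bar> \<le> \<bar>f 0\<bar> + \<bar>inner p (G 0)\<bar> + L * (norm p)\<^sup>2" for p
    using gradient_quadratic_bound[OF G lip, of p 0] by simp
  moreover have "0 \<le> L" using lip lipschitz_on_nonneg by blast
  ultimately show "AE \<omega> in M. norm (f (X \<omega>)) \<le> norm (\<bar>f 0\<bar> + \<bar>inner (X \<omega>) (G 0)\<bar> + L * (norm (X \<omega>))\<^sup>2)"
    by (intro AE_I2) (simp add: add_nonneg_nonneg)
qed

text \<open>Polarization produces negative squares of both the gradient and the momentum, and half
  of the momentum term pays for the curvature. The two blocks have different step sizes, hence the
  common bounds \<open>k\<close> and \<open>r\<close>.\<close>

lemma component_descent: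
  fixes a m :: "'v::real_inner" and \<alpha> k r L :: real
  assumes "0 \<le> k" "k \<le> \<alpha>" "\<alpha> \<le> r" "L * \<alpha> \<le> 1 / 4"
  shows "- (\<alpha> * inner m a) + L * (\<alpha>\<^sup>2 * (norm m)\<^sup>2)
     \<le> - (k / 4 * (norm a)\<^sup>2) - k / 4 * (norm m)\<^sup>2 + r / 2 * (norm (m - a))\<^sup>2"
proof -
  have "2 * inner m a = (norm a)\<^sup>2 + (norm m)\<^sup>2 - (norm (m - a))\<^sup>2"
    unfolding power2_norm_eq_inner by (simp add: inner_diff_left inner_diff_right inner_commute)
  then have "\<alpha> * (2 * inner m a) = \<alpha> * ((norm a)\<^sup>2 + (norm m)\<^sup>2 - (norm (m - a))\<^sup>2)"
    by simp
  then have "- (\<alpha> * inner m a) = \<alpha> / 2 * (norm (m - a))\<^sup>2 - \<alpha> / 2 * (norm a)\<^sup>2 - \<alpha> / 2 * (norm m)\<^sup>2"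
    by (simp add: algebra_simps)
  moreover have "(L * \<alpha>) * (\<alpha> * (norm m)\<^sup>2) \<le> 1 / 4 * (\<alpha> * (norm m)\<^sup>2)"
    using assms by (intro mult_right_mono) auto
  moreover have "L * (\<alpha>\<^sup>2 * (norm m)\<^sup>2) = (L * \<alpha>) * (\<alpha> * (norm m)\<^sup>2)"
    by (simp add: power2_eq_square)
  moreover have "k * (norm a)\<^sup>2 \<le> \<alpha> * (norm a)\<^sup>2" "k * (norm m)\<^sup>2 \<le> \<alpha> * (norm m)\<^sup>2"
      "\<alpha> * (norm (m - a))\<^sup>2 \<le> r * (norm (m - a))\<^sup>2" "0 \<le> k * (norm a)\<^sup>2"
    using assms by (auto intro: mult_right_mono)
  ultimately show ?thesis by linarith
qed

lemma sum3_sq_le: "(x + y + w)\<^sup>2 \<le> 3 * x\<^sup>2 + 3 * y\<^sup>2 + 3 * (w::real)\<^sup>2"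
proof -
  have "0 \<le> (x - y)\<^sup>2 + (y - w)\<^sup>2 + (x - w)\<^sup>2" by simp
  then show ?thesis by (simp add: power2_eq_square algebra_simps)
qed

lemma msq_cong: "(\<And>\<omega>. \<omega> \<in> space M \<Longrightarrow> X \<omega> = Y \<omega>) \<Longrightarrow> msq M X = msq M Y"
  by (rule Bochner_Integration.integral_cong) auto

context momeha_run
begin

definition mm :: "nat \<Rightarrow> 'w \<Rightarrow> ('dx, 'dy) pt" where "mm t \<omega> = (mx t \<omega>, my t \<omega>)"
definition grad :: "nat \<Rightarrow> 'w \<Rightarrow> ('dx, 'dy) pt" where "grad t \<omega> = D\<Phi> (penalty S t) (z t \<omega>)"
definition St :: "nat \<Rightarrow> 'w \<Rightarrow> real^'dy" where "St t \<omega> = lower.S (z t \<omega>) (th t \<omega>)"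
definition pr :: "nat \<Rightarrow> 'w \<Rightarrow> real^'dy" where "pr t \<omega> = lower.prox (z t \<omega>)"

text \<open>Lower-case \<open>u\<close> and \<open>v\<close> compare the updated momentum with the
  target before the iterates move; \<open>U\<close> and \<open>V\<close> take both at the same time.
  For the tracking error the capital is the intermediate quantity: \<open>H\<close> has the new
  \<open>\<theta>\<close> and the old proximal point.\<close>

definition q :: "nat \<Rightarrow> real" where "q t = msq M (grad t)"
definition N :: "nat \<Rightarrow> real" where "N t = msq M (mm (Suc t))"
definition v :: "nat \<Rightarrow> real" where "v t = msq M (\<lambda>\<omega>. mm (Suc t) \<omega> - grad t \<omega>)"
definition V :: "nat \<Rightarrow> real" where "V t = msq M (\<lambda>\<omega>. mm t \<omega> - grad t \<omega>)"
definition u :: "nat \<Rightarrow> real" where "u t = msq M (\<lambda>\<omega>. mt (Suc t) \<omega> - St t \<omega>)"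
definition U :: "nat \<Rightarrow> real" where "U t = msq M (\<lambda>\<omega>. mt t \<omega> - St t \<omega>)"
definition h :: "nat \<Rightarrow> real" where "h t = msq M (\<lambda>\<omega>. th t \<omega> - pr t \<omega>)"
definition H :: "nat \<Rightarrow> real" where "H t = msq M (\<lambda>\<omega>. th (Suc t) \<omega> - pr t \<omega>)"
definition \<phi> :: "nat \<Rightarrow> real" where "\<phi> t = (\<integral>\<omega>. \<Phi> (penalty S t) (z t \<omega>) \<partial>M)"
definition L\<Phi> :: real where "L\<Phi> = LF / c0 + Lgap"

lemma penalty_pos: "0 < penalty S t"
  using penalty(1) penalty(2)[of t] by linarith

lemma grad_lip: "L\<Phi>-lipschitz_on UNIV (D\<Phi> (penalty S t))"
  unfolding L\<Phi>_def by (rule D\<Phi>_lip[OF penalty(1,2)])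

lemma L\<Phi>_nonneg: "0 \<le> L\<Phi>"
  using grad_lip lipschitz_on_nonneg by blast

lemma prox_lipschitz: "(lower.K / lower.\<mu>)-lipschitz_on UNIV lower.prox"
  using lower.prox_lip lower.K_pos lower.\<mu>_pos by (intro lipschitz_onI) (auto simp: dist_norm)

lemma r_pos: "0 < r t" using steps(2,4)[of t] by linarith

lemma sqint_v: "sqint M (mm t)" "sqint M (grad t)" "sqint M (St t)" "sqint M (pr t)"
proof -
  show "sqint M (mm t)" unfolding mm_def[abs_def] by (intro sqint_intros sqint_t)
  show "sqint M (grad t)" unfolding grad_def[abs_def] by (intro sqint_lipschitz[OF _ grad_lip] sqint_t)
  show "sqint M (St t)" unfolding St_def[abs_def] lower.S_def by (intro sqint_intros sqint_t)
  show "sqint M (pr t)" unfolding pr_def[abs_def] by (intro sqint_lipschitz[OF _ prox_lipschitz] sqint_t)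
qed

lemma adapted_v: "adapted (Jt t) (mm t)" "adapted (Jt t) (grad t)" "adapted (Jt t) (St t)"
proof -
  show "adapted (Jt t) (mm t)" unfolding mm_def[abs_def] by (intro adapted_intros adapted_t)
  show "adapted (Jt t) (grad t)" unfolding grad_def[abs_def] by (intro lipschitz_adapted[OF grad_lip] adapted_t)
  show "adapted (Jt t) (St t)" unfolding St_def[abs_def] lower.S_def by (intro adapted_intros adapted_t)
qed

lemmas int_v = sqint_v[THEN sqint_integrable] sqint_t[THEN sqint_integrable]

lemma integrable_\<Phi>: "integrable M (\<lambda>\<omega>. \<Phi> (penalty S t) (z t' \<omega>))"
  by (rule integrable_smooth[OF GDERIV_\<Phi> grad_lip sqint_t(7)])

lemma integrable_gap: "integrable M (\<lambda>\<omega>. gap P (z t \<omega>))"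
  by (rule integrable_smooth[OF GDERIV_gap Dgap_lip sqint_t(7)])

lemma integrable_F: "integrable M (\<lambda>\<omega>. stch P (z t \<omega>))"
  by (rule integrable_smooth[OF GDERIV_F DF_lip sqint_t(7)])

lemma z_move:
  assumes "\<omega> \<in> space M"
  shows "z (Suc t) \<omega> - z t \<omega> = (- step_x S t *\<^sub>R mx (Suc t) \<omega>, - step_y S t *\<^sub>R my (Suc t) \<omega>)"
    "norm (xx (Suc t) \<omega> - xx t \<omega>) \<le> r t * norm (mx (Suc t) \<omega>)"
    "(norm (z (Suc t) \<omega> - z t \<omega>))\<^sup>2 \<le> (r t)\<^sup>2 * (norm (mm (Suc t) \<omega>))\<^sup>2"
proof -
  show eq: "z (Suc t) \<omega> - z t \<omega> = (- step_x S t *\<^sub>R mx (Suc t) \<omega>, - step_y S t *\<^sub>R my (Suc t) \<omega>)"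
    using iteration(4,6)[OF assms, of t] by (simp add: z_def)
  show "norm (xx (Suc t) \<omega> - xx t \<omega>) \<le> r t * norm (mx (Suc t) \<omega>)"
    using iteration(4)[OF assms, of t] steps(2,4)[of t] by (simp add: mult_right_mono)
  have "(step_x S t)\<^sup>2 \<le> (r t)\<^sup>2" "(step_y S t)\<^sup>2 \<le> (r t)\<^sup>2"
    using steps(2-5)[of t] by (auto intro: power_mono)
  then show "(norm (z (Suc t) \<omega> - z t \<omega>))\<^sup>2 \<le> (r t)\<^sup>2 * (norm (mm (Suc t) \<omega>))\<^sup>2"
    unfolding eq by (simp add: norm_sq_prod mm_def power_mult_distrib distrib_left add_mono mult_right_mono)
qed

lemma msq_z_move: "msq M (\<lambda>\<omega>. z (Suc t) \<omega> - z t \<omega>) \<le> (r t)\<^sup>2 * N t"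
proof -
  have "msq M (\<lambda>\<omega>. z (Suc t) \<omega> - z t \<omega>) \<le> (\<integral>\<omega>. (r t)\<^sup>2 * (norm (mm (Suc t) \<omega>))\<^sup>2 \<partial>M)"
    by (intro integral_mono z_move(3) sqint_integrable[OF sqint_diff] sqint_t integrable_mult_right int_v)
  then show ?thesis by (simp add: N_def)
qed

lemma msq_lipschitz_le:
  assumes X: "sqint M X" "sqint M Y" and "0 \<le> k"
    and le: "\<And>\<omega>. \<omega> \<in> space M \<Longrightarrow> norm (X \<omega>) \<le> k * norm (Y \<omega>)"
  shows "msq M X \<le> k\<^sup>2 * msq M Y"
proof -
  have "msq M X \<le> (\<integral>\<omega>. k\<^sup>2 * (norm (Y \<omega>))\<^sup>2 \<partial>M)"
  proof (rule integral_mono)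
    show "(norm (X \<omega>))\<^sup>2 \<le> k\<^sup>2 * (norm (Y \<omega>))\<^sup>2" if "\<omega> \<in> space M" for \<omega>
      using power_mono[OF le[OF that] norm_ge_zero, of 2] by (simp add: power_mult_distrib)
  qed (use X sqint_integrable in auto)
  then show ?thesis by simp
qed

lemma descent:
  assumes k: "0 \<le> k" "k * r t \<le> step_x S t" "k * r t \<le> step_y S t" and small: "L\<Phi> * r t \<le> 1 / 4"
  shows "\<phi> (Suc t) \<le> \<phi> t - k / 4 * r t * q t - k / 4 * r t * N t + 1 / 2 * r t * v t"
proof -
  let ?c = "penalty S t"
  have path: "\<Phi> (penalty S (Suc t)) (z (Suc t) \<omega>) \<le> \<Phi> ?c (z t \<omega>) - k / 4 * r t * (norm (grad t \<omega>))\<^sup>2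
      - k / 4 * r t * (norm (mm (Suc t) \<omega>))\<^sup>2 + 1 / 2 * r t * (norm (mm (Suc t) \<omega> - grad t \<omega>))\<^sup>2"
    if \<omega>: "\<omega> \<in> space M" for \<omega>
  proof -
    let ?g = "grad t \<omega>" and ?m = "mm (Suc t) \<omega>" and ?d = "z (Suc t) \<omega> - z t \<omega>"
    \<comment> \<open>Returning to the old penalty only enlarges \<open>\<Phi>\<close>; the
      quadratic bound can then be used with the gradient \<open>grad t\<close>.\<close>
    have "\<Phi> (penalty S (Suc t)) (z (Suc t) \<omega>) \<le> \<Phi> ?c (z (Suc t) \<omega>)"
      using incseq_SucD[OF penalty(3)] penalty_pos by (intro \<Phi>_antimono) auto
    also have "\<dots> \<le> \<Phi> ?c (z t \<omega>) + inner ?d ?g + L\<Phi> * (norm ?d)\<^sup>2"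
      using gradient_quadratic_bound[OF GDERIV_\<Phi> grad_lip[of t], of "z (Suc t) \<omega>" "z t \<omega>"]
      by (simp add: grad_def)
    also have "inner ?d ?g = - (step_x S t * inner (fst ?m) (fst ?g)) - step_y S t * inner (snd ?m) (snd ?g)"
      unfolding z_move(1)[OF \<omega>] by (simp add: inner_prod_def mm_def)
    also have "(norm ?d)\<^sup>2 = (step_x S t)\<^sup>2 * (norm (fst ?m))\<^sup>2 + (step_y S t)\<^sup>2 * (norm (snd ?m))\<^sup>2"
      unfolding z_move(1)[OF \<omega>] by (simp add: norm_sq_prod mm_def power_mult_distrib)
    finally have 1: "\<Phi> (penalty S (Suc t)) (z (Suc t) \<omega>) \<le> \<Phi> ?c (z t \<omega>)
        + (- (step_x S t * inner (fst ?m) (fst ?g)) + L\<Phi> * ((step_x S t)\<^sup>2 * (norm (fst ?m))\<^sup>2))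
        + (- (step_y S t * inner (snd ?m) (snd ?g)) + L\<Phi> * ((step_y S t)\<^sup>2 * (norm (snd ?m))\<^sup>2))"
      by (simp add: algebra_simps)
    have L: "L\<Phi> * step_x S t \<le> 1 / 4" "L\<Phi> * step_y S t \<le> 1 / 4"
      using small mult_left_mono[OF steps(4) L\<Phi>_nonneg, of t] mult_left_mono[OF steps(5) L\<Phi>_nonneg, of t] by linarith+
    have k0: "0 \<le> k * r t" using k r_pos[of t] by simp
    have
      "- (step_x S t * inner (fst ?m) (fst ?g)) + L\<Phi> * ((step_x S t)\<^sup>2 * (norm (fst ?m))\<^sup>2)
       \<le> - (k * r t / 4 * (norm (fst ?g))\<^sup>2) - k * r t / 4 * (norm (fst ?m))\<^sup>2 + r t / 2 * (norm (fst ?m - fst ?g))\<^sup>2"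
      "- (step_y S t * inner (snd ?m) (snd ?g)) + L\<Phi> * ((step_y S t)\<^sup>2 * (norm (snd ?m))\<^sup>2)
       \<le> - (k * r t / 4 * (norm (snd ?g))\<^sup>2) - k * r t / 4 * (norm (snd ?m))\<^sup>2 + r t / 2 * (norm (snd ?m - snd ?g))\<^sup>2"
      using component_descent[OF k0 k(2) steps(4) L(1)] component_descent[OF k0 k(3) steps(5) L(2)] by blast+
    with 1 show ?thesis
      unfolding norm_sq_prod[of ?g] norm_sq_prod[of ?m] norm_sq_prod[of "?m - ?g"] fst_diff snd_diff
      by (simp add: algebra_simps)
  qed
  note int = integrable_\<Phi> int_v sqint_integrable[OF sqint_diff[OF sqint_v(1,2)]]
  have "\<phi> (Suc t) \<le> (\<integral>\<omega>. \<Phi> ?c (z t \<omega>) - k / 4 * r t * (norm (grad t \<omega>))\<^sup>2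
      - k / 4 * r t * (norm (mm (Suc t) \<omega>))\<^sup>2 + 1 / 2 * r t * (norm (mm (Suc t) \<omega> - grad t \<omega>))\<^sup>2 \<partial>M)"
    unfolding \<phi>_def
    by (intro integral_mono path Bochner_Integration.integrable_add Bochner_Integration.integrable_diff
        integrable_mult_right int)
  also have "\<dots> = \<phi> t - k / 4 * r t * q t - k / 4 * r t * N t + 1 / 2 * r t * v t"
    unfolding \<phi>_def q_def N_def v_def using int by simp
  finally show ?thesis .
qed

lemma theta_error: "u t \<le> (1 - \<eta> t) * U t + (\<eta> t)\<^sup>2 * \<sigma>\<^sup>2"
proof -
  \<comment> \<open>The stochastic lower gradient is unbiased, so the bias slot of
    \<open>momentum_step\<close> is \<open>0\<close>.\<close>
  have "u t = msq M (\<lambda>\<omega>. (1 - \<eta> t) *\<^sub>R (mt t \<omega> - St t \<omega>) + \<eta> t *\<^sub>R (0 + e_theta t \<omega>))"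
    unfolding u_def by (rule msq_cong) (simp add: iteration(1) e_theta_def St_def algebra_simps)
  also have "\<dots> \<le> (1 - \<eta> t) * U t + \<eta> t * msq M (\<lambda>\<omega>. 0 :: real^'dy) + (\<eta> t)\<^sup>2 * \<sigma>\<^sup>2"
    unfolding U_def
    by (rule momentum_step[OF theta_sqint(1)[OF state_sqint]])
       (use \<eta>[of t] in \<open>auto intro!: sqint_diff sqint_t sqint_v sqint_const borel_measurable_diff adapted_t adapted_v\<close>)
  finally show ?thesis by simp
qed

text \<open>This direction differs from the exact gradient only in using \<open>th (Suc t)\<close>
  for the proximal point; everything else cancels.\<close>

lemma dx_error:
  "norm (d_x P S R t \<omega> - fst (grad t \<omega>)) \<le> Lg * norm (th (Suc t) \<omega> - pr t \<omega>)"
proof -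
  have "d_x P S R t \<omega> - fst (grad t \<omega>)
      = fst (nabla (objg P) (xx t \<omega>, pr t \<omega>) - nabla (objg P) (xx t \<omega>, th (Suc t) \<omega>))"
    by (simp add: d_x_def grad_def D\<Phi>_def Dgap_def lower.Genv_def z_def pr_def)
  also have "norm \<dots> \<le> norm (nabla (objg P) (xx t \<omega>, pr t \<omega>) - nabla (objg P) (xx t \<omega>, th (Suc t) \<omega>))"
    by (rule fst_lipschitz)
  also have "\<dots> \<le> Lg * norm ((xx t \<omega>, pr t \<omega>) - (xx t \<omega>, th (Suc t) \<omega>))" by (rule lower.G_lip)
  finally show ?thesis by (simp add: norm_Pair norm_minus_commute)
qed

text \<open>Here the direction is evaluated at the already updated \<open>x\<close>, which adds the
  displacement of \<open>x\<close> to the tracking error.\<close>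

lemma dy_error:
  "norm (d_y P S R t \<omega> - snd (grad t \<omega>))
    \<le> (LF / c0 + Lg) * norm (xx (Suc t) \<omega> - xx t \<omega>) + 1 / gam P * norm (th (Suc t) \<omega> - pr t \<omega>)"
proof -
  let ?p = "(xx (Suc t) \<omega>, yy t \<omega>)" and ?c = "penalty S t"
  have "d_y P S R t \<omega> - snd (grad t \<omega>) = snd ((1 / ?c) *\<^sub>R (DF ?p - DF (z t \<omega>)) + (nabla (objg P) ?p - nabla (objg P) (z t \<omega>)))
      + (1 / gam P) *\<^sub>R (th (Suc t) \<omega> - pr t \<omega>)"
    by (simp add: d_y_def grad_def D\<Phi>_def Dgap_def lower.Genv_def z_def pr_def algebra_simps)
  also have "norm \<dots> \<le> norm (snd ((1 / ?c) *\<^sub>R (DF ?p - DF (z t \<omega>)) + (nabla (objg P) ?p - nabla (objg P) (z t \<omega>))))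
      + norm ((1 / gam P) *\<^sub>R (th (Suc t) \<omega> - pr t \<omega>))"
    by (rule norm_triangle_ineq)
  also have "norm ((1 / gam P) *\<^sub>R (th (Suc t) \<omega> - pr t \<omega>)) = 1 / gam P * norm (th (Suc t) \<omega> - pr t \<omega>)"
    using gam by simp
  also have "norm (snd ((1 / ?c) *\<^sub>R (DF ?p - DF (z t \<omega>)) + (nabla (objg P) ?p - nabla (objg P) (z t \<omega>))))
      \<le> norm ((1 / ?c) *\<^sub>R (DF ?p - DF (z t \<omega>))) + norm (nabla (objg P) ?p - nabla (objg P) (z t \<omega>))"
    by (rule order_trans[OF snd_lipschitz norm_triangle_ineq])
  also have "norm ((1 / ?c) *\<^sub>R (DF ?p - DF (z t \<omega>))) \<le> LF / c0 * norm (?p - z t \<omega>)"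
  proof -
    have "norm ((1 / ?c) *\<^sub>R (DF ?p - DF (z t \<omega>))) = 1 / ?c * norm (DF ?p - DF (z t \<omega>))"
      using penalty_pos[of t] by simp
    also have "\<dots> \<le> 1 / c0 * (LF * norm (?p - z t \<omega>))"
      using lipschitz_onD[OF DF_lip, of ?p "z t \<omega>"] penalty(1) penalty(2)[of t] LF_nonneg
      by (intro mult_mono frac_le) (auto simp: dist_norm)
    finally show ?thesis by simp
  qed
  also have "norm (nabla (objg P) ?p - nabla (objg P) (z t \<omega>)) \<le> Lg * norm (?p - z t \<omega>)" by (rule lower.G_lip)
  also have "norm (?p - z t \<omega>) = norm (xx (Suc t) \<omega> - xx t \<omega>)" by (simp add: z_def norm_Pair)
  finally show ?thesis by (simp add: distrib_right)
qed

definition s :: "nat \<Rightarrow> real" where "s t = step_theta S t powr (2/3)"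
text \<open>The first two summands come from the tracking error in the \<open>x\<close>- and the
  \<open>y\<close>-block, the third is the bias with factors \<open>2\<close> and \<open>3\<close>
  in these blocks, and the last comes from the updated \<open>x\<close> in the
  \<open>y\<close>-direction.\<close>

definition Cv :: real where "Cv = 2 * Lg\<^sup>2 + 3 / (gam P)\<^sup>2 + 5 * Kb\<^sup>2 + 3 * (LF / c0 + Lg)\<^sup>2"

lemma N_nonneg: "0 \<le> N t" and H_nonneg: "0 \<le> H t" and h_nonneg: "0 \<le> h t"
  and u_nonneg: "0 \<le> u t" and U_nonneg: "0 \<le> U t" and v_nonneg: "0 \<le> v t" and V_nonneg: "0 \<le> V t"
  by (simp_all add: N_def H_def h_def u_def U_def v_def V_def)

lemma int_H: "integrable M (\<lambda>\<omega>. (norm (th (Suc t) \<omega> - pr t \<omega>))\<^sup>2)"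
  by (intro sqint_integrable sqint_diff sqint_t sqint_v)

text \<open>The blocks are estimated separately because their noises are orthogonal to different
  sigma-algebras; the factor \<open>2\<close> is one variance per block. The deviations of the
  conditional means from \<open>grad t\<close> act as biases.\<close>

lemma upper_error: "v t \<le> (1 - \<eta> t) * V t + \<eta> t * (Cv * (H t + (s t)\<^sup>2 + (r t)\<^sup>2 * N t)) + 2 * (\<eta> t)\<^sup>2 * \<sigma>\<^sup>2"
proof -
  let ?bx = "\<lambda>\<omega>. d_x P S R t \<omega> + bx t \<omega> - fst (grad t \<omega>)"
  let ?by = "\<lambda>\<omega>. d_y P S R t \<omega> + by' t \<omega> - snd (grad t \<omega>)"
  have sq: "sqint M ?bx" "sqint M ?by"
    "sqint M (\<lambda>\<omega>. mx t \<omega> - fst (grad t \<omega>))" "sqint M (\<lambda>\<omega>. my t \<omega> - snd (grad t \<omega>))"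
    "sqint M (\<lambda>\<omega>. mx (Suc t) \<omega> - fst (grad t \<omega>))" "sqint M (\<lambda>\<omega>. my (Suc t) \<omega> - snd (grad t \<omega>))"
    by (intro sqint_diff sqint_add sqint_fst sqint_snd sqint_t sqint_v bias_sqint)+
  have ad: "adapted (Jx t) (\<lambda>\<omega>. mx t \<omega> - fst (grad t \<omega>))" "adapted (Jy t) (\<lambda>\<omega>. my t \<omega> - snd (grad t \<omega>))"
    "adapted (Jx t) ?bx" "adapted (Jy t) ?by"
  proof -
    have "adapted (Jx t) (mx t)" "adapted (Jy t) (my t)" "adapted (Jx t) (grad t)" "adapted (Jy t) (grad t)"
      using adapted_t(4,5)[of t] adapted_v(2)[of t] J_mono(1,3)[of t] by (blast intro: adapted_mono)+
    note ad = this d_adapted bias_measurable[of t, unfolded filt_eq]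
    show "adapted (Jx t) (\<lambda>\<omega>. mx t \<omega> - fst (grad t \<omega>))" "adapted (Jy t) (\<lambda>\<omega>. my t \<omega> - snd (grad t \<omega>))"
      "adapted (Jx t) ?bx" "adapted (Jy t) ?by"
      by (intro borel_measurable_diff borel_measurable_add fst_adapted snd_adapted ad)+
  qed
  have "msq M (\<lambda>\<omega>. mx (Suc t) \<omega> - fst (grad t \<omega>)) = msq M (\<lambda>\<omega>. (1 - \<eta> t) *\<^sub>R (mx t \<omega> - fst (grad t \<omega>))
      + \<eta> t *\<^sub>R (?bx \<omega> + (dhat_x P S B R t \<omega> - (d_x P S R t \<omega> + bx t \<omega>))))"
    by (rule msq_cong) (simp add: iteration(3) algebra_simps)
  also have "\<dots> \<le> (1 - \<eta> t) * msq M (\<lambda>\<omega>. mx t \<omega> - fst (grad t \<omega>)) + \<eta> t * msq M ?bx + (\<eta> t)\<^sup>2 * \<sigma>\<^sup>2"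
    by (rule momentum_step[OF x_sqint(2)[OF state_sqint]]) (use \<eta>[of t] sq ad in auto)
  finally have vx: "msq M (\<lambda>\<omega>. mx (Suc t) \<omega> - fst (grad t \<omega>))
      \<le> (1 - \<eta> t) * msq M (\<lambda>\<omega>. mx t \<omega> - fst (grad t \<omega>)) + \<eta> t * msq M ?bx + (\<eta> t)\<^sup>2 * \<sigma>\<^sup>2" .
  have "msq M (\<lambda>\<omega>. my (Suc t) \<omega> - snd (grad t \<omega>)) = msq M (\<lambda>\<omega>. (1 - \<eta> t) *\<^sub>R (my t \<omega> - snd (grad t \<omega>))
      + \<eta> t *\<^sub>R (?by \<omega> + (dhat_y P S B R t \<omega> - (d_y P S R t \<omega> + by' t \<omega>))))"
    by (rule msq_cong) (simp add: iteration(5) algebra_simps)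
  also have "\<dots> \<le> (1 - \<eta> t) * msq M (\<lambda>\<omega>. my t \<omega> - snd (grad t \<omega>)) + \<eta> t * msq M ?by + (\<eta> t)\<^sup>2 * \<sigma>\<^sup>2"
    by (rule momentum_step[OF y_sqint(2)[OF state_sqint]]) (use \<eta>[of t] sq ad in auto)
  finally have vy: "msq M (\<lambda>\<omega>. my (Suc t) \<omega> - snd (grad t \<omega>))
      \<le> (1 - \<eta> t) * msq M (\<lambda>\<omega>. my t \<omega> - snd (grad t \<omega>)) + \<eta> t * msq M ?by + (\<eta> t)\<^sup>2 * \<sigma>\<^sup>2" .
  have "msq M ?bx \<le> (\<integral>\<omega>. 2 * Lg\<^sup>2 * (norm (th (Suc t) \<omega> - pr t \<omega>))\<^sup>2 + 2 * (Kb\<^sup>2 * (s t)\<^sup>2) \<partial>M)"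
  proof (rule integral_mono_AE)
    show "AE \<omega> in M. (norm (?bx \<omega>))\<^sup>2 \<le> 2 * Lg\<^sup>2 * (norm (th (Suc t) \<omega> - pr t \<omega>))\<^sup>2 + 2 * (Kb\<^sup>2 * (s t)\<^sup>2)"
      using bias(1)[of t]
    proof eventually_elim
      case (elim \<omega>)
      have "(norm (d_x P S R t \<omega> - fst (grad t \<omega>)))\<^sup>2 \<le> (Lg * norm (th (Suc t) \<omega> - pr t \<omega>))\<^sup>2"
        "(norm (bx t \<omega>))\<^sup>2 \<le> (Kb * s t)\<^sup>2"
        using dx_error elim by (auto simp: s_def intro: power_mono)
      moreover have "?bx \<omega> = (d_x P S R t \<omega> - fst (grad t \<omega>)) + bx t \<omega>" by simp
      ultimately show ?case
        using norm_add_sq_le[of "d_x P S R t \<omega> - fst (grad t \<omega>)" "bx t \<omega>"]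
        by (simp only: power_mult_distrib)
    qed
  qed (use sq[THEN sqint_integrable] int_H in auto)
  also have "\<dots> = 2 * Lg\<^sup>2 * H t + 2 * (Kb\<^sup>2 * (s t)\<^sup>2)"
    using int_H by (simp add: H_def prob_space)
  finally have bx: "msq M ?bx \<le> 2 * Lg\<^sup>2 * H t + 2 * (Kb\<^sup>2 * (s t)\<^sup>2)" .
  have "msq M ?by \<le> (\<integral>\<omega>. 3 * (LF / c0 + Lg)\<^sup>2 * ((r t)\<^sup>2 * (norm (mm (Suc t) \<omega>))\<^sup>2)
      + 3 / (gam P)\<^sup>2 * (norm (th (Suc t) \<omega> - pr t \<omega>))\<^sup>2 + 3 * (Kb\<^sup>2 * (s t)\<^sup>2) \<partial>M)"
  proof (rule integral_mono_AE)
    show "AE \<omega> in M. (norm (?by \<omega>))\<^sup>2 \<le> 3 * (LF / c0 + Lg)\<^sup>2 * ((r t)\<^sup>2 * (norm (mm (Suc t) \<omega>))\<^sup>2)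
        + 3 / (gam P)\<^sup>2 * (norm (th (Suc t) \<omega> - pr t \<omega>))\<^sup>2 + 3 * (Kb\<^sup>2 * (s t)\<^sup>2)"
      using bias(2)[of t] AE_space
    proof eventually_elim
      case (elim \<omega>)
      let ?A = "(LF / c0 + Lg) * (r t * norm (mm (Suc t) \<omega>))"
      have "norm (xx (Suc t) \<omega> - xx t \<omega>) \<le> r t * norm (mm (Suc t) \<omega>)"
        using z_move(2)[OF elim(2), of t] fst_lipschitz[of "mm (Suc t) \<omega>"] r_pos[of t]
        by (smt (verit) mm_def fst_conv mult_left_mono)
      then have "(LF / c0 + Lg) * norm (xx (Suc t) \<omega> - xx t \<omega>) \<le> ?A"
        using LF_nonneg lower.L_nonneg penalty(1) by (intro mult_left_mono) auto
      moreover have "?by \<omega> = (d_y P S R t \<omega> - snd (grad t \<omega>)) + by' t \<omega>" by simp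
      then have "norm (?by \<omega>) \<le> norm (d_y P S R t \<omega> - snd (grad t \<omega>)) + norm (by' t \<omega>)"
        by (simp only: norm_triangle_ineq)
      ultimately have "norm (?by \<omega>) \<le> ?A + 1 / gam P * norm (th (Suc t) \<omega> - pr t \<omega>) + Kb * s t"
        using dy_error[of t \<omega>] elim(1) unfolding s_def by linarith
      then have "(norm (?by \<omega>))\<^sup>2 \<le> (?A + 1 / gam P * norm (th (Suc t) \<omega> - pr t \<omega>) + Kb * s t)\<^sup>2"
        by (intro power_mono) auto
      also have "\<dots> \<le> 3 * ?A\<^sup>2 + 3 * (1 / gam P * norm (th (Suc t) \<omega> - pr t \<omega>))\<^sup>2 + 3 * (Kb * s t)\<^sup>2"
        by (rule sum3_sq_le)
      finally show ?case by (simp add: power_mult_distrib power_divide)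
    qed
  qed (use sq[THEN sqint_integrable] int_H int_v in auto)
  also have "\<dots> = 3 * (LF / c0 + Lg)\<^sup>2 * ((r t)\<^sup>2 * N t) + 3 / (gam P)\<^sup>2 * H t + 3 * (Kb\<^sup>2 * (s t)\<^sup>2)"
    using int_H int_v by (simp add: H_def N_def prob_space)
  finally have "by": "msq M ?by \<le> 3 * (LF / c0 + Lg)\<^sup>2 * ((r t)\<^sup>2 * N t) + 3 / (gam P)\<^sup>2 * H t + 3 * (Kb\<^sup>2 * (s t)\<^sup>2)" .
  have "msq M ?bx + msq M ?by \<le> (2 * Lg\<^sup>2 + 3 / (gam P)\<^sup>2) * H t + 5 * Kb\<^sup>2 * (s t)\<^sup>2
      + 3 * (LF / c0 + Lg)\<^sup>2 * ((r t)\<^sup>2 * N t)"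
    using bx "by" by (simp add: algebra_simps)
  also have "\<dots> \<le> Cv * H t + Cv * (s t)\<^sup>2 + Cv * ((r t)\<^sup>2 * N t)"
  proof -
    have "2 * Lg\<^sup>2 + 3 / (gam P)\<^sup>2 \<le> Cv" "5 * Kb\<^sup>2 \<le> Cv" "3 * (LF / c0 + Lg)\<^sup>2 \<le> Cv"
      by (simp_all add: Cv_def)
    then show ?thesis using H_nonneg N_nonneg by (intro add_mono mult_right_mono) auto
  qed
  finally have "\<eta> t * (msq M ?bx + msq M ?by) \<le> \<eta> t * (Cv * (H t + (s t)\<^sup>2 + (r t)\<^sup>2 * N t))"
    using \<eta>(1)[of t] by (intro mult_left_mono) (auto simp: algebra_simps)
  moreover have "v t = msq M (\<lambda>\<omega>. mx (Suc t) \<omega> - fst (grad t \<omega>)) + msq M (\<lambda>\<omega>. my (Suc t) \<omega> - snd (grad t \<omega>))"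
    "V t = msq M (\<lambda>\<omega>. mx t \<omega> - fst (grad t \<omega>)) + msq M (\<lambda>\<omega>. my t \<omega> - snd (grad t \<omega>))"
    using sq[THEN sqint_integrable] unfolding v_def V_def norm_sq_prod mm_def by simp_all
  ultimately show ?thesis using vx vy by (simp add: algebra_simps)
qed

text \<open>The mean squared change of the target gradient caused by the penalty alone; it vanishes
  for a constant penalty.\<close>

definition \<Delta> :: "nat \<Rightarrow> real" where
  "\<Delta> t = (1 / penalty S t - 1 / penalty S (Suc t))\<^sup>2 * msq M (\<lambda>\<omega>. DF (z (Suc t) \<omega>))"

lemma young_weight: "0 < e \<Longrightarrow> e \<le> 1 \<Longrightarrow> 1 + 1 / (e / 2) \<le> 3 / (e::real)"
  by (simp add: field_simps)

lemma upper_drift: "V (Suc t) \<le> (1 + \<eta> t / 2) * v t + 3 / \<eta> t * (2 * L\<Phi>\<^sup>2 * ((r t)\<^sup>2 * N t) + 2 * \<Delta> t)"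
proof -
  let ?c = "penalty S t" and ?c' = "penalty S (Suc t)"
  \<comment> \<open>\<open>?X\<close> is the movement of the point at the old penalty,
    \<open>?Y\<close> the change of penalty at the new point; together they are the change of
    \<open>grad\<close>.\<close>
  let ?X = "\<lambda>\<omega>. D\<Phi> ?c (z t \<omega>) - D\<Phi> ?c (z (Suc t) \<omega>)" and ?Y = "\<lambda>\<omega>. (1 / ?c - 1 / ?c') *\<^sub>R DF (z (Suc t) \<omega>)"
  have sX: "sqint M ?X" by (intro sqint_diff sqint_lipschitz[OF _ grad_lip] sqint_t)
  have sY: "sqint M ?Y" by (intro sqint_scaleR sqint_lipschitz[OF _ DF_lip] sqint_t)
  have "V (Suc t) = msq M (\<lambda>\<omega>. (mm (Suc t) \<omega> - grad t \<omega>) + (?X \<omega> + ?Y \<omega>))"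
    unfolding V_def by (rule msq_cong) (simp add: grad_def D\<Phi>_def algebra_simps)
  also have "\<dots> \<le> (1 + \<eta> t / 2) * v t + (1 + 1 / (\<eta> t / 2)) * msq M (\<lambda>\<omega>. ?X \<omega> + ?Y \<omega>)"
    unfolding v_def using \<eta>[of t] by (intro msq_add_young sqint_diff sqint_v sqint_add sX sY) auto
  also have "(1 + 1 / (\<eta> t / 2)) * msq M (\<lambda>\<omega>. ?X \<omega> + ?Y \<omega>) \<le> 3 / \<eta> t * (2 * L\<Phi>\<^sup>2 * ((r t)\<^sup>2 * N t) + 2 * \<Delta> t)"
  proof (rule mult_mono[OF young_weight])
    have "msq M ?X \<le> L\<Phi>\<^sup>2 * msq M (\<lambda>\<omega>. z (Suc t) \<omega> - z t \<omega>)"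
      using lipschitz_onD[OF grad_lip] L\<Phi>_nonneg
      by (intro msq_lipschitz_le sX sqint_diff sqint_t) (auto simp: dist_norm norm_minus_commute)
    also have "\<dots> \<le> L\<Phi>\<^sup>2 * ((r t)\<^sup>2 * N t)" by (intro mult_left_mono msq_z_move) simp
    finally have "msq M ?X \<le> L\<Phi>\<^sup>2 * ((r t)\<^sup>2 * N t)" .
    moreover have "msq M ?Y = \<Delta> t" by (simp add: \<Delta>_def power_mult_distrib)
    ultimately show "msq M (\<lambda>\<omega>. ?X \<omega> + ?Y \<omega>) \<le> 2 * L\<Phi>\<^sup>2 * ((r t)\<^sup>2 * N t) + 2 * \<Delta> t"
      using msq_add_young[OF sX sY, of 1] by simp
  qed (use \<eta>[of t] in auto)
  finally show ?thesis by simp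
qed

lemma St_le: "norm (St t \<omega>) \<le> lower.K * norm (th t \<omega> - pr t \<omega>)"
  using lower.S_lip[of "z t \<omega>" "th t \<omega>" "z t \<omega>" "pr t \<omega>"] by (simp add: St_def pr_def)

text \<open>\<open>St\<close> vanishes when \<open>th\<close> is the proximal point, so the momentum
  is controlled by its own error and the tracking error. This is the feedback of \<open>u\<close>
  and \<open>h\<close> into \<open>U\<close>.\<close>

lemma theta_move: "msq M (mt (Suc t)) \<le> 2 * u t + 2 * lower.K\<^sup>2 * h t"
proof -
  have "msq M (mt (Suc t)) = msq M (\<lambda>\<omega>. (mt (Suc t) \<omega> - St t \<omega>) + St t \<omega>)" by simp
  also have "\<dots> \<le> (1 + 1) * u t + (1 + 1 / 1) * msq M (St t)"
    unfolding u_def by (intro msq_add_young sqint_diff sqint_t sqint_v) simp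
  also have "msq M (St t) \<le> lower.K\<^sup>2 * h t"
    unfolding h_def using lower.K_pos by (intro msq_lipschitz_le sqint_diff sqint_t sqint_v St_le) auto
  finally show ?thesis by simp
qed

lemma theta_drift: "U (Suc t) \<le> (1 + \<eta> t / 2) * u t
    + 3 / \<eta> t * (2 * lower.K\<^sup>2 * ((r t)\<^sup>2 * N t) + 2 * lower.K\<^sup>2 * ((step_theta S t)\<^sup>2 * (2 * u t + 2 * lower.K\<^sup>2 * h t)))"
proof -
  let ?X = "\<lambda>\<omega>. St t \<omega> - St (Suc t) \<omega>"
  have sX: "sqint M ?X" by (intro sqint_diff sqint_v)
  have "U (Suc t) = msq M (\<lambda>\<omega>. (mt (Suc t) \<omega> - St t \<omega>) + ?X \<omega>)"
    unfolding U_def by (rule msq_cong) (simp add: algebra_simps)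
  also have "\<dots> \<le> (1 + \<eta> t / 2) * u t + (1 + 1 / (\<eta> t / 2)) * msq M ?X"
    unfolding u_def using \<eta>[of t] by (intro msq_add_young sqint_diff sqint_v sqint_t) auto
  also have "(1 + 1 / (\<eta> t / 2)) * msq M ?X
      \<le> 3 / \<eta> t * (2 * lower.K\<^sup>2 * ((r t)\<^sup>2 * N t) + 2 * lower.K\<^sup>2 * ((step_theta S t)\<^sup>2 * (2 * u t + 2 * lower.K\<^sup>2 * h t)))"
  proof (rule mult_mono[OF young_weight])
    have "msq M ?X \<le> (\<integral>\<omega>. 2 * lower.K\<^sup>2 * ((r t)\<^sup>2 * (norm (mm (Suc t) \<omega>))\<^sup>2)
        + 2 * lower.K\<^sup>2 * ((step_theta S t)\<^sup>2 * (norm (mt (Suc t) \<omega>))\<^sup>2) \<partial>M)"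
    proof (rule integral_mono)
      fix \<omega> assume \<omega>: "\<omega> \<in> space M"
      let ?a = "norm (z (Suc t) \<omega> - z t \<omega>)" and ?b = "norm (th (Suc t) \<omega> - th t \<omega>)"
      have "(norm (?X \<omega>))\<^sup>2 \<le> (lower.K * (?a + ?b))\<^sup>2"
        using lower.S_lip[of "z (Suc t) \<omega>" "th (Suc t) \<omega>" "z t \<omega>" "th t \<omega>"]
        by (intro power_mono) (auto simp: St_def norm_minus_commute)
      also have "\<dots> \<le> lower.K\<^sup>2 * (2 * ?a\<^sup>2 + 2 * ?b\<^sup>2)"
        using norm_add_sq_le[of ?a ?b] by (simp add: power_mult_distrib mult_left_mono)
      also have "\<dots> \<le> lower.K\<^sup>2 * (2 * ((r t)\<^sup>2 * (norm (mm (Suc t) \<omega>))\<^sup>2) + 2 * ((step_theta S t)\<^sup>2 * (norm (mt (Suc t) \<omega>))\<^sup>2))"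
        using z_move(3)[OF \<omega>, of t] iteration(2)[OF \<omega>, of t]
        by (intro mult_left_mono add_mono) (auto simp: power_mult_distrib)
      finally show "(norm (?X \<omega>))\<^sup>2 \<le> 2 * lower.K\<^sup>2 * ((r t)\<^sup>2 * (norm (mm (Suc t) \<omega>))\<^sup>2)
        + 2 * lower.K\<^sup>2 * ((step_theta S t)\<^sup>2 * (norm (mt (Suc t) \<omega>))\<^sup>2)"
        by (simp add: distrib_left)
    qed (use sqint_integrable[OF sX] int_v in auto)
    also have "\<dots> = 2 * lower.K\<^sup>2 * ((r t)\<^sup>2 * N t) + 2 * lower.K\<^sup>2 * ((step_theta S t)\<^sup>2 * msq M (mt (Suc t)))"
      using int_v by (simp add: N_def)
    also have "\<dots> \<le> 2 * lower.K\<^sup>2 * ((r t)\<^sup>2 * N t) + 2 * lower.K\<^sup>2 * ((step_theta S t)\<^sup>2 * (2 * u t + 2 * lower.K\<^sup>2 * h t))"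
      by (intro add_mono mult_left_mono theta_move) auto
    finally show "msq M ?X \<le> 2 * lower.K\<^sup>2 * ((r t)\<^sup>2 * N t) + 2 * lower.K\<^sup>2 * ((step_theta S t)\<^sup>2 * (2 * u t + 2 * lower.K\<^sup>2 * h t))" .
  qed (use \<eta>[of t] in auto)
  finally show ?thesis by simp
qed

text \<open>An exact gradient step contracts towards the old proximal point, and the momentum error
  perturbs it. Young's weight \<open>step_theta S t * lower.\<mu> / 2\<close> gives up half of the
  contraction and reduces the squared step in front of \<open>u\<close> to a single one.\<close>

lemma tracking_step:
  assumes a: "step_theta S t * lower.K\<^sup>2 \<le> lower.\<mu>" "step_theta S t * lower.\<mu> \<le> 1" "step_theta S t \<le> 1"
  shows "H t \<le> (1 - step_theta S t * (lower.\<mu> / 2)) * h t + (1 + 2 / lower.\<mu>) * step_theta S t * u t"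
proof -
  let ?a = "step_theta S t" and ?\<mu> = "lower.\<mu>"
  let ?X = "\<lambda>\<omega>. th t \<omega> - ?a *\<^sub>R St t \<omega> - pr t \<omega>" and ?Y = "\<lambda>\<omega>. (- ?a) *\<^sub>R (mt (Suc t) \<omega> - St t \<omega>)"
  have pos: "0 < ?a" "0 < ?\<mu>" using steps(1) lower.\<mu>_pos by auto
  have sX: "sqint M ?X" by (intro sqint_diff sqint_scaleR sqint_t sqint_v)
  have sY: "sqint M ?Y" by (intro sqint_diff sqint_scaleR sqint_t sqint_v)
  have "H t = msq M (\<lambda>\<omega>. ?X \<omega> + ?Y \<omega>)"
    unfolding H_def by (rule msq_cong) (simp add: iteration(2) algebra_simps)
  also have "\<dots> \<le> (1 + ?a * ?\<mu> / 2) * msq M ?X + (1 + 1 / (?a * ?\<mu> / 2)) * msq M ?Y"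
    using pos by (intro msq_add_young sX sY) auto
  also have "msq M ?Y = ?a\<^sup>2 * u t" by (simp add: u_def power_mult_distrib)
  also have "(1 + 1 / (?a * ?\<mu> / 2)) * (?a\<^sup>2 * u t) = (?a + 2 / ?\<mu>) * ?a * u t"
    using pos by (simp add: field_simps power2_eq_square)
  also have "\<dots> \<le> (1 + 2 / ?\<mu>) * ?a * u t"
    using a(3) pos u_nonneg by (intro mult_right_mono) auto
  also have "(1 + ?a * ?\<mu> / 2) * msq M ?X \<le> (1 + ?a * ?\<mu> / 2) * ((1 - ?a * ?\<mu>) * h t)"
  proof (rule mult_left_mono)
    have "msq M ?X \<le> (\<integral>\<omega>. (1 - ?a * ?\<mu>) * (norm (th t \<omega> - pr t \<omega>))\<^sup>2 \<partial>M)"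
    proof (rule integral_mono)
      show "(norm (?X \<omega>))\<^sup>2 \<le> (1 - ?a * ?\<mu>) * (norm (th t \<omega> - pr t \<omega>))\<^sup>2" for \<omega>
        using lower.gradient_step_contraction[OF _ a(1), of "th t \<omega>" "z t \<omega>" "pr t \<omega>"] pos
        by (simp add: St_def pr_def)
    qed (use sqint_integrable[OF sX] sqint_integrable[OF sqint_diff[OF sqint_t(3) sqint_v(4)]] in auto)
    then show "msq M ?X \<le> (1 - ?a * ?\<mu>) * h t" by (simp add: h_def)
  qed (use pos in auto)
  also have "(1 + ?a * ?\<mu> / 2) * ((1 - ?a * ?\<mu>) * h t) \<le> (1 - ?a * (?\<mu> / 2)) * h t"
  proof -
    have "(1 + x / 2) * (1 - x) = 1 - x / 2 - x\<^sup>2 / 2" for x :: real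
      by (simp add: power2_eq_square field_simps)
    from this[of "?a * ?\<mu>"] have "(1 + ?a * ?\<mu> / 2) * (1 - ?a * ?\<mu>) \<le> 1 - ?a * (?\<mu> / 2)" by simp
    then show ?thesis using h_nonneg by (metis mult.assoc mult_right_mono)
  qed
  finally show ?thesis by simp
qed

text \<open>The proximal point moves at most a constant times as far as the iterates. Half of the
  rate left by \<open>tracking_step\<close> is the Young weight, and its inverse is the source of
  the division by \<open>step_theta S t\<close>.\<close>

lemma tracking_drift:
  assumes "step_theta S t \<le> 1"
  shows "h (Suc t) \<le> (1 + step_theta S t * (lower.\<mu> / 2) / 2) * H t
    + (1 + 4 / lower.\<mu>) * (lower.K / lower.\<mu>)\<^sup>2 / step_theta S t * ((r t)\<^sup>2 * N t)"
proof -
  let ?a = "step_theta S t" and ?\<mu> = "lower.\<mu>"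
  let ?X = "\<lambda>\<omega>. pr t \<omega> - pr (Suc t) \<omega>"
  have pos: "0 < ?a" "0 < ?\<mu>" using steps(1) lower.\<mu>_pos by auto
  have sX: "sqint M ?X" by (intro sqint_diff sqint_v)
  have "h (Suc t) = msq M (\<lambda>\<omega>. (th (Suc t) \<omega> - pr t \<omega>) + ?X \<omega>)" by (simp add: h_def)
  also have "\<dots> \<le> (1 + ?a * (?\<mu> / 2) / 2) * H t + (1 + 1 / (?a * (?\<mu> / 2) / 2)) * msq M ?X"
    unfolding H_def using pos by (intro msq_add_young sX sqint_diff sqint_t sqint_v) auto
  also have "(1 + 1 / (?a * (?\<mu> / 2) / 2)) * msq M ?X \<le> ((1 + 4 / ?\<mu>) / ?a) * ((lower.K / ?\<mu>)\<^sup>2 * ((r t)\<^sup>2 * N t))"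
  proof (rule mult_mono)
    show "1 + 1 / (?a * (?\<mu> / 2) / 2) \<le> (1 + 4 / ?\<mu>) / ?a"
      using pos assms by (simp add: field_simps)
    have "msq M ?X \<le> (lower.K / ?\<mu>)\<^sup>2 * msq M (\<lambda>\<omega>. z (Suc t) \<omega> - z t \<omega>)"
      using lower.prox_lip lower.K_pos pos
      by (intro msq_lipschitz_le sX sqint_diff sqint_t) (auto simp: pr_def norm_minus_commute)
    also have "\<dots> \<le> (lower.K / ?\<mu>)\<^sup>2 * ((r t)\<^sup>2 * N t)" by (intro mult_left_mono msq_z_move) simp
    finally show "msq M ?X \<le> (lower.K / ?\<mu>)\<^sup>2 * ((r t)\<^sup>2 * N t)" .
  qed (use pos in auto)
  finally show ?thesis by simp
qed

end

section \<open>Rates\<close>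

lemma powr_neg_tendsto_0: "p < 0 \<Longrightarrow> (\<lambda>t. (1 + real t) powr p) \<longlonglongrightarrow> 0"
  by real_asymp

lemma powr_neg_decseq: "p \<le> 0 \<Longrightarrow> decseq (\<lambda>t. (1 + real t) powr p)"
  by (intro decseq_SucI powr_mono2') auto

text \<open>Telescoping bounds the sum of \<open>r * q\<close>, and \<open>(m T)^2\<close> times the
  sum of \<open>r\<close> is at most a multiple of it. The number \<open>m T\<close> stands for the
  best expected stationarity measure up to \<open>T\<close>.\<close>

lemma min_rate:
  fixes r s q W m :: "nat \<Rightarrow> real"
  assumes desc: "\<And>t. t \<ge> t0 \<Longrightarrow> W (Suc t) \<le> W t - c * r t * q t + C * (r t * s t)"
    and W: "\<And>t. 0 \<le> W t" and q: "\<And>t. 0 \<le> q t" and c: "0 < c" "0 < C" "0 < w"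
    and r: "\<And>t. r t = (1 + real t) powr (-(3/4))" and s: "\<And>t. 0 < s t"
    and pen: "incseq pen" "\<And>t. 0 < pen t"
    and m: "\<And>T. 0 \<le> m T" "\<And>T t. t \<le> T \<Longrightarrow> m T \<le> pen (Suc t) / w * sqrt (q (Suc t))"
    and T: "2 * t0 \<le> T"
  shows "(m T)\<^sup>2 \<le> (pen (Suc T))\<^sup>2 * (real T + 2) powr (-(1/4)) * (2 / (w\<^sup>2 * c))
    * (W t0 + C * (\<Sum>t<T+2. r t * s t))"
proof -
  have tele: "c * (\<Sum>t=t0..<n. r t * q t) \<le> W t0 - W n + C * (\<Sum>t=t0..<n. r t * s t)" if "t0 \<le> n" for n
    using that
  proof (induction n rule: nat_induct_at_least)
    case (Suc n)
    then show ?case using desc[of n] by (simp add: distrib_left)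
  qed simp
  have rq: "0 \<le> r t * q t" and rs: "0 \<le> r t * s t" for t using q s by (simp_all add: r less_imp_le)
  have "(m T)\<^sup>2 * ((real T + 2) powr (1/4) / 2) \<le> (m T)\<^sup>2 * (\<Sum>t=t0..T. r (Suc t))"
  proof (rule mult_left_mono)
    \<comment> \<open>Because \<open>2 * t0 \<le> T\<close>, at least \<open>(T + 2) / 2\<close>
      indices remain, and no term is smaller than the last one.\<close>
    have "(real T + 2) powr (1/4) / 2 = (real T + 2) / 2 * (real T + 2) powr (-(3/4))"
      using powr_mult_base[of "real T + 2" "-(3/4)"] by simp
    also have "\<dots> \<le> real (card {t0..T}) * (real T + 2) powr (-(3/4))"
      using T by (intro mult_right_mono) auto
    also have "\<dots> = (\<Sum>t=t0..T. (real T + 2) powr (-(3/4)))" by simp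
    also have "\<dots> \<le> (\<Sum>t=t0..T. r (Suc t))"
      unfolding r by (intro sum_mono powr_mono2') auto
    finally show "(real T + 2) powr (1/4) / 2 \<le> (\<Sum>t=t0..T. r (Suc t))" .
  qed simp
  also have "\<dots> \<le> (\<Sum>t=t0..T. (pen (Suc T) / w)\<^sup>2 * (r (Suc t) * q (Suc t)))"
    unfolding sum_distrib_left
  proof (rule sum_mono)
    fix t assume "t \<in> {t0..T}"
    then have t: "t \<le> T" by simp
    have "m T \<le> pen (Suc T) / w * sqrt (q (Suc t))"
      using m(2)[OF t] incseqD[OF pen(1), of "Suc t" "Suc T"] t c q
      by (meson divide_right_mono less_imp_le mult_right_mono order_trans real_sqrt_ge_zero Suc_le_mono)
    then have "(m T)\<^sup>2 \<le> (pen (Suc T) / w * sqrt (q (Suc t)))\<^sup>2" using m(1) by (intro power_mono)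
    also have "\<dots> = (pen (Suc T) / w)\<^sup>2 * q (Suc t)" using q by (simp add: power_mult_distrib power_divide)
    finally have "(m T)\<^sup>2 * r (Suc t) \<le> (pen (Suc T) / w)\<^sup>2 * q (Suc t) * r (Suc t)"
      by (intro mult_right_mono) (auto simp: r)
    then show "(m T)\<^sup>2 * r (Suc t) \<le> (pen (Suc T) / w)\<^sup>2 * (r (Suc t) * q (Suc t))" by (simp add: mult_ac)
  qed
  \<comment> \<open>Stationarity number \<open>t\<close> is measured at the iterate
    \<open>t + 1\<close>, which shifts the range.\<close>
  also have "\<dots> = (pen (Suc T) / w)\<^sup>2 * (\<Sum>t=Suc t0..Suc T. r t * q t)"
    by (simp only: sum_distrib_left[symmetric] sum.shift_bounds_cl_Suc_ivl)
  also have "\<dots> \<le> (pen (Suc T) / w)\<^sup>2 * ((W t0 + C * (\<Sum>t<T+2. r t * s t)) / c)"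
  proof (rule mult_left_mono)
    have "(\<Sum>t=Suc t0..Suc T. r t * q t) \<le> (\<Sum>t=t0..<T+2. r t * q t)"
      using rq by (intro sum_mono2) auto
    moreover have "c * (\<Sum>t=t0..<T+2. r t * q t) \<le> W t0 + C * (\<Sum>t=t0..<T+2. r t * s t)"
      using tele[of "T + 2"] W[of "T + 2"] T by simp
    moreover have "(\<Sum>t=t0..<T+2. r t * s t) \<le> (\<Sum>t<T+2. r t * s t)"
      using rs by (intro sum_mono2) auto
    ultimately have "c * (\<Sum>t=Suc t0..Suc T. r t * q t) \<le> W t0 + C * (\<Sum>t<T+2. r t * s t)"
      using c by (smt (verit) mult_left_mono)
    then show "(\<Sum>t=Suc t0..Suc T. r t * q t) \<le> (W t0 + C * (\<Sum>t<T+2. r t * s t)) / c"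
      using c by (simp add: field_simps)
  qed simp
  finally show ?thesis
    using c by (simp add: powr_minus field_simps power_divide)
qed

lemma bigo_of_sq:
  fixes m g :: "nat \<Rightarrow> real"
  assumes m: "\<And>T. 0 \<le> m T" and "0 \<le> A"
    and le: "\<And>T. T0 \<le> T \<Longrightarrow> (m T)\<^sup>2 \<le> A * (g T)\<^sup>2" and g: "\<And>T. T0 \<le> T \<Longrightarrow> 0 \<le> g T"
  shows "m \<in> O(g)"
proof (intro bigoI[of _ "sqrt A"] eventually_sequentiallyI[of T0])
  fix T assume T: "T0 \<le> T"
  then have "m T \<le> sqrt (A * (g T)\<^sup>2)" by (intro real_le_rsqrt le)
  then show "norm (m T) \<le> sqrt A * norm (g T)" using m g[OF T] by (simp add: real_sqrt_mult)
qed

lemma bounded_descent: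
  fixes W b :: "nat \<Rightarrow> real"
  assumes desc: "\<And>t. t \<ge> t0 \<Longrightarrow> W (Suc t) \<le> W t + C * b t" and b: "\<And>t. 0 \<le> b t" and C: "0 \<le> C"
    and bound: "\<And>n. (\<Sum>t<n. b t) \<le> K" and t: "t0 \<le> t"
  shows "W t \<le> W t0 + C * K"
proof -
  have "W t \<le> W t0 + C * (\<Sum>i=t0..<t. b i)" using t
  proof (induction t rule: nat_induct_at_least)
    case (Suc n)
    then show ?case using desc[of n] by (simp add: distrib_left)
  qed simp
  moreover have "(\<Sum>i=t0..<t. b i) \<le> (\<Sum>i<t. b i)" using b by (intro sum_mono2) auto
  ultimately show ?thesis using bound[of t] C by (smt (verit) mult_left_mono)
qed

context momeha_run
begin

text \<open>The rate is left abstract: every nonnegative sequence below all gradient bounds must be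
  \<open>O(rs)\<close>. The minimum over \<open>{0..T}\<close> is such a sequence, so a schedule has
  to supply only an argument about real sequences.\<close>

lemma stationarity:
  assumes gap: "(\<lambda>T. \<integral>\<omega>. gap P (z T \<omega>) \<partial>M) \<in> O(rc)"
    and rate: "\<And>m. (\<And>T. 0 \<le> m T) \<Longrightarrow>
      (\<And>T t. t \<le> T \<Longrightarrow> m T \<le> penalty S (Suc t) / wmin * sqrt (q (Suc t))) \<Longrightarrow> m \<in> O(rs)"
  shows "stationary_in_expectation P M R rc rs"
proof -
  \<comment> \<open>The multiplier depends on the random point reached; its penalty has the index of
    \<open>grad (Suc t)\<close>.\<close>
  define pm where "pm t \<omega> = penalty S (Suc t) / weight (z (Suc t) \<omega>)" for t \<omega>
  let ?st = "iter_stat P R pm"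
  have iter_gap_eq: "iter_gap P R t \<omega> = gap P (z t \<omega>)" for t \<omega> by (simp add: iter_gap_def z_def)
  have st_eq: "?st t \<omega> = stat_measure P (pm t \<omega>) (gap P (z (Suc t) \<omega>)) (z (Suc t) \<omega>)" for t \<omega>
    by (simp add: iter_stat_def iter_gap_eq) (simp add: z_def)
  have zM: "z t \<in> borel_measurable M" for t using adapted_M[OF adapted_t(7)] .
  have pmM: "pm t \<in> borel_measurable M" for t
    unfolding pm_def[abs_def] by (intro borel_measurable_divide borel_measurable_const measurable_compose[OF zM weight_measurable])
  have weight_pos: "0 < weight p" for p using wmin_pos wmin_le_weight[of p] by linarith
  have le: "?st t \<omega> \<le> penalty S (Suc t) / wmin * norm (grad (Suc t) \<omega>)" and nn: "0 \<le> ?st t \<omega>" for t \<omega>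
    unfolding st_eq using stat_measure_le[OF penalty_pos] stat_measure_nonneg
    by (auto simp: pm_def grad_def)
  have int_bound: "integrable M (\<lambda>\<omega>. penalty S (Suc t) / wmin * norm (grad (Suc t) \<omega>))" for t
    by (intro integrable_mult_right sqint_norm_integrable sqint_v)
  have int_st: "integrable M (?st t)" for t
  proof (rule Bochner_Integration.integrable_bound[OF int_bound[of t]])
    show "?st t \<in> borel_measurable M"
      unfolding st_eq[abs_def] using stat_measure_measurable[OF zM pmM] .
    show "AE \<omega> in M. norm (?st t \<omega>) \<le> norm (penalty S (Suc t) / wmin * norm (grad (Suc t) \<omega>))"
      using le nn by (intro AE_I2) (smt (verit) real_norm_def)
  qed
  have "(\<integral>\<omega>. ?st t \<omega> \<partial>M) \<le> penalty S (Suc t) / wmin * sqrt (q (Suc t))" for t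
  proof -
    have "(\<integral>\<omega>. ?st t \<omega> \<partial>M) \<le> (\<integral>\<omega>. penalty S (Suc t) / wmin * norm (grad (Suc t) \<omega>) \<partial>M)"
      by (intro integral_mono int_st int_bound le)
    also have "\<dots> = penalty S (Suc t) / wmin * (\<integral>\<omega>. norm (grad (Suc t) \<omega>) \<partial>M)" by simp
    also have "\<dots> \<le> penalty S (Suc t) / wmin * sqrt (q (Suc t))"
      unfolding q_def using penalty_pos[of "Suc t"] wmin_pos
      by (intro mult_left_mono expectation_norm_le sqint_v) auto
    finally show ?thesis .
  qed
  then have "(MIN t\<in>{0..T}. \<integral>\<omega>. ?st t \<omega> \<partial>M) \<le> penalty S (Suc t) / wmin * sqrt (q (Suc t))"
    if "t \<le> T" for t T
    using that by (intro order_trans[OF Min_le]) auto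
  then have "(\<lambda>T. MIN t\<in>{0..T}. \<integral>\<omega>. ?st t \<omega> \<partial>M) \<in> O(rs)"
    using nn by (intro rate) (auto simp: Min_ge_iff)
  moreover have "(\<lambda>T. \<integral>\<omega>. iter_gap P R T \<omega> \<partial>M) \<in> O(rc)" using gap by (simp add: iter_gap_eq)
  moreover have "0 \<le> pm t \<omega>" for t \<omega>
    using penalty_pos[of "Suc t"] weight_pos[of "z (Suc t) \<omega>"] by (simp add: pm_def)
  moreover have "integrable M (iter_gap P R t)" for t
    using integrable_gap[of t] by (simp add: iter_gap_eq[abs_def])
  ultimately show ?thesis
    unfolding stationary_in_expectation_def using pmM int_st by blast
qed

lemma \<phi>_nonneg: "0 \<le> \<phi> t"
  unfolding \<phi>_def using \<Phi>_nonneg[OF penalty_pos] by simp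

text \<open>The ratios have exponents \<open>-(3/4) + e\<close>, \<open>-(3/4) + 2/3 * e\<close> and
  \<open>- e / 3\<close>, all negative in the given range of \<open>e\<close>, as
  \<open>lyapunov_descent\<close> demands.\<close>

lemma lyapunov_bound:
  assumes r: "r = (\<lambda>t. (1 + real t) powr (-(3/4)))"
    and a: "step_theta S = (\<lambda>t. (1 + real t) powr (-e))" and e: "3/8 \<le> e" "e < 1/2"
    and \<kappa>: "0 < \<kappa>" "\<forall>\<^sub>F t in sequentially. \<kappa> * r t \<le> step_x S t \<and> \<kappa> * r t \<le> step_y S t"
    and l: "0 < l" "0 < L" "\<forall>\<^sub>F t in sequentially. l * s t \<le> \<eta> t \<and> \<eta> t \<le> L * s t"
    and \<Delta>: "0 \<le> K" "\<And>t. \<Delta> t \<le> K * s t ^ 3"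
  obtains c C W t0 where "0 < c" "0 < C" "\<And>t. \<phi> t \<le> W t"
    "\<And>t. t \<ge> t0 \<Longrightarrow> W (Suc t) \<le> W t - c * r t * q t + C * (r t * s t)"
proof -
  have s: "s t = (1 + real t) powr (-(2/3 * e))" for t by (simp add: s_def a powr_powr mult.commute)
  have ra: "r t / step_theta S t = (1 + real t) powr (-(3/4) + e)"
    and rs: "r t / s t = (1 + real t) powr (-(3/4) + 2/3 * e)"
    and as: "step_theta S t / s t = (1 + real t) powr (- e / 3)" for t
    by (simp_all add: r a s powr_diff[symmetric])
  have pos: "0 < r t" "0 < step_theta S t" "0 < s t" for t by (simp_all add: r a s)
  have s1: "s t \<le> 1" "step_theta S t \<le> 1" for t
    using e powr_mono[of "-(2/3 * e)" 0 "1 + real t"] powr_mono[of "- e" 0 "1 + real t"] by (auto simp: s a)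
  have lim: "r \<longlonglongrightarrow> 0" "step_theta S \<longlonglongrightarrow> 0" "(\<lambda>t. r t / step_theta S t) \<longlonglongrightarrow> 0" "(\<lambda>t. r t / s t) \<longlonglongrightarrow> 0"
    "(\<lambda>t. step_theta S t / s t) \<longlonglongrightarrow> 0"
    unfolding ra rs as unfolding r a using e by (intro powr_neg_tendsto_0; simp)+
  have dec: "decseq (\<lambda>t. r t / step_theta S t)" "decseq (\<lambda>t. r t / s t)"
    unfolding ra rs using e by (intro powr_neg_decseq; simp)+
  let ?K = "lower.K" and ?\<mu> = "lower.\<mu>"
  have K\<mu>: "0 < ?K" "0 < ?\<mu>" using lower.K_pos lower.\<mu>_pos by auto
  \<comment> \<open>A sum dominating every coefficient of the error recursions, so that one constant
    serves them all.\<close>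
  define C where "C = 1 + Cv + 2 * L * \<sigma>\<^sup>2 + 6 * L\<Phi>\<^sup>2 + 6 * K + 18 * ?K\<^sup>2 + 12 * ?K ^ 4 + 2 / ?\<mu>
    + (1 + 4 / ?\<mu>) * (?K / ?\<mu>)\<^sup>2"
  have Cv: "0 \<le> Cv" by (simp add: Cv_def)
  have nn: "0 \<le> L * \<sigma>\<^sup>2" "0 \<le> 2 / ?\<mu>" "0 \<le> (1 + 4 / ?\<mu>) * (?K / ?\<mu>)\<^sup>2" "0 \<le> ?K ^ 4" "0 \<le> ?K\<^sup>2" "0 \<le> L\<Phi>\<^sup>2"
    using K\<mu> l by (auto intro: mult_nonneg_nonneg)
  have C: "1 \<le> C" "Cv + 2 * L * \<sigma>\<^sup>2 \<le> C" "L * \<sigma>\<^sup>2 \<le> C" "6 * L\<Phi>\<^sup>2 \<le> C" "6 * K \<le> C" "6 * ?K\<^sup>2 \<le> C"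
    "12 * ?K\<^sup>2 \<le> C" "12 * ?K ^ 4 \<le> C" "1 + 2 / ?\<mu> \<le> C" "(1 + 4 / ?\<mu>) * (?K / ?\<mu>)\<^sup>2 \<le> C"
    unfolding C_def using nn Cv \<Delta>(1) by linarith+
  define c where "c = \<kappa> / 4"
  have c: "0 < c" using \<kappa> by (simp add: c_def)
  have sm1: "\<forall>\<^sub>F t in sequentially. L\<Phi> * r t < 1 / 4"
    by (rule order_tendstoD(2)[OF tendsto_mult_left[OF lim(1)]]) simp
  have sm2: "\<forall>\<^sub>F t in sequentially. step_theta S t * ?K\<^sup>2 < ?\<mu>"
    by (rule order_tendstoD(2)[of _ "0 * ?K\<^sup>2"]) (use K\<mu> in \<open>auto intro!: tendsto_intros lim\<close>)
  have sm3: "\<forall>\<^sub>F t in sequentially. step_theta S t * ?\<mu> < 1"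
    by (rule order_tendstoD(2)[OF tendsto_mult_right[OF lim(2)]]) simp
  show ?thesis
  \<comment> \<open>The rate is \<open>?\<mu> / 2\<close> because \<open>tracking_step\<close> has
    given up half of the contraction.\<close>
  proof (rule lyapunov_descent[of r "step_theta S" s \<eta> c l L "?\<mu> / 2" C N v V u U h H \<phi> q])
    show "\<forall>\<^sub>F t in sequentially. \<phi> (Suc t) \<le> \<phi> t - c * r t * q t - c * r t * N t + C * r t * v t"
      using \<kappa>(2) sm1
    proof eventually_elim
      case (elim t)
      have "1 / 2 * r t * v t \<le> C * r t * v t"
        using C(1) pos(1)[of t] v_nonneg[of t] by (intro mult_right_mono) auto
      then show ?case using descent[of \<kappa> t] elim \<kappa>(1) by (simp add: c_def)
    qed
    show "\<forall>\<^sub>F t in sequentially. v t \<le> (1 - \<eta> t) * V t + C * \<eta> t * (H t + s t + (r t)\<^sup>2 * N t)"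
      using l(3)
    proof eventually_elim
      case (elim t)
      \<comment> \<open>The squared bias is of order \<open>s^2\<close> and disappears in the noise
        of order \<open>s\<close>.\<close>
      have "(s t)\<^sup>2 \<le> s t" using s1(1)[of t] pos(3)[of t] by (simp add: power2_eq_square)
      then have "Cv * (H t + (s t)\<^sup>2 + (r t)\<^sup>2 * N t) \<le> Cv * (H t + s t + (r t)\<^sup>2 * N t)"
        using Cv by (intro mult_left_mono) auto
      moreover have "2 * \<eta> t * \<sigma>\<^sup>2 \<le> 2 * (L * s t) * \<sigma>\<^sup>2" using elim by (intro mult_right_mono) auto
      moreover have "2 * L * \<sigma>\<^sup>2 * s t \<le> 2 * L * \<sigma>\<^sup>2 * (H t + s t + (r t)\<^sup>2 * N t)"
        using nn H_nonneg[of t] N_nonneg[of t] by (intro mult_left_mono) auto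
      moreover have "(Cv + 2 * L * \<sigma>\<^sup>2) * (H t + s t + (r t)\<^sup>2 * N t) \<le> C * (H t + s t + (r t)\<^sup>2 * N t)"
        using C(2) H_nonneg[of t] N_nonneg[of t] pos(3)[of t] by (intro mult_right_mono) auto
      ultimately have "Cv * (H t + (s t)\<^sup>2 + (r t)\<^sup>2 * N t) + 2 * \<eta> t * \<sigma>\<^sup>2 \<le> C * (H t + s t + (r t)\<^sup>2 * N t)"
        by (simp add: distrib_right mult_ac)
      then have "\<eta> t * (Cv * (H t + (s t)\<^sup>2 + (r t)\<^sup>2 * N t) + 2 * \<eta> t * \<sigma>\<^sup>2) \<le> \<eta> t * (C * (H t + s t + (r t)\<^sup>2 * N t))"
        using \<eta>(1)[of t] by (intro mult_left_mono) auto
      then show ?case using upper_error[of t] by (simp add: distrib_left power2_eq_square mult_ac)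
    qed
    show "\<forall>\<^sub>F t in sequentially. V (Suc t) \<le> (1 + \<eta> t / 2) * v t + C / \<eta> t * ((r t)\<^sup>2 * N t + s t ^ 3)"
    proof (rule always_eventually, rule allI)
      fix t
      have "6 * L\<Phi>\<^sup>2 * ((r t)\<^sup>2 * N t) \<le> C * ((r t)\<^sup>2 * N t)" "6 * K * s t ^ 3 \<le> C * s t ^ 3"
        using C N_nonneg[of t] pos(3)[of t] by (auto intro!: mult_right_mono)
      then have "3 * (2 * L\<Phi>\<^sup>2 * ((r t)\<^sup>2 * N t) + 2 * \<Delta> t) \<le> C * ((r t)\<^sup>2 * N t + s t ^ 3)"
        using \<Delta>(2)[of t] by (simp add: distrib_left)
      then have "3 * (2 * L\<Phi>\<^sup>2 * ((r t)\<^sup>2 * N t) + 2 * \<Delta> t) / \<eta> t \<le> C * ((r t)\<^sup>2 * N t + s t ^ 3) / \<eta> t"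
        using \<eta>(1)[of t] by (intro divide_right_mono) auto
      then show "V (Suc t) \<le> (1 + \<eta> t / 2) * v t + C / \<eta> t * ((r t)\<^sup>2 * N t + s t ^ 3)"
        using upper_drift[of t] by simp
    qed
    show "\<forall>\<^sub>F t in sequentially. u t \<le> (1 - \<eta> t) * U t + C * \<eta> t * s t"
      using l(3)
    proof eventually_elim
      case (elim t)
      have "\<eta> t * \<sigma>\<^sup>2 \<le> (L * s t) * \<sigma>\<^sup>2" using elim by (intro mult_right_mono) auto
      also have "\<dots> = (L * \<sigma>\<^sup>2) * s t" by simp
      also have "\<dots> \<le> C * s t" using C(3) pos(3)[of t] by (intro mult_right_mono) auto
      finally have "\<eta> t * (\<eta> t * \<sigma>\<^sup>2) \<le> \<eta> t * (C * s t)" using \<eta>(1)[of t] by (intro mult_left_mono) auto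
      then show ?case using theta_error[of t] by (simp add: power2_eq_square mult_ac)
    qed
    show "\<forall>\<^sub>F t in sequentially. U (Suc t) \<le> (1 + \<eta> t / 2) * u t
        + C / \<eta> t * ((step_theta S t)\<^sup>2 * (u t + h t) + (r t)\<^sup>2 * N t)"
    proof (rule always_eventually, rule allI)
      fix t
      let ?a = "(step_theta S t)\<^sup>2"
      have "6 * ?K\<^sup>2 * ((r t)\<^sup>2 * N t) \<le> C * ((r t)\<^sup>2 * N t)" "12 * ?K\<^sup>2 * (?a * u t) \<le> C * (?a * u t)"
        "12 * ?K ^ 4 * (?a * h t) \<le> C * (?a * h t)"
        using C(6-8) N_nonneg[of t] u_nonneg[of t] h_nonneg[of t] by (auto intro!: mult_right_mono)
      moreover have "3 * (2 * ?K\<^sup>2 * ((r t)\<^sup>2 * N t) + 2 * ?K\<^sup>2 * (?a * (2 * u t + 2 * ?K\<^sup>2 * h t)))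
          = 6 * ?K\<^sup>2 * ((r t)\<^sup>2 * N t) + 12 * ?K\<^sup>2 * (?a * u t) + 12 * ?K ^ 4 * (?a * h t)"
        by (simp add: power2_eq_square power4_eq_xxxx algebra_simps)
      moreover have "C * (?a * (u t + h t) + (r t)\<^sup>2 * N t)
          = C * (?a * u t) + C * (?a * h t) + C * ((r t)\<^sup>2 * N t)"
        by (simp add: distrib_left)
      ultimately have "3 * (2 * ?K\<^sup>2 * ((r t)\<^sup>2 * N t) + 2 * ?K\<^sup>2 * (?a * (2 * u t + 2 * ?K\<^sup>2 * h t)))
          \<le> C * (?a * (u t + h t) + (r t)\<^sup>2 * N t)"
        by linarith
      then have "3 * (2 * ?K\<^sup>2 * ((r t)\<^sup>2 * N t) + 2 * ?K\<^sup>2 * (?a * (2 * u t + 2 * ?K\<^sup>2 * h t))) / \<eta> t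
          \<le> C * (?a * (u t + h t) + (r t)\<^sup>2 * N t) / \<eta> t"
        using \<eta>(1)[of t] by (intro divide_right_mono) auto
      then show "U (Suc t) \<le> (1 + \<eta> t / 2) * u t + C / \<eta> t * (?a * (u t + h t) + (r t)\<^sup>2 * N t)"
        using theta_drift[of t] by simp
    qed
    show "\<forall>\<^sub>F t in sequentially. H t \<le> (1 - step_theta S t * (?\<mu> / 2)) * h t + C * step_theta S t * u t"
      using sm2 sm3
    proof eventually_elim
      case (elim t)
      have "(1 + 2 / ?\<mu>) * (step_theta S t * u t) \<le> C * (step_theta S t * u t)"
        using C(9) pos(2)[of t] u_nonneg[of t] by (intro mult_right_mono) auto
      then show ?case using tracking_step[of t] elim s1(2)[of t] by simp
    qed
    show "\<forall>\<^sub>F t in sequentially. h (Suc t) \<le> (1 + step_theta S t * (?\<mu> / 2) / 2) * H t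
        + C / step_theta S t * (r t)\<^sup>2 * N t"
    proof (rule always_eventually, rule allI)
      fix t
      have "(1 + 4 / ?\<mu>) * (?K / ?\<mu>)\<^sup>2 / step_theta S t * ((r t)\<^sup>2 * N t) \<le> C / step_theta S t * ((r t)\<^sup>2 * N t)"
        using C(10) pos(2)[of t] N_nonneg[of t] by (intro mult_right_mono divide_right_mono) auto
      then show "h (Suc t) \<le> (1 + step_theta S t * (?\<mu> / 2) / 2) * H t + C / step_theta S t * (r t)\<^sup>2 * N t"
        using tracking_drift[OF s1(2), of t] by simp
    qed
    fix W C' t0
    assume "0 < C'" "\<And>t. \<phi> t \<le> W t" "\<And>t. t0 \<le> t \<Longrightarrow> W (Suc t) \<le> W t - c * r t * q t + C' * (r t * s t)"
    with c show thesis by (rule that)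
  qed (use c pos \<eta> l C(1) K\<mu> N_nonneg v_nonneg V_nonneg u_nonneg U_nonneg h_nonneg H_nonneg dec lim in auto)
qed

lemma gap_integral_nonneg: "0 \<le> (\<integral>\<omega>. gap P (z t \<omega>) \<partial>M)"
  using gap_nonneg by simp

lemma gap_integral_le_\<phi>: "(\<integral>\<omega>. gap P (z t \<omega>) \<partial>M) \<le> \<phi> t"
  unfolding \<phi>_def
  using Flow penalty_pos[of t] by (intro integral_mono integrable_gap integrable_\<Phi>) (simp add: \<Phi>_def)

lemma stationary_constant_penalty:
  assumes r: "r = (\<lambda>t. (1 + real t) powr (-(3/4)))"
    and a: "step_theta S = (\<lambda>t. (1 + real t) powr (-(3/8 + \<delta>)))" and \<delta>: "0 < \<delta>" "\<delta> < 1/8"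
    and pen: "penalty S = (\<lambda>t. c0)"
    and \<kappa>: "0 < \<kappa>" "\<forall>\<^sub>F t in sequentially. \<kappa> * r t \<le> step_x S t \<and> \<kappa> * r t \<le> step_y S t"
    and l: "0 < l" "0 < L" "\<forall>\<^sub>F t in sequentially. l * s t \<le> \<eta> t \<and> \<eta> t \<le> L * s t"
  shows "stationary_in_expectation P M R (\<lambda>T. 1) (\<lambda>T. real T powr (-(1/8 - \<delta>)))"
proof -
  have "0 \<le> s t" for t by (simp add: s_def)
  then have \<Delta>: "\<Delta> t \<le> 0 * s t ^ 3" for t by (simp add: \<Delta>_def pen)
  obtain c C W t0 where W: "0 < c" "0 < C" "\<And>t. \<phi> t \<le> W t"
    "\<And>t. t \<ge> t0 \<Longrightarrow> W (Suc t) \<le> W t - c * r t * q t + C * (r t * s t)"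
    using \<delta> by - (rule lyapunov_bound[OF r a _ _ \<kappa> l order_refl \<Delta>], simp, simp, rule that)
  have W0: "0 \<le> W t" for t using W(3) \<phi>_nonneg order_trans by blast
  have q0: "0 \<le> q t" for t by (simp add: q_def)
  \<comment> \<open>\<open>3/4 + 2/3 * (3/8 + \<delta>) = 1 + 2 * \<delta> / 3\<close>; the surplus
    over \<open>1\<close> makes the errors summable.\<close>
  have rs: "r t * s t = real (Suc t) powr (-1 - 2 * \<delta> / 3)" for t
    by (simp add: r s_def a powr_powr powr_add[symmetric] algebra_simps)
  have "summable (\<lambda>t. real t powr (-1 - 2 * \<delta> / 3))"
    using \<delta> by (simp add: summable_real_powr_iff)
  then have sm: "summable (\<lambda>t. r t * s t)" unfolding rs by (subst summable_Suc_iff)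
  define K where "K = (\<Sum>t. r t * s t)"
  have rs0: "0 \<le> r t * s t" for t unfolding rs by simp
  have K: "(\<Sum>t<n. r t * s t) \<le> K" for n unfolding K_def using sm rs0 by (intro sum_le_suminf) auto
  have K0: "0 \<le> K" using K[of 0] by simp
  show ?thesis
  proof (rule stationarity)
    \<comment> \<open>The gap is a summand of \<open>\<Phi>\<close> whose companion is nonnegative,
      so the bounded Lyapunov function controls it.\<close>
    have "(\<integral>\<omega>. gap P (z t \<omega>) \<partial>M) \<le> W t0 + C * K" if "t0 \<le> t" for t
    proof -
      have "W (Suc t) \<le> W t + C * (r t * s t)" if "t \<ge> t0" for t
      proof -
        have "0 \<le> c * r t * q t" using W(1) q0[of t] r_pos[of t] by simp
        with W(4)[OF that] show ?thesis by linarith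
      qed
      from bounded_descent[OF this rs0 _ K that] W(2) have "W t \<le> W t0 + C * K" by simp
      then show ?thesis using gap_integral_le_\<phi>[of t] W(3)[of t] by linarith
    qed
    then show "(\<lambda>T. \<integral>\<omega>. gap P (z T \<omega>) \<partial>M) \<in> O(\<lambda>T. 1)"
      using gap_integral_nonneg
      by (intro bigoI[of _ "W t0 + C * K"] eventually_sequentiallyI[of t0]) simp
  next
    fix m :: "nat \<Rightarrow> real"
    assume m: "\<And>T. 0 \<le> m T" "\<And>T t. t \<le> T \<Longrightarrow> m T \<le> penalty S (Suc t) / wmin * sqrt (q (Suc t))"
    define A where "A = c0\<^sup>2 * (2 / (wmin\<^sup>2 * c)) * (W t0 + C * K)"
    have A: "0 \<le> A" using W(1,2) W0[of t0] K0 by (simp add: A_def)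
    show "m \<in> O(\<lambda>T. real T powr (-(1/8 - \<delta>)))"
    proof (rule bigo_of_sq[OF m(1) A])
      fix T assume T: "2 * t0 + 1 \<le> T"
      have s0: "0 < s t" for t by (simp add: s_def a)
      have "(m T)\<^sup>2 \<le> (penalty S (Suc T))\<^sup>2 * (real T + 2) powr (-(1/4)) * (2 / (wmin\<^sup>2 * c))
          * (W t0 + C * (\<Sum>t<T+2. r t * s t))"
        using T by (intro min_rate[OF W(4) W0 q0 W(1,2) wmin_pos _ s0 penalty(3) penalty_pos m]) (auto simp: r)
      also have "\<dots> \<le> (penalty S (Suc T))\<^sup>2 * (real T + 2) powr (-(1/4)) * (2 / (wmin\<^sup>2 * c)) * (W t0 + C * K)"
        using W(1,2) K[of "T + 2"] by (intro mult_left_mono add_left_mono) auto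
      also have "\<dots> = A * (real T + 2) powr (-(1/4))" by (simp add: A_def pen)
      also have "\<dots> \<le> A * (real T powr (-(1/8 - \<delta>)))\<^sup>2"
      proof (rule mult_left_mono[OF _ A])
        have "(real T + 2) powr (-(1/4)) \<le> real T powr (-(1/4))" using T by (intro powr_mono2') auto
        \<comment> \<open>The argument yields the exponent \<open>-1/4\<close> for the square; it is
          relaxed to twice \<open>-(1/8 - \<delta>)\<close>.\<close>
        also have "\<dots> \<le> real T powr (-(1/4) + 2 * \<delta>)" using T \<delta> by (intro powr_mono) auto
        also have "\<dots> = (real T powr (-(1/8 - \<delta>)))\<^sup>2"
          by (simp add: power2_eq_square powr_add[symmetric])
        finally show "(real T + 2) powr (-(1/4)) \<le> (real T powr (-(1/8 - \<delta>)))\<^sup>2" .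
      qed
      finally show "(m T)\<^sup>2 \<le> A * (real T powr (-(1/8 - \<delta>)))\<^sup>2" .
    qed simp
  qed
qed

text \<open>The gap rate comes straight from the bounded penalized objective: the expected gap is at
  most \<open>K\<close> divided by the penalty. For stationarity the same bound controls the second
  moment of \<open>DF\<close>, and with it the drift \<open>\<Delta>\<close>.\<close>

lemma stationary_growing_penalty:
  assumes r: "r = (\<lambda>t. (1 + real t) powr (-(3/4)))"
    and a: "step_theta S = (\<lambda>t. (1 + real t) powr (-(3/8)))"
    and pen: "penalty S = (\<lambda>t. c0 * (1 + real t) powr (1/16))"
    and bdd: "\<And>t. (\<integral>\<omega>. penalized P Flow (penalty S t) (z t \<omega>) \<partial>M) \<le> K"
    and \<kappa>: "0 < \<kappa>" "\<forall>\<^sub>F t in sequentially. \<kappa> * r t \<le> step_x S t \<and> \<kappa> * r t \<le> step_y S t"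
    and l: "0 < l" "0 < L" "\<forall>\<^sub>F t in sequentially. l * s t \<le> \<eta> t \<and> \<eta> t \<le> L * s t"
  shows "stationary_in_expectation P M R (\<lambda>T. real T powr (-(1/16)))
    (\<lambda>T. real T powr (-(1/16)) * sqrt (ln (real T)))"
proof -
  let ?EF = "\<lambda>t. \<integral>\<omega>. stch P (z t \<omega>) - Flow \<partial>M" and ?Eg = "\<lambda>t. \<integral>\<omega>. gap P (z t \<omega>) \<partial>M"
  have int_FL: "integrable M (\<lambda>\<omega>. stch P (z t \<omega>) - Flow)" for t using integrable_F by simp
  have sum_le: "?EF t + penalty S t * ?Eg t \<le> K" for t
    using bdd[of t] int_FL[of t] integrable_gap[of t] unfolding penalized_def by simp
  have EF0: "0 \<le> ?EF t" for t using Flow by simp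
  have EF: "?EF t \<le> K" and Eg: "penalty S t * ?Eg t \<le> K" for t
    using sum_le[of t] EF0[of t] mult_nonneg_nonneg[OF less_imp_le[OF penalty_pos[of t]] gap_integral_nonneg[of t]]
    by linarith+
  have K0: "0 \<le> K" using EF[of 0] EF0[of 0] by linarith
  \<comment> \<open>The gradient of a smooth function bounded below is controlled by its value,
    whose expectation \<open>bdd\<close> bounds.\<close>
  have DF2: "msq M (\<lambda>\<omega>. DF (z t \<omega>)) \<le> 4 * (LF + 1) * K" for t
  proof -
    have "msq M (\<lambda>\<omega>. DF (z t \<omega>)) \<le> (\<integral>\<omega>. 4 * (LF + 1) * (stch P (z t \<omega>) - Flow) \<partial>M)"
      by (intro integral_mono DF_le_value integrable_mult_right int_FL sqint_integrable sqint_lipschitz[OF _ DF_lip] sqint_t)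
    also have "\<dots> = 4 * (LF + 1) * ?EF t" by simp
    also have "\<dots> \<le> 4 * (LF + 1) * K" using EF LF_nonneg by (intro mult_left_mono) auto
    finally show ?thesis .
  qed
  have s: "s t = (1 + real t) powr (-(1/4))" for t by (simp add: s_def a powr_powr)
  define K' where "K' = (1 / c0)\<^sup>2 * (4 * (LF + 1) * K)"
  have K': "0 \<le> K'" using K0 LF_nonneg by (simp add: K'_def)
  \<comment> \<open>The admissible drift is \<open>s ^ 3\<close>, of exponent \<open>-3/4\<close>.
    Inverse penalties differ at most by order \<open>1 / (1 + t)\<close>; relaxing this to exponent
    \<open>-3/8\<close> before squaring gives exactly that order.\<close>
  have \<Delta>: "\<Delta> t \<le> K' * s t ^ 3" for t
  proof -
    let ?x = "1 + real t" and ?y = "2 + real t"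
    have "1 / penalty S t - 1 / penalty S (Suc t) = 1 / c0 * (?x powr (-(1/16)) - ?y powr (-(1/16)))"
      using penalty(1) by (simp add: pen powr_minus field_simps)
    then have "(1 / penalty S t - 1 / penalty S (Suc t))\<^sup>2 = (1 / c0)\<^sup>2 * (?x powr (-(1/16)) - ?y powr (-(1/16)))\<^sup>2"
      by (simp only: power_mult_distrib)
    also have "\<dots> \<le> (1 / c0)\<^sup>2 * (?x powr (-(3/8)))\<^sup>2"
    proof (intro mult_left_mono power_mono)
      show "0 \<le> ?x powr (-(1/16)) - ?y powr (-(1/16))" by (simp add: powr_mono2')
      have "?x powr (-(1/16)) - ?y powr (-(1/16)) = ?x powr (-(1/16)) * (1 - (?x / ?y) powr (1/16))"
        by (simp add: powr_divide powr_minus field_simps)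
      also have "\<dots> \<le> 1 * (1 - (?x / ?y) powr (1/16))"
        using powr_mono[of "-(1/16)" 0 ?x] powr_le1[of "1/16" "?x / ?y"] by (intro mult_right_mono) auto
      \<comment> \<open>The base lies below \<open>1\<close>, so raising the exponent lowers the
        power.\<close>
      also have "\<dots> \<le> 1 - (?x / ?y) powr 1"
        using powr_mono'[of "1/16" 1 "?x / ?y"] by simp
      also have "\<dots> = ?y powr (-1)" by (simp add: powr_minus field_simps)
      also have "\<dots> \<le> ?x powr (-1)" by (intro powr_mono2') auto
      also have "\<dots> \<le> ?x powr (-(3/8))" by (intro powr_mono) auto
      finally show "?x powr (-(1/16)) - ?y powr (-(1/16)) \<le> ?x powr (-(3/8))" .
    qed simp
    also have "(?x powr (-(3/8)))\<^sup>2 = s t ^ 3"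
      by (simp add: s power2_eq_square power3_eq_cube powr_add[symmetric])
    finally have "\<Delta> t \<le> (1 / c0)\<^sup>2 * s t ^ 3 * (4 * (LF + 1) * K)"
      unfolding \<Delta>_def using DF2[of "Suc t"] by (intro mult_mono) (auto simp: s)
    then show ?thesis by (simp add: K'_def mult_ac)
  qed
  obtain c C W t0 where W: "0 < c" "0 < C" "\<And>t. \<phi> t \<le> W t"
    "\<And>t. t \<ge> t0 \<Longrightarrow> W (Suc t) \<le> W t - c * r t * q t + C * (r t * s t)"
    by - (rule lyapunov_bound[OF r a _ _ \<kappa> l K' \<Delta>], simp, simp, rule that)
  have W0: "0 \<le> W t" for t using W(3) \<phi>_nonneg order_trans by blast
  have q0: "0 \<le> q t" for t by (simp add: q_def)
  \<comment> \<open>The borderline case \<open>3/4 + 1/4 = 1\<close>: the partial sums are harmonic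
    numbers and produce the logarithm.\<close>
  have rs: "r t * s t = inverse (real (Suc t))" for t
    unfolding r s powr_add[symmetric] by (simp add: powr_minus add.commute)
  have harm: "(\<Sum>t<n. r t * s t) \<le> 1 + ln (real n)" if "0 < n" for n
  proof -
    have "(\<Sum>t<n. r t * s t) = harm n"
      unfolding rs harm_def by (rule sum.reindex_bij_witness[of _ "\<lambda>k. k - 1" Suc]) auto
    then show ?thesis
      using euler_mascheroni_sequence_decreasing[of 1 n] that by (simp add: harm_expand)
  qed
  show ?thesis
  proof (rule stationarity)
    show "(\<lambda>T. \<integral>\<omega>. gap P (z T \<omega>) \<partial>M) \<in> O(\<lambda>T. real T powr (-(1/16)))"
    proof (intro bigoI[of _ "K / c0"] eventually_sequentiallyI[of 1])
      fix t :: nat assume t: "1 \<le> t"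
      have "?Eg t \<le> K / penalty S t" using Eg[of t] penalty_pos[of t] by (simp add: field_simps)
      also have "\<dots> = K / c0 * (1 + real t) powr (-(1/16))" by (simp add: pen powr_minus field_simps)
      also have "\<dots> \<le> K / c0 * real t powr (-(1/16))"
        using t K0 penalty(1) by (intro mult_left_mono powr_mono2') auto
      finally show "norm (?Eg t) \<le> K / c0 * norm (real t powr (-(1/16)))" using gap_integral_nonneg[of t] by simp
    qed
  next
    fix m :: "nat \<Rightarrow> real"
    assume m: "\<And>T. 0 \<le> m T" "\<And>T t. t \<le> T \<Longrightarrow> m T \<le> penalty S (Suc t) / wmin * sqrt (q (Suc t))"
    define A where "A = c0\<^sup>2 * (2 / (wmin\<^sup>2 * c)) * (W t0 + 3 * C)"
    have A: "0 \<le> A" using W(1,2) W0[of t0] by (simp add: A_def)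
    show "m \<in> O(\<lambda>T. real T powr (-(1/16)) * sqrt (ln (real T)))"
    proof (rule bigo_of_sq[OF m(1) A])
      \<comment> \<open>\<open>T \<ge> 3\<close> gives \<open>ln T \<ge> 1\<close> and
        \<open>T + 2 \<le> T^2\<close>, so all constants can be absorbed into multiples of
        \<open>ln T\<close>.\<close>
      fix T assume T: "2 * t0 + 3 \<le> T"
      have s0: "0 < s t" for t by (simp add: s)
      have lnT: "1 \<le> ln (real T)"
        using T exp_le by (subst ln_ge_iff) (auto intro: order_trans)
      have "3 * real T \<le> real T * real T" using T by (intro mult_right_mono) auto
      then have "real (T + 2) \<le> (real T)\<^sup>2" using T unfolding power2_eq_square by linarith
      then have "ln (real (T + 2)) \<le> 2 * ln (real T)"
        using T ln_mono[of "real (T + 2)" "(real T)\<^sup>2"] by (simp add: ln_realpow)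
      then have "C * (\<Sum>t<T+2. r t * s t) \<le> C * (3 * ln (real T))"
        using harm[of "T + 2"] lnT W(2) by (intro mult_left_mono) auto
      moreover have "W t0 \<le> W t0 * ln (real T)" using W0[of t0] lnT by (simp add: mult_le_cancel_left1)
      ultimately have log: "W t0 + C * (\<Sum>t<T+2. r t * s t) \<le> (W t0 + 3 * C) * ln (real T)"
        by (simp add: distrib_right)
      have "(m T)\<^sup>2 \<le> (penalty S (Suc T))\<^sup>2 * (real T + 2) powr (-(1/4)) * (2 / (wmin\<^sup>2 * c))
          * (W t0 + C * (\<Sum>t<T+2. r t * s t))"
        using T by (intro min_rate[OF W(4) W0 q0 W(1,2) wmin_pos _ s0 penalty(3) penalty_pos m]) (auto simp: r)
      also have "\<dots> \<le> (penalty S (Suc T))\<^sup>2 * (real T + 2) powr (-(1/4)) * (2 / (wmin\<^sup>2 * c))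
          * ((W t0 + 3 * C) * ln (real T))"
        using W(1) log by (intro mult_left_mono) auto
      \<comment> \<open>The squared penalty grows with exponent \<open>1/8\<close> and halves the
        decay \<open>-1/4\<close>.\<close>
      also have "(penalty S (Suc T))\<^sup>2 * (real T + 2) powr (-(1/4)) = c0\<^sup>2 * (real T + 2) powr (-(1/8))"
        by (simp add: pen power_mult_distrib power2_eq_square powr_add[symmetric] add.commute)
      also have "c0\<^sup>2 * (real T + 2) powr (-(1/8)) * (2 / (wmin\<^sup>2 * c)) * ((W t0 + 3 * C) * ln (real T))
          = A * ((real T + 2) powr (-(1/8)) * ln (real T))" by (simp add: A_def)
      also have "\<dots> \<le> A * (real T powr (-(1/16)) * sqrt (ln (real T)))\<^sup>2"
      proof (rule mult_left_mono[OF _ A])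
        have "(real T + 2) powr (-(1/8)) \<le> real T powr (-(1/8))" using T by (intro powr_mono2') auto
        also have "\<dots> = (real T powr (-(1/16)))\<^sup>2" by (simp add: power2_eq_square powr_add[symmetric])
        finally show "(real T + 2) powr (-(1/8)) * ln (real T) \<le> (real T powr (-(1/16)) * sqrt (ln (real T)))\<^sup>2"
          using lnT by (simp add: power_mult_distrib mult_right_mono)
      qed
      finally show "(m T)\<^sup>2 \<le> A * (real T powr (-(1/16)) * sqrt (ln (real T)))\<^sup>2" .
    qed simp
  qed
qed

end

theorem theorem2:
  fixes P :: "('s, 'r, 'm::finite, 'dx::finite, 'dy::finite) problem"
    and Flow Lf Lg LF \<rho>x \<rho>y c0 \<delta> \<sigma> :: real
    and x0 :: "real^'dx" and y0 :: "real^'dy"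
  assumes data: "stochastic_data P"
    and smoothing: "0 < smoothing P"
    and ideal: "\<And>i p. ideal P $ i < objf P i p"
    and pref: "pref P \<in> prob_simplex_pos"
    and A1: "\<And>i. bdd_below (range (objf P i))" "\<And>p. Flow \<le> stch P p"
    and A2: "\<And>i. lipschitz_gradient Lf (objf P i)" "lipschitz_gradient Lg (objg P)"
      "lipschitz_gradient LF (stch P)"
    and weakly_convex: "0 < \<rho>x" "0 < \<rho>y"
      "convex_on UNIV (\<lambda>(x, y). objg P (x, y) + \<rho>x / 2 * (norm x)\<^sup>2 + \<rho>y / 2 * (norm y)\<^sup>2)"
    and gam: "0 < gam P" "gam P < 1 / (2 * \<rho>y)"
    and c0: "0 < c0"
    and \<delta>: "0 < \<delta>" "\<delta> < 1/8"
  shows "\<exists>\<alpha>0 ubx uby. 0 < \<alpha>0 \<and> (\<forall>t. 0 < ubx t \<and> 0 < uby t) \<and> decseq ubx \<and> decseq uby \<and>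
    (\<forall>S (M :: 'w measure) B R.
       prob_space M \<and> independent_minibatches P M B \<and> momeha P S x0 y0 M B R \<and>
       constraint_regular P M R \<and> stochastic_directions P S \<sigma> M B R \<and> admissible ubx uby S
       \<longrightarrow>
       (penalty S = (\<lambda>t. c0) \<and>
        step_theta S = (\<lambda>t. \<alpha>0 * (1 + real t) powr (- (3/8 + \<delta>)))
        \<longrightarrow> stationary_in_expectation P M R (\<lambda>T. 1) (\<lambda>T. real T powr (- (1/8 - \<delta>))))
       \<and>
       (penalty S = (\<lambda>t. c0 * (1 + real t) powr (1/16)) \<and>
        step_theta S = (\<lambda>t. \<alpha>0 * (1 + real t) powr (- (3/8))) \<and>
        (\<exists>K. \<forall>t. (\<integral>\<omega>. penalized P Flow (penalty S t) (it_x R t \<omega>, it_y R t \<omega>) \<partial>M) \<le> K)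
        \<longrightarrow> stationary_in_expectation P M R (\<lambda>T. real T powr (- (1/16)))
              (\<lambda>T. real T powr (- (1/16)) * sqrt (ln (real T)))))"
proof -
  \<comment> \<open>With this exponent \<open>r * s\<close> is exactly harmonic for
    \<open>step_theta\<close> of exponent \<open>-3/8\<close>, while the sum of \<open>r\<close>
    still diverges like \<open>T powr (1/4)\<close>.\<close>
  define r :: "nat \<Rightarrow> real" where "r = (\<lambda>t. (1 + real t) powr (-(3/4)))"
  have problem: "bilevel P Flow Lf Lg LF \<rho>x \<rho>y"
    using data smoothing pref A1(2) A2 weakly_convex gam by unfold_locales
  \<comment> \<open>The factor \<open>1\<close> is the witness for \<open>\<alpha>0\<close>, kept so
    that the final instantiation matches.\<close>
  have main: "(penalty S = (\<lambda>t. c0) \<and> step_theta S = (\<lambda>t. 1 * (1 + real t) powr (- (3/8 + \<delta>)))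
        \<longrightarrow> stationary_in_expectation P M R (\<lambda>T. 1) (\<lambda>T. real T powr (- (1/8 - \<delta>)))) \<and>
       (penalty S = (\<lambda>t. c0 * (1 + real t) powr (1/16)) \<and>
        step_theta S = (\<lambda>t. 1 * (1 + real t) powr (- (3/8))) \<and>
        (\<exists>K. \<forall>t. (\<integral>\<omega>. penalized P Flow (penalty S t) (it_x R t \<omega>, it_y R t \<omega>) \<partial>M) \<le> K)
        \<longrightarrow> stationary_in_expectation P M R (\<lambda>T. real T powr (- (1/16)))
              (\<lambda>T. real T powr (- (1/16)) * sqrt (ln (real T))))"
    if M: "prob_space M" "independent_minibatches P M B" "momeha P S x0 y0 M B R"
      and dirs: "stochastic_directions P S \<sigma> M B R" and adm: "admissible r r S"
    for S and M :: "'w measure" and B R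
  proof -
    interpret bilevel P Flow Lf Lg LF \<rho>x \<rho>y by (rule problem)
    interpret prob_space M by (rule M(1))
    have steps: "\<And>t. 0 < step_x S t" "\<And>t. 0 < step_y S t" "\<And>t. step_x S t \<le> r t" "\<And>t. step_y S t \<le> r t"
      "\<And>t. step_x S t \<le> step_y S t" "\<And>t. 0 \<le> momentum S t" "\<And>t. momentum S t < 1"
      using adm by (auto simp: admissible_def)
    \<comment> \<open>The lower bound in \<open>admissible\<close> makes \<open>step_x\<close>
      eventually at least a multiple of \<open>r\<close>; \<open>step_x S t \<le> step_y S t\<close>
      passes this on to \<open>step_y\<close>.\<close>
    obtain \<kappa> where \<kappa>: "0 < \<kappa>" "\<forall>\<^sub>F t in sequentially. \<kappa> * norm (min (r t) (r t)) \<le> norm (step_x S t)"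
      using adm unfolding admissible_def by (auto elim: landau_omega.bigE)
    from \<kappa>(2) have \<kappa>': "\<forall>\<^sub>F t in sequentially. \<kappa> * r t \<le> step_x S t \<and> \<kappa> * r t \<le> step_y S t"
    proof eventually_elim
      case (elim t)
      then show ?case using steps(1,5)[of t] by (simp add: r_def)
    qed
    have \<Theta>: "(\<lambda>t. 1 - momentum S t) \<in> \<Theta>(\<lambda>t. step_theta S t powr (2/3))"
      using adm by (simp add: admissible_def)
    obtain l where l: "0 < l" "\<forall>\<^sub>F t in sequentially. l * norm (step_theta S t powr (2/3)) \<le> norm (1 - momentum S t)"
      using bigthetaD2[OF \<Theta>] by (rule landau_omega.bigE)
    obtain L where L: "0 < L" "\<forall>\<^sub>F t in sequentially. norm (1 - momentum S t) \<le> L * norm (step_theta S t powr (2/3))"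
      using bigthetaD1[OF \<Theta>] by (rule landau_o.bigE)
    have lL: "\<forall>\<^sub>F t in sequentially. l * step_theta S t powr (2/3) \<le> 1 - momentum S t
        \<and> 1 - momentum S t \<le> L * step_theta S t powr (2/3)"
      using l(2) L(2)
    proof eventually_elim
      case (elim t)
      then show ?case using steps(7)[of t] by simp
    qed
    have mv: "mean_variance M (filt_theta P M B t) \<sigma>
        (\<lambda>\<omega>. grad_ghat P (bsize B (GTheta t)) (it_x R t \<omega>, it_theta R t \<omega>) (rho_theta B t \<omega>))
        (\<lambda>\<omega>. nabla (objg P) (it_x R t \<omega>, it_theta R t \<omega>))" for t
      using dirs by (simp add: stochastic_directions_def)
    obtain bx by' K where "\<forall>t. bx t \<in> borel_measurable (filt_x P M B t) \<and> by' t \<in> borel_measurable (filt_y P M B t) \<and>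
        mean_variance M (filt_x P M B t) \<sigma> (dhat_x P S B R t) (\<lambda>\<omega>. d_x P S R t \<omega> + bx t \<omega>) \<and>
        mean_variance M (filt_y P M B t) \<sigma> (dhat_y P S B R t) (\<lambda>\<omega>. d_y P S R t \<omega> + by' t \<omega>) \<and>
        (AE \<omega> in M. norm (bx t \<omega>) \<le> K * step_theta S t powr (2/3)) \<and>
        (AE \<omega> in M. norm (by' t \<omega>) \<le> K * step_theta S t powr (2/3))"
      using dirs unfolding stochastic_directions_def by (elim conjE exE) (rule that)
    then have b:
      "\<And>t. bx t \<in> borel_measurable (filt_x P M B t)" "\<And>t. by' t \<in> borel_measurable (filt_y P M B t)"
      "\<And>t. mean_variance M (filt_x P M B t) \<sigma> (dhat_x P S B R t) (\<lambda>\<omega>. d_x P S R t \<omega> + bx t \<omega>)"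
      "\<And>t. mean_variance M (filt_y P M B t) \<sigma> (dhat_y P S B R t) (\<lambda>\<omega>. d_y P S R t \<omega> + by' t \<omega>)"
      "\<And>t. AE \<omega> in M. norm (bx t \<omega>) \<le> K * step_theta S t powr (2/3)"
      "\<And>t. AE \<omega> in M. norm (by' t \<omega>) \<le> K * step_theta S t powr (2/3)"
      by simp_all
    have run: "momeha_run P Flow Lf Lg LF \<rho>x \<rho>y M S x0 y0 B R \<sigma> c0 K bx by' r"
      if "\<And>t. 0 < step_theta S t" "\<And>t. c0 \<le> penalty S t" "incseq (penalty S)"
      by (intro momeha_run.intro momeha_run_axioms.intro problem M mv b steps that c0)
    show ?thesis
    proof (intro conjI impI; elim conjE)
      assume pen: "penalty S = (\<lambda>t. c0)" and "step_theta S = (\<lambda>t. 1 * (1 + real t) powr (- (3/8 + \<delta>)))"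
      then have a: "step_theta S = (\<lambda>t. (1 + real t) powr (- (3/8 + \<delta>)))" by simp
      interpret momeha_run P Flow Lf Lg LF \<rho>x \<rho>y M S x0 y0 B R \<sigma> c0 K bx by' r
        by (rule run) (simp_all add: a pen)
      show "stationary_in_expectation P M R (\<lambda>T. 1) (\<lambda>T. real T powr (- (1/8 - \<delta>)))"
        by (rule stationary_constant_penalty[OF r_def a \<delta> pen \<kappa>(1) \<kappa>' l(1) L(1) lL[folded s_def \<eta>_def]])
    next
      assume pen: "penalty S = (\<lambda>t. c0 * (1 + real t) powr (1/16))"
        and "step_theta S = (\<lambda>t. 1 * (1 + real t) powr (- (3/8)))"
        and bdd: "\<exists>K. \<forall>t. (\<integral>\<omega>. penalized P Flow (penalty S t) (it_x R t \<omega>, it_y R t \<omega>) \<partial>M) \<le> K"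
      then have a: "step_theta S = (\<lambda>t. (1 + real t) powr (- (3/8)))" by simp
      have "c0 \<le> penalty S t" for t
        using c0 powr_mono[of 0 "1/16" "1 + real t"] by (simp add: pen)
      moreover have "incseq (penalty S)"
        unfolding pen using c0 by (intro incseq_SucI mult_left_mono powr_mono2) auto
      ultimately interpret momeha_run P Flow Lf Lg LF \<rho>x \<rho>y M S x0 y0 B R \<sigma> c0 K bx by' r
        by (intro run) (simp_all add: a)
      obtain K' where "\<And>t. (\<integral>\<omega>. penalized P Flow (penalty S t) (z t \<omega>) \<partial>M) \<le> K'"
        using bdd unfolding z_def by blast
      then show "stationary_in_expectation P M R (\<lambda>T. real T powr (- (1/16)))
          (\<lambda>T. real T powr (- (1/16)) * sqrt (ln (real T)))"
        by (rule stationary_growing_penalty[OF r_def a pen _ \<kappa>(1) \<kappa>' l(1) L(1) lL[folded s_def \<eta>_def]])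
    qed
  qed
  have pos: "\<forall>t. 0 < r t \<and> 0 < r t" and dec: "decseq r"
    unfolding r_def by (auto intro!: powr_neg_decseq)
  show ?thesis
    by (intro exI[of _ "1::real"] exI[of _ r] conjI[OF zero_less_one conjI[OF pos conjI[OF dec conjI[OF dec]]]]
        allI impI main; elim conjE; assumption)
qed

end
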